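(* Let $(\mathbf B_t)_{t\ge0}$ and $(\mathbf B'_t)_{t\ge0}$ be a coupling by reflection of two Heisenberg Brownian motions starting in $(x,y,z)$ and $(x',y',z')$. Then, for every $p\in(0,1)$, $$\sup_{t\ge0}\mathbb E\left[d_{\mathbb H}(\mathbf B_t,\mathbf B'_t)^p\right]<+\infty.$$ Moreover, if for $a,a'\in\mathbb H$ the pair $(\mathbf B^a_t,\mathbf B^{a'}_t)_{t\ge0}$ denotes the coupling by reflection of two Heisenberg Brownian motions starting in $a$ and $a'$, then for every $p\in(0,1)$, $$\sup_{a\neq a'\in\mathbb H}\ \sup_{t\ge0}\ \frac{\mathbb E\left[d_{\mathbb H}(\mathbf B_t^a,\mathbf B_t^{a'})^p\right]}{d_{\mathbb H}(a,a')^p}<+\infty.$$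
   Context: Heisenberg group: $\mathbb H=\mathbb R^3$ with the group law $(x,y,z)\cdot(x',y',z')=\left(x+x',y+y',z+z'+\tfrac12(xy'-yx')\right)$. Left-invariant vector fields: $X=\partial_x-\tfrac y2\partial_z$, $Y=\partial_y+\tfrac x2\partial_z$. Distance: $d_{\mathbb H}(a,a')=\inf_\gamma\int_0^1|\dot\gamma(t)|_{\mathrm h}\,dt$, the infimum being over horizontal curves $\gamma:[0,1]\to\mathbb H$ from $a$ to $a'$, i.e. absolutely continuous curves with $\dot\gamma(t)\in\mathrm{Vect}(X(\gamma(t)),Y(\gamma(t)))$ for almost every $t$; $|\cdot|_{\mathrm h}$ is the Euclidean norm on $\mathrm{Vect}(X,Y)$ making $(X,Y)$ orthonormal (Carnot–Carathéodory distance). Heisenberg Brownian motion starting in $a\in\mathbb H$: a process with the law of $\mathbf B^a_t=a\cdot\left(B^1_t,B^2_t,\tfrac12\left(\int_0^tB^1_s\,dB^2_s-\int_0^tB^2_s\,dB^1_s\right)\right)$, where $B^1,B^2$ are independent standard one-dimensional Brownian motions starting at $0$. Such a process is determined by its starting point and its first two coordinates (its horizontal part), a planar Brownian motion: if $(\beta^1,\beta^2)$ is the horizontal part, the third coordinate $A$ satisfies $dA_t=\tfrac12(\beta^1_t\,d\beta^2_t-\beta^2_t\,d\beta^1_t)$. Coupling by reflection of two Heisenberg Brownian motions with starting points $a=(x,y,z)$, $a'=(x',y',z')$: the horizontal parts $B_t,B'_t\in\mathbb R^2$ (starting at $(x,y)$ and $(x',y')$) are coupled by reflection, i.e. $B'$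 is the mirror image of $B$ with respect to the perpendicular bisector of the segment $[B_0,B'_0]$ up to the time $\tau=\inf\{s\ge0: B_s=B'_s\}$, and $B'_t=B_t$ for $t\ge\tau$ (if $B_0=B'_0$ then $\tau=0$ and $B'=B$). *)

theory Defs
  imports "HOL-Probability.Probability"
begin

section \<open>The Heisenberg group and its Carnot--Caratheodory distance\<close>

type_synonym heis = "real \<times> real \<times> real"

fun heis_mult :: "heis \<Rightarrow> heis \<Rightarrow> heis" where
  "heis_mult (x, y, z) (x', y', z') = (x + x', y + y', z + z' + (x * y' - y * x') / 2)"

fun hor :: "heis \<Rightarrow> real \<times> real" where
  "hor (x, y, z) = (x, y)"

fun field_X :: "heis \<Rightarrow> heis" where
  "field_X (x, y, z) = (1, 0, - y / 2)"

fun field_Y :: "heis \<Rightarrow> heis" where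
  "field_Y (x, y, z) = (0, 1, x / 2)"

text \<open>The Euclidean norm on the span of the two vectors \<open>field_X q\<close>, \<open>field_Y q\<close> for which they
  are orthonormal. It is only meaningful for vectors in this span, where the coefficients
  \<open>u\<close>, \<open>v\<close> are unique.\<close>

definition hnorm :: "heis \<Rightarrow> heis \<Rightarrow> real" where
  "hnorm q w = (THE r. \<exists>u v. w = u *\<^sub>R field_X q + v *\<^sub>R field_Y q \<and> r = sqrt (u\<^sup>2 + v\<^sup>2))"

lemma hnorm_frame: "hnorm q (u *\<^sub>R field_X q + v *\<^sub>R field_Y q) = sqrt (u\<^sup>2 + v\<^sup>2)"
  unfolding hnorm_def by (cases q) (auto intro!: the_equality)

definition absolutely_continuous_on :: "real set \<Rightarrow> (real \<Rightarrow> 'a::real_normed_vector) \<Rightarrow> bool" where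
  "absolutely_continuous_on S f \<longleftrightarrow>
    (\<forall>\<epsilon>>0. \<exists>\<delta>>0. \<forall>(n::nat) l r.
      (\<forall>i<n. l i \<le> r i \<and> {l i..r i} \<subseteq> S) \<and>
      disjoint_family_on (\<lambda>i. {l i<..<r i}) {..<n} \<and>
      (\<Sum>i<n. r i - l i) < \<delta> \<longrightarrow>
      (\<Sum>i<n. norm (f (r i) - f (l i))) < \<epsilon>)"

definition horizontal_curve :: "(real \<Rightarrow> heis) \<Rightarrow> bool" where
  "horizontal_curve \<gamma> \<longleftrightarrow>
    absolutely_continuous_on {0..1} \<gamma> \<and>
    (AE t in lebesgue. t \<in> {0..1} \<longrightarrow>
      \<gamma> differentiable (at t) \<and>
      vector_derivative \<gamma> (at t) \<in> span {field_X (\<gamma> t), field_Y (\<gamma> t)})"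

definition hlength :: "(real \<Rightarrow> heis) \<Rightarrow> ennreal" where
  "hlength \<gamma> = (\<integral>\<^sup>+ t \<in> {0..1}. ennreal (hnorm (\<gamma> t) (vector_derivative \<gamma> (at t))) \<partial>lebesgue)"

text \<open>Any two points are joined by a horizontal curve of finite length, so the infimum is finite
  and \<open>enn2real\<close> loses nothing.\<close>

definition dist_H :: "heis \<Rightarrow> heis \<Rightarrow> real" where
  "dist_H a a' =
    enn2real (INF \<gamma> \<in> {\<gamma>. horizontal_curve \<gamma> \<and> \<gamma> 0 = a \<and> \<gamma> 1 = a'}. hlength \<gamma>)"


section \<open>Brownian motion and the Ito integral\<close>

text \<open>Processes are indexed by all reals; only times \<open>t \<ge> 0\<close> matter.\<close>

definition standard_BM :: "'w measure \<Rightarrow> (real \<Rightarrow> 'w \<Rightarrow> real) \<Rightarrow> bool" where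
  "standard_BM M W \<longleftrightarrow>
    prob_space M \<and>
    (\<forall>t\<ge>0. W t \<in> borel_measurable M) \<and>
    (AE \<omega> in M. W 0 \<omega> = 0) \<and>
    (\<forall>s t. 0 \<le> s \<and> s < t \<longrightarrow>
      distributed M lborel (\<lambda>\<omega>. W t \<omega> - W s \<omega>) (normal_density 0 (sqrt (t - s)))) \<and>
    (\<forall>(n::nat) \<theta>. 0 \<le> \<theta> 0 \<and> (\<forall>i<n. \<theta> i \<le> \<theta> (Suc i)) \<longrightarrow>
      prob_space.indep_vars M (\<lambda>_. borel) (\<lambda>i \<omega>. W (\<theta> (Suc i)) \<omega> - W (\<theta> i) \<omega>) {..<n}) \<and>
    (AE \<omega> in M. continuous_on {0..} (\<lambda>t. W t \<omega>))"

definition indep_processes ::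
  "'w measure \<Rightarrow> (real \<Rightarrow> 'w \<Rightarrow> real) \<Rightarrow> (real \<Rightarrow> 'w \<Rightarrow> real) \<Rightarrow> bool" where
  "indep_processes M U V \<longleftrightarrow>
    prob_space.indep_var M
      (PiM {0..} (\<lambda>_. borel)) (\<lambda>\<omega>. \<lambda>t\<in>{0..}. U t \<omega>)
      (PiM {0..} (\<lambda>_. borel)) (\<lambda>\<omega>. \<lambda>t\<in>{0..}. V t \<omega>)"

definition planar_BM :: "'w measure \<Rightarrow> (real \<Rightarrow> 'w \<Rightarrow> real) \<Rightarrow> (real \<Rightarrow> 'w \<Rightarrow> real) \<Rightarrow> bool" where
  "planar_BM M B1 B2 \<longleftrightarrow> standard_BM M B1 \<and> standard_BM M B2 \<and> indep_processes M B1 B2"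

text \<open>The sigma-algebra on the sample space generated by \<open>(U s, V s)\<close>, \<open>0 \<le> s \<le> t\<close>.\<close>

definition natural_filtration ::
  "'w measure \<Rightarrow> (real \<Rightarrow> 'w \<Rightarrow> real) \<Rightarrow> (real \<Rightarrow> 'w \<Rightarrow> real) \<Rightarrow> real \<Rightarrow> 'w measure" where
  "natural_filtration M U V t =
    vimage_algebra (space M) (\<lambda>\<omega>. \<lambda>s\<in>{0..t}. (U s \<omega>, V s \<omega>)) (PiM {0..t} (\<lambda>_. borel))"

text \<open>An elementary (simple adapted) process on \<open>[0, T]\<close> is given by subdivision points
  \<open>\<theta> 0 \<le> \<dots> \<le> \<theta> n\<close> and square-integrable values \<open>e i\<close>, taken on \<open>[\<theta> i, \<theta> (i + 1))\<close> and
  measurable with respect to the past of time \<open>\<theta> i\<close>.\<close>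

definition elementary ::
  "'w measure \<Rightarrow> (real \<Rightarrow> 'w measure) \<Rightarrow> real \<Rightarrow> nat \<Rightarrow> (nat \<Rightarrow> real) \<Rightarrow> (nat \<Rightarrow> 'w \<Rightarrow> real) \<Rightarrow> bool"
  where
  "elementary M F T n \<theta> e \<longleftrightarrow>
    0 \<le> \<theta> 0 \<and> \<theta> n \<le> T \<and> (\<forall>i<n. \<theta> i \<le> \<theta> (Suc i)) \<and>
    (\<forall>i<n. e i \<in> borel_measurable (F (\<theta> i)) \<and> integrable M (\<lambda>\<omega>. (e i \<omega>)\<^sup>2))"

definition elem_process ::
  "nat \<Rightarrow> (nat \<Rightarrow> real) \<Rightarrow> (nat \<Rightarrow> 'w \<Rightarrow> real) \<Rightarrow> real \<Rightarrow> 'w \<Rightarrow> real" where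
  "elem_process n \<theta> e s \<omega> = (\<Sum>i<n. e i \<omega> * indicator {\<theta> i..<\<theta> (Suc i)} s)"

definition elem_integral ::
  "(real \<Rightarrow> 'w \<Rightarrow> real) \<Rightarrow> nat \<Rightarrow> (nat \<Rightarrow> real) \<Rightarrow> (nat \<Rightarrow> 'w \<Rightarrow> real) \<Rightarrow> 'w \<Rightarrow> real" where
  "elem_integral W n \<theta> e \<omega> = (\<Sum>i<n. e i \<omega> * (W (\<theta> (Suc i)) \<omega> - W (\<theta> i) \<omega>))"

text \<open>The random variable \<open>I\<close> is a version of the Ito integral of \<open>f\<close> against \<open>W\<close> over \<open>[0, T]\<close>:
  the \<open>L\<^sup>2\<close>-limit of the integrals of elementary processes that converge to \<open>f\<close> in
  \<open>L\<^sup>2([0, T] \<times> M)\<close>. By the Ito isometry, \<open>I\<close> is unique up to null sets if \<open>W\<close> is a Brownian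
  motion for the filtration \<open>F\<close>.\<close>

definition ito_integral ::
  "'w measure \<Rightarrow> (real \<Rightarrow> 'w measure) \<Rightarrow> (real \<Rightarrow> 'w \<Rightarrow> real) \<Rightarrow> (real \<Rightarrow> 'w \<Rightarrow> real) \<Rightarrow>
    real \<Rightarrow> ('w \<Rightarrow> real) \<Rightarrow> bool" where
  "ito_integral M F W f T I \<longleftrightarrow>
    I \<in> borel_measurable M \<and>
    (\<exists>n \<theta> e.
      (\<forall>k::nat. elementary M F T (n k) (\<theta> k) (e k)) \<and>
      (\<lambda>k. \<integral>\<^sup>+ \<omega>. (\<integral>\<^sup>+ s \<in> {0..T}.
          ennreal ((f s \<omega> - elem_process (n k) (\<theta> k) (e k) s \<omega>)\<^sup>2) \<partial>lborel) \<partial>M)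
        \<longlonglongrightarrow> 0 \<and>
      (\<lambda>k. \<integral>\<^sup>+ \<omega>. ennreal ((I \<omega> - elem_integral W (n k) (\<theta> k) (e k) \<omega>)\<^sup>2) \<partial>M) \<longlonglongrightarrow> 0)"


section \<open>Heisenberg Brownian motion and coupling by reflection\<close>

text \<open>\<open>L1 t\<close> and \<open>L2 t\<close> are the integrals of \<open>B1\<close> against \<open>B2\<close> and of \<open>B2\<close> against \<open>B1\<close>
  over \<open>[0, t]\<close>. The driving planar Brownian motion is recovered from the horizontal part, so
  asking for it on the sample space of \<open>P\<close> is no restriction on the law of \<open>P\<close>.\<close>

definition heis_BM :: "'w measure \<Rightarrow> heis \<Rightarrow> (real \<Rightarrow> 'w \<Rightarrow> heis) \<Rightarrow> bool" where
  "heis_BM M a P \<longleftrightarrow>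
    (\<forall>t\<ge>0. P t \<in> borel_measurable M) \<and>
    (AE \<omega> in M. continuous_on {0..} (\<lambda>t. P t \<omega>)) \<and>
    (\<exists>B1 B2 L1 L2.
      planar_BM M B1 B2 \<and>
      (\<forall>t\<ge>0. ito_integral M (natural_filtration M B1 B2) B2 B1 t (L1 t) \<and>
             ito_integral M (natural_filtration M B1 B2) B1 B2 t (L2 t)) \<and>
      (AE \<omega> in M. \<forall>t\<ge>0. P t \<omega> = heis_mult a (B1 t \<omega>, B2 t \<omega>, (L1 t \<omega> - L2 t \<omega>) / 2)))"

text \<open>Orthogonal reflection in the perpendicular bisector of the segment \<open>[b, b']\<close>. For \<open>b = b'\<close>
  the quotient is a division by zero and the map is the identity.\<close>

definition mirror :: "'a::real_inner \<Rightarrow> 'a \<Rightarrow> 'a \<Rightarrow> 'a" where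
  "mirror b b' v =
    v - (2 * ((v - midpoint b b') \<bullet> (b' - b)) / ((b' - b) \<bullet> (b' - b))) *\<^sub>R (b' - b)"

text \<open>First meeting time of the horizontal parts, equal to \<open>\<infinity>\<close> if they never meet.\<close>

definition meeting_time :: "(real \<Rightarrow> 'w \<Rightarrow> heis) \<Rightarrow> (real \<Rightarrow> 'w \<Rightarrow> heis) \<Rightarrow> 'w \<Rightarrow> ereal" where
  "meeting_time P P' \<omega> = Inf {ereal s | s. 0 \<le> s \<and> hor (P s \<omega>) = hor (P' s \<omega>)}"

definition reflection_coupling ::
  "'w measure \<Rightarrow> heis \<Rightarrow> heis \<Rightarrow> (real \<Rightarrow> 'w \<Rightarrow> heis) \<Rightarrow> (real \<Rightarrow> 'w \<Rightarrow> heis) \<Rightarrow> bool" where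
  "reflection_coupling M a a' P P' \<longleftrightarrow>
    heis_BM M a P \<and> heis_BM M a' P' \<and>
    (AE \<omega> in M. \<forall>t\<ge>0.
      (ereal t \<le> meeting_time P P' \<omega> \<longrightarrow>
        hor (P' t \<omega>) = mirror (hor a) (hor a') (hor (P t \<omega>))) \<and>
      (meeting_time P P' \<omega> \<le> ereal t \<longrightarrow> hor (P' t \<omega>) = hor (P t \<omega>)))"

end

theory Submission
  imports Defs
begin

text \<open>The distance from \<open>a\<close> to \<open>a'\<close> is comparable to the gauge \<open>|\<Delta>| + |\<zeta>|\<^sup>1\<^sup>/\<^sup>2\<close>, where \<open>(\<Delta>, \<zeta>) = a\<^sup>-\<^sup>1 \<cdot> a'\<close>.
  Along the coupling, \<open>\<Delta> = \<rho> u\<close> with a fixed unit vector \<open>u\<close>, where \<open>\<rho>\<close> is a linear Brownian motion of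
  variance \<open>4 t\<close> started in \<open>r\<close> and stopped in \<open>0\<close>, and \<open>d\<zeta> = \<rho> dw\<close>, where \<open>w\<close> is the component of the
  planar Brownian motion orthogonal to \<open>u\<close>. By optional stopping \<open>\<rho>\<close> reaches \<open>K\<close> with probability at most
  \<open>r / K\<close>, and its expected time in \<open>(0, K)\<close> is at most \<open>r K / 4\<close>. The second moment of the part of the
  increment of \<open>\<zeta>\<close> that is collected while \<open>\<rho> < K\<close> is thus at most \<open>r K\<^sup>3 / 4\<close>, and the choice \<open>K\<^sup>2 = \<lambda>\<close> shows
  that both \<open>\<rho>\<close> and \<open>|\<zeta> - \<zeta>\<^sub>0|\<^sup>1\<^sup>/\<^sup>2\<close> have tails of order \<open>r / s\<close> uniformly in time. So their \<open>p\<close>-th moments are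
  bounded by a multiple of \<open>r\<^sup>p\<close> for \<open>p < 1\<close>.

  All of this is done on grids of mesh \<open>t / n\<close>, with stochastic integrals replaced by Riemann sums, so that
  only second and fourth moments of independent increments are needed.\<close>

section \<open>The Carnot--Caratheodory distance\<close>

text \<open>For distinct horizontal starting points the meeting time has infinite mean, and the
  second moment of \<open>\<zeta> - \<zeta>\<^sub>0\<close> grows without bound in time. Hence the
  cut at a level \<open>K\<close>, and hence tails of weak type only, which control moments of
  exponent below 1. Three obstacles shape the discretisation. The Ito integral is given by an
  unspecified sequence of elementary processes; an isometry carries it over to Riemann sums. The two
  motions have driving Brownian motions and filtrations of their own, so four stochastic integrals
  are approximated separately on one grid, and the coupling is used path by path. A walk seen on a
  grid overshoots the levels 0 and \<open>K\<close>; fourth moments of its steps control this with a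
  free parameter \<delta>: the grid is refined at fixed \<delta>, and only then \<delta> tends to 0.
  Averaging the separation over both ends of a cell makes the height increment exact. The price is a
  covariation sum with vanishing second moment and one term from the cell in which the motions
  meet.\<close>

text \<open>A tagged division is a finite set without numbering, so the numbered intervals of the
  definition are transported along a bijection with \<open>{..<card I}\<close>.\<close>

lemma absolutely_continuous_on_finite_family:
  fixes f :: "real \<Rightarrow> 'a::real_normed_vector"
  assumes "absolutely_continuous_on S f" "\<epsilon> > 0"
  shows "\<exists>\<delta>>0. \<forall>(I :: 'i set) l r. finite I \<longrightarrow> (\<forall>i\<in>I. l i \<le> r i \<and> {l i..r i} \<subseteq> S) \<longrightarrow>
      disjoint_family_on (\<lambda>i. {l i<..<r i}) I \<longrightarrow> (\<Sum>i\<in>I. r i - l i) < \<delta> \<longrightarrow>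
      (\<Sum>i\<in>I. norm (f (r i) - f (l i))) < \<epsilon>"
proof -
  from assms obtain \<delta> where \<delta>: "\<delta> > 0"
    and *: "\<forall>(n::nat) l r. (\<forall>i<n. l i \<le> r i \<and> {l i..r i} \<subseteq> S) \<and>
      disjoint_family_on (\<lambda>i. {l i<..<r i}) {..<n} \<and>
      (\<Sum>i<n. r i - l i) < \<delta> \<longrightarrow> (\<Sum>i<n. norm (f (r i) - f (l i))) < \<epsilon>"
    unfolding absolutely_continuous_on_def by blast
  show ?thesis
  proof (intro exI[of _ \<delta>] conjI \<delta> allI impI)
    fix I :: "'i set" and l r :: "'i \<Rightarrow> real"
    assume I: "finite I" "\<forall>i\<in>I. l i \<le> r i \<and> {l i..r i} \<subseteq> S"
      "disjoint_family_on (\<lambda>i. {l i<..<r i}) I" "(\<Sum>i\<in>I. r i - l i) < \<delta>"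
    obtain h where h: "bij_betw h {..<card I} I"
      using ex_bij_betw_nat_finite[OF I(1)] by (auto simp: atLeast0LessThan)
    have inj: "inj_on h {..<card I}" and im: "h ` {..<card I} = I"
      using h by (auto simp: bij_betw_def)
    have "(\<Sum>i<card I. norm (f (r (h i)) - f (l (h i)))) < \<epsilon>"
    proof (rule *[rule_format], intro conjI)
      show "\<forall>i<card I. l (h i) \<le> r (h i) \<and> {l (h i)..r (h i)} \<subseteq> S"
        using I(2) im by blast
      show "disjoint_family_on (\<lambda>i. {l (h i)<..<r (h i)}) {..<card I}"
        unfolding disjoint_family_on_def
      proof (intro ballI impI)
        fix m n assume mn: "m \<in> {..<card I}" "n \<in> {..<card I}" "m \<noteq> n"
        then have "h m \<noteq> h n" using inj by (auto dest: inj_onD)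
        moreover have "h m \<in> I" "h n \<in> I" using mn im by auto
        ultimately show "{l (h m)<..<r (h m)} \<inter> {l (h n)<..<r (h n)} = {}"
          using disjoint_family_onD[OF I(3)] by blast
      qed
      show "(\<Sum>i<card I. r (h i) - l (h i)) < \<delta>"
        using I(4) sum.reindex_bij_betw[OF h, of "\<lambda>i. r i - l i"] by simp
    qed
    then show "(\<Sum>i\<in>I. norm (f (r i) - f (l i))) < \<epsilon>"
      using sum.reindex_bij_betw[OF h, of "\<lambda>i. norm (f (r i) - f (l i))"] by simp
  qed
qed

lemma sum_interval_lengths_le:
  fixes l r :: "'i \<Rightarrow> real"
  assumes "finite I" "\<And>i. i \<in> I \<Longrightarrow> l i \<le> r i \<and> {l i<..<r i} \<subseteq> T"
    "disjoint_family_on (\<lambda>i. {l i<..<r i}) I" "T \<in> sets lebesgue"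
  shows "ennreal (\<Sum>i\<in>I. r i - l i) \<le> emeasure lebesgue T"
proof -
  have "ennreal (\<Sum>i\<in>I. r i - l i) = (\<Sum>i\<in>I. ennreal (r i - l i))"
    using assms(2) by (subst sum_ennreal) auto
  also have "\<dots> = (\<Sum>i\<in>I. emeasure lebesgue {l i<..<r i})"
    using assms(2) by (intro sum.cong) auto
  also have "\<dots> = emeasure lebesgue (\<Union>i\<in>I. {l i<..<r i})"
    using assms by (intro sum_emeasure) auto
  also have "\<dots> \<le> emeasure lebesgue T"
    using assms by (intro emeasure_mono) auto
  finally show ?thesis .
qed

text \<open>Henstock--Kurzweil sums handle the exceptional null set directly: choose the gauge at its
  points subordinate to an open set of small measure and apply absolute continuity there.\<close>

theorem fundamental_theorem_of_calculus_absolutely_continuous: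
  fixes f :: "real \<Rightarrow> real"
  assumes ab: "a \<le> b" and ac: "absolutely_continuous_on {a..b} f" and N: "negligible N"
    and der: "\<And>x. x \<in> {a..b} - N \<Longrightarrow> (f has_vector_derivative f' x) (at x within {a..b})"
  shows "(f' has_integral (f b - f a)) {a..b}"
proof (cases "a = b")
  case True
  then show ?thesis using has_integral_refl(2)[of f' b] by simp
next
  case False
  then have ab: "a < b" using ab by simp
  \<comment> \<open>With the value 0 on \<open>N\<close>, a tag in \<open>N\<close> contributes
    nothing to the Riemann sum, and its error is the increment of \<open>f\<close> alone.\<close>
  define g where "g x = (if x \<in> N then 0 else f' x)" for x
  have "(g has_integral (f b - f a)) {a..b}"
    unfolding has_integral_factor_content_real
  proof safe
    fix e :: real assume e: "e > 0"
    have e2: "e / 2 * (b - a) > 0" using e ab by simp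
    obtain \<delta> where \<delta>: "\<delta> > 0"
      and AC: "\<forall>(I :: (real \<times> real set) set) l r. finite I \<longrightarrow>
        (\<forall>i\<in>I. l i \<le> r i \<and> {l i..r i} \<subseteq> {a..b}) \<longrightarrow>
        disjoint_family_on (\<lambda>i. {l i<..<r i}) I \<longrightarrow> (\<Sum>i\<in>I. r i - l i) < \<delta> \<longrightarrow>
        (\<Sum>i\<in>I. norm (f (r i) - f (l i))) < e / 2 * (b - a)"
      using absolutely_continuous_on_finite_family[OF ac e2, where 'i = "real \<times> real set"] by blast
    have "N \<in> sets lebesgue" using N negligible_imp_sets by blast
    then obtain T where T: "open T" "N \<subseteq> T" "(T - N) \<in> lmeasurable" "emeasure lebesgue (T - N) < ennreal \<delta>"
      using sets_lebesgue_outer_open[OF _ \<delta>] by metis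
    have Tsets: "T \<in> sets lebesgue" using T(1) by (auto intro: borel_open)
    have "emeasure lebesgue T \<le> emeasure lebesgue (T - N) + emeasure lebesgue N"
      using \<open>N \<in> sets lebesgue\<close> T(3) Tsets
      by (intro order.trans[OF emeasure_mono emeasure_subadditive]) auto
    also have "emeasure lebesgue N = 0"
      using N by (simp add: negligible_iff_null_sets null_setsD1)
    finally have Tm: "emeasure lebesgue T < ennreal \<delta>" using T(4) by simp
    have "\<forall>x. \<exists>d>0. (x \<in> {a..b} - N \<longrightarrow>
         (\<forall>y\<in>{a..b}. norm (y-x) < d \<longrightarrow> norm (f y - f x - (y-x) *\<^sub>R f' x) \<le> e / 2 * norm (y-x))) \<and>
         (x \<in> N \<longrightarrow> ball x d \<subseteq> T)"
    proof
      fix x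
      show "\<exists>d>0. (x \<in> {a..b} - N \<longrightarrow>
         (\<forall>y\<in>{a..b}. norm (y-x) < d \<longrightarrow> norm (f y - f x - (y-x) *\<^sub>R f' x) \<le> e / 2 * norm (y-x))) \<and>
         (x \<in> N \<longrightarrow> ball x d \<subseteq> T)"
      proof (cases "x \<in> N")
        case True
        then obtain d where "d > 0" "ball x d \<subseteq> T" using T(1,2) open_contains_ball by (metis subsetD)
        with True show ?thesis by auto
      next
        case xN: False
        show ?thesis
        proof (cases "x \<in> {a..b}")
          case True
          have "(f has_derivative (\<lambda>y. y *\<^sub>R f' x)) (at x within {a..b})"
            using der[of x] True xN by (auto simp: has_vector_derivative_def)
          then have "\<exists>d>0. \<forall>y\<in>{a..b}. norm (y-x) < d \<longrightarrow> norm (f y - f x - (y-x) *\<^sub>R f' x) \<le> e / 2 * norm (y-x)"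
            unfolding has_derivative_within_alt using e by (meson half_gt_zero)
          then show ?thesis using xN by auto
        qed (use xN in \<open>auto intro: exI[of _ 1]\<close>)
      qed
    qed
    then obtain d where d: "\<And>x. 0 < d x"
       "\<And>x y. \<lbrakk>x \<in> {a..b}; x \<notin> N; y \<in> {a..b}; norm (y-x) < d x\<rbrakk>
          \<Longrightarrow> norm (f y - f x - (y-x) *\<^sub>R f' x) \<le> e / 2 * norm (y-x)"
       "\<And>x. x \<in> N \<Longrightarrow> ball x (d x) \<subseteq> T"
      by (metis DiffI)
    show "\<exists>d. gauge d \<and> (\<forall>p. p tagged_division_of {a..b} \<and> d fine p \<longrightarrow>
      norm ((\<Sum>(x, k)\<in>p. measure lborel k *\<^sub>R g x) - (f b - f a)) \<le> e * measure lborel {a..b})"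
    proof (rule exI, safe)
      show "gauge (\<lambda>x. ball x (d x))" using d(1) gauge_ball_dependent by blast
    next
      fix p assume p: "p tagged_division_of {a..b}" and fine: "(\<lambda>x. ball x (d x)) fine p"
      have fin: "finite p" using p by blast
      have sum_len: "b - a = (\<Sum>(x,K)\<in>p. Sup K - Inf K)"
        and sum_f: "f b - f a = (\<Sum>(x,K)\<in>p. f(Sup K) - f(Inf K))"
        using additive_tagged_division_1[OF less_imp_le[OF ab] p, of "\<lambda>x. x"]
          additive_tagged_division_1[OF less_imp_le[OF ab] p, of f] by simp_all
      have K: "\<exists>u v. K = {u..v} \<and> u \<le> v \<and> Inf K = u \<and> Sup K = v \<and> x \<in> {u..v} \<and> {u..v} \<subseteq> {a..b} \<and> {u..v} \<subseteq> ball x (d x)"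
        if pK: "(x, K) \<in> p" for x K
      proof -
        note xK = tagged_division_ofD(2,3)[OF p pK]
        obtain u v where uv: "K = cbox u v" using tagged_division_ofD(4)[OF p pK] by blast
        moreover have "K \<subseteq> ball x (d x)" using fine pK by (auto simp: fine_def)
        ultimately show ?thesis using xK by auto
      qed
      have Kq: "snd q = {Inf (snd q)..Sup (snd q)}" "Inf (snd q) \<le> Sup (snd q)"
        "{Inf (snd q)..Sup (snd q)} \<subseteq> {a..b}" "{Inf (snd q)..Sup (snd q)} \<subseteq> ball (fst q) (d (fst q))"
        if "q \<in> p" for q
        using K[of "fst q" "snd q"] that by (metis prod.collapse)+
      define p1 where "p1 = {q\<in>p. fst q \<in> N}"
      define p2 where "p2 = {q\<in>p. fst q \<notin> N}"
      have pp: "p = p1 \<union> p2" "p1 \<inter> p2 = {}" "finite p1" "finite p2" "p1 \<subseteq> p" "p2 \<subseteq> p"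
        using fin by (auto simp: p1_def p2_def)
      let ?D = "\<lambda>q. measure lborel (snd q) *\<^sub>R g (fst q) - (f (Sup (snd q)) - f (Inf (snd q)))"
      have "(\<Sum>(x, k)\<in>p. measure lborel k *\<^sub>R g x) - (f b - f a) = (\<Sum>q\<in>p. ?D q)"
        by (simp only: sum_f sum_subtractf case_prod_unfold)
      also have "\<dots> = (\<Sum>q\<in>p1. ?D q) + (\<Sum>q\<in>p2. ?D q)"
        using sum.union_disjoint[OF pp(3,4,2), of ?D] by (simp only: pp(1)[symmetric])
      finally have split: "norm ((\<Sum>(x, k)\<in>p. measure lborel k *\<^sub>R g x) - (f b - f a))
        \<le> (\<Sum>q\<in>p1. norm (?D q)) + (\<Sum>q\<in>p2. norm (?D q))"
        by (simp only:) (intro order.trans[OF norm_triangle_ineq] add_mono norm_sum)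
      have "(\<Sum>q\<in>p1. norm (?D q)) = (\<Sum>q\<in>p1. norm (f (Sup (snd q)) - f (Inf (snd q))))"
        by (intro sum.cong) (auto simp: p1_def g_def)
      also have "\<dots> < e / 2 * (b - a)"
      proof (rule AC[rule_format])
        show "finite p1" by fact
        show "Inf (snd q) \<le> Sup (snd q) \<and> {Inf (snd q)..Sup (snd q)} \<subseteq> {a..b}" if "q \<in> p1" for q
          using Kq(2,3)[of q] that pp(5) by blast
        show dis: "disjoint_family_on (\<lambda>i. {Inf (snd i)<..<Sup (snd i)}) p1"
          unfolding disjoint_family_on_def
        proof (intro ballI impI)
          fix q q' assume q: "q \<in> p1" "q' \<in> p1" "q \<noteq> q'"
          then have qp: "(fst q, snd q) \<in> p" "(fst q', snd q') \<in> p" using pp by auto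
          have int: "interior (snd q) \<inter> interior (snd q') = {}"
            using tagged_division_ofD(5)[OF p qp] q(3) by (metis prod.collapse)
          have "interior (snd q) = {Inf (snd q)<..<Sup (snd q)}" using Kq(1)[of q] interior_atLeastAtMost_real qp(1) by (metis prod.collapse)
          moreover have "interior (snd q') = {Inf (snd q')<..<Sup (snd q')}" using Kq(1)[of q'] interior_atLeastAtMost_real qp(2) by (metis prod.collapse)
          ultimately show "{Inf (snd q)<..<Sup (snd q)} \<inter> {Inf (snd q')<..<Sup (snd q')} = {}"
            using int by simp
        qed
        have "ennreal (\<Sum>q\<in>p1. Sup (snd q) - Inf (snd q)) \<le> emeasure lebesgue T"
        proof (rule sum_interval_lengths_le[OF \<open>finite p1\<close> _ dis Tsets])
          fix q assume q: "q \<in> p1"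
          have "ball (fst q) (d (fst q)) \<subseteq> T" using q d(3) by (auto simp: p1_def)
          then show "Inf (snd q) \<le> Sup (snd q) \<and> {Inf (snd q)<..<Sup (snd q)} \<subseteq> T"
            using Kq(2,4)[of q] q pp(5) greaterThanLessThan_subseteq_atLeastAtMost_iff by (meson order_refl subsetD subset_trans greaterThanLessThan_subseteq_atLeastAtMost_iff)
        qed
        then have "ennreal (\<Sum>q\<in>p1. Sup (snd q) - Inf (snd q)) < ennreal \<delta>" using Tm by simp
        then show "(\<Sum>q\<in>p1. Sup (snd q) - Inf (snd q)) < \<delta>"
          by (rule contrapos_pp) (simp add: not_less ennreal_leI)
      qed
      finally have 1: "(\<Sum>q\<in>p1. norm (?D q)) \<le> e / 2 * (b - a)" by simp
      have "(\<Sum>q\<in>p2. norm (?D q)) \<le> (\<Sum>q\<in>p2. e / 2 * (Sup (snd q) - Inf (snd q)))"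
      proof (rule sum_mono)
        fix q assume q: "q \<in> p2"
        obtain x k where xk: "q = (x, k)" by force
        then obtain u v where uv: "k = {u..v}" "u \<le> v" "Inf k = u" "Sup k = v" "x \<in> {u..v}"
          "{u..v} \<subseteq> {a..b}" "{u..v} \<subseteq> ball x (d x)" using K[of x k] q pp by auto
        have xN: "x \<notin> N" "x \<in> {a..b}" using q xk uv by (auto simp: p2_def)
        have D: "norm (f y - f x - (y-x) *\<^sub>R f' x) \<le> e / 2 * norm (y-x)" if "y \<in> {u..v}" for y
          using d(2)[of x y] xN that uv(6,7) by (force simp: dist_real_def)
        \<comment> \<open>The tag lies between \<open>u\<close> and \<open>v\<close>, so the errors
          at the two ends, proportional to their distances from the tag, add up to
          \<open>e / 2 * (v - u)\<close>.\<close>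
        have "norm (?D q) = norm ((f u - f x - (u-x) *\<^sub>R f' x) - (f v - f x - (v-x) *\<^sub>R f' x))"
          using uv xN by (simp add: xk g_def algebra_simps)
        also have "\<dots> \<le> e / 2 * norm (u - x) + e / 2 * norm (v - x)"
          using D[of u] D[of v] uv(2) norm_triangle_ineq4[of "f u - f x - (u-x) *\<^sub>R f' x" "f v - f x - (v-x) *\<^sub>R f' x"] by auto
        also have "\<dots> = e / 2 * (Sup (snd q) - Inf (snd q))"
          using uv by (simp add: xk field_simps)
        finally show "norm (?D q) \<le> e / 2 * (Sup (snd q) - Inf (snd q))" .
      qed
      also have "\<dots> \<le> (\<Sum>q\<in>p. e / 2 * (Sup (snd q) - Inf (snd q)))"
      proof (rule sum_mono2[OF fin pp(6)])
        fix q assume "q \<in> p - p2"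
        then show "0 \<le> e / 2 * (Sup (snd q) - Inf (snd q))" using Kq(2)[of q] e by simp
      qed
      also have "\<dots> = e / 2 * (b - a)"
        unfolding sum_len by (simp add: sum_distrib_left case_prod_unfold)
      finally have 2: "(\<Sum>q\<in>p2. norm (?D q)) \<le> e / 2 * (b - a)" .
      show "norm ((\<Sum>(x, k)\<in>p. measure lborel k *\<^sub>R g x) - (f b - f a)) \<le> e * measure lborel {a..b}"
        using split 1 2 ab by (simp add: field_simps)
    qed
  qed
  then show ?thesis
    by (rule has_integral_spike[OF N, rotated]) (auto simp: g_def)
qed

lemma absolutely_continuous_on_subset:
  assumes "absolutely_continuous_on S f" "T \<subseteq> S"
  shows "absolutely_continuous_on T f"
  unfolding absolutely_continuous_on_def
proof (intro allI impI)
  fix e :: real assume "e > 0"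
  then obtain \<delta> where "\<delta> > 0" and *: "\<And>(n::nat) l r. (\<forall>i<n. l i \<le> r i \<and> {l i..r i} \<subseteq> S) \<and>
      disjoint_family_on (\<lambda>i. {l i<..<r i}) {..<n} \<and> (\<Sum>i<n. r i - l i) < \<delta> \<Longrightarrow>
      (\<Sum>i<n. norm (f (r i) - f (l i))) < e"
    using assms(1) unfolding absolutely_continuous_on_def by blast
  show "\<exists>\<delta>>0. \<forall>(n::nat) l r.
      (\<forall>i<n. l i \<le> r i \<and> {l i..r i} \<subseteq> T) \<and>
      disjoint_family_on (\<lambda>i. {l i<..<r i}) {..<n} \<and> (\<Sum>i<n. r i - l i) < \<delta> \<longrightarrow>
      (\<Sum>i<n. norm (f (r i) - f (l i))) < e"
  proof (intro exI[of _ \<delta>] conjI allI impI *)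
    show "l i \<le> r i" if "(\<forall>i<n. l i \<le> r i \<and> {l i..r i} \<subseteq> T) \<and>
      disjoint_family_on (\<lambda>i. {l i<..<r i}) {..<n} \<and> (\<Sum>i<n. r i - l i) < \<delta>" "i < n"
      for n i and l r :: "nat \<Rightarrow> real" using that by blast
    show "{l i..r i} \<subseteq> S" if "(\<forall>i<n. l i \<le> r i \<and> {l i..r i} \<subseteq> T) \<and>
      disjoint_family_on (\<lambda>i. {l i<..<r i}) {..<n} \<and> (\<Sum>i<n. r i - l i) < \<delta>" "i < n"
      for n i and l r :: "nat \<Rightarrow> real" using that assms(2) by blast
  qed (use \<open>\<delta> > 0\<close> in blast)+
qed

lemma lipschitz_imp_absolutely_continuous_on:
  assumes "\<And>x y. x \<in> S \<Longrightarrow> y \<in> S \<Longrightarrow> norm (f x - f y) \<le> L * \<bar>x - y\<bar>"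
  shows "absolutely_continuous_on S f"
  unfolding absolutely_continuous_on_def
proof (intro allI impI)
  fix e :: real assume e: "e > 0"
  define L' where "L' = max L 1"
  have L': "L' > 0" by (simp add: L'_def)
  show "\<exists>\<delta>>0. \<forall>(n::nat) l r.
      (\<forall>i<n. l i \<le> r i \<and> {l i..r i} \<subseteq> S) \<and>
      disjoint_family_on (\<lambda>i. {l i<..<r i}) {..<n} \<and>
      (\<Sum>i<n. r i - l i) < \<delta> \<longrightarrow>
      (\<Sum>i<n. norm (f (r i) - f (l i))) < e"
  proof (intro exI[of _ "e / L'"] conjI allI impI)
    show "0 < e / L'" using e L' by simp
    fix n :: nat and l r :: "nat \<Rightarrow> real"
    assume *: "(\<forall>i<n. l i \<le> r i \<and> {l i..r i} \<subseteq> S) \<and>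
      disjoint_family_on (\<lambda>i. {l i<..<r i}) {..<n} \<and> (\<Sum>i<n. r i - l i) < e / L'"
    have "(\<Sum>i<n. norm (f (r i) - f (l i))) \<le> (\<Sum>i<n. L' * (r i - l i))"
    proof (rule sum_mono)
      fix i assume "i \<in> {..<n}"
      then have i: "l i \<le> r i" "{l i..r i} \<subseteq> S" using * by auto
      then have "norm (f (r i) - f (l i)) \<le> L * \<bar>r i - l i\<bar>" by (intro assms) auto
      also have "\<dots> \<le> L' * (r i - l i)" using i by (auto simp: L'_def intro!: mult_right_mono)
      finally show "norm (f (r i) - f (l i)) \<le> L' * (r i - l i)" .
    qed
    also have "\<dots> = L' * (\<Sum>i<n. r i - l i)" by (simp add: sum_distrib_left)
    also have "\<dots> < e" using * L' by (simp add: field_simps)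
    finally show "(\<Sum>i<n. norm (f (r i) - f (l i))) < e" .
  qed
qed

text \<open>Gauge integrability of \<open>f'\<close> makes it measurable. If the integral of its
  absolute value is finite, the gauge integral is a Lebesgue integral and can be estimated; if it is
  infinite, so is the right-hand side.\<close>

lemma absolutely_continuous_increment_le:
  fixes f :: "real \<Rightarrow> real"
  assumes ac: "absolutely_continuous_on {0..1} f" and s: "s \<in> {0..1}"
    and der: "AE t in lebesgue. t \<in> {0..1} \<longrightarrow> (f has_vector_derivative f' t) (at t) \<and> \<bar>f' t\<bar> \<le> v t"
  shows "ennreal \<bar>f s - f 0\<bar> \<le> (\<integral>\<^sup>+t\<in>{0..1}. ennreal (v t) \<partial>lebesgue)"
proof -
  obtain N where N: "negligible N"
    and der': "\<And>t. t \<in> {0..1} - N \<Longrightarrow> (f has_vector_derivative f' t) (at t) \<and> \<bar>f' t\<bar> \<le> v t"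
    using der by (auto simp: eventually_ae_filter negligible_iff_null_sets)
  have int: "(f' has_integral (f s - f 0)) {0..s}"
  proof (rule fundamental_theorem_of_calculus_absolutely_continuous[OF _ _ N])
    show "absolutely_continuous_on {0..s} f"
      using s by (intro absolutely_continuous_on_subset[OF ac]) auto
    show "(f has_vector_derivative f' x) (at x within {0..s})" if "x \<in> {0..s} - N" for x
      using der'[of x] that s by (auto intro: has_vector_derivative_at_within)
  qed (use s in auto)
  have meas: "(\<lambda>x. f' x * indicator {0..s} x) \<in> borel_measurable lebesgue"
    by (rule has_integral_implies_lebesgue_measurable_real[OF int])
  have le: "(\<integral>\<^sup>+t. ennreal \<bar>f' t * indicator {0..s} t\<bar> \<partial>lebesgue) \<le> (\<integral>\<^sup>+t\<in>{0..1}. ennreal (v t) \<partial>lebesgue)"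
    using der s by (intro nn_integral_mono_AE) (auto simp: indicator_def abs_mult intro!: ennreal_leI elim!: eventually_mono)
  show ?thesis
  proof (cases "(\<integral>\<^sup>+t. ennreal \<bar>f' t * indicator {0..s} t\<bar> \<partial>lebesgue) = \<infinity>")
    case True
    then show ?thesis using le by (simp add: top_unique)
  next
    case False
    then have I: "integrable lebesgue (\<lambda>x. f' x * indicator {0..s} x)"
      using meas by (intro integrableI_bounded) (auto simp: top.not_eq_extremum)
    have "(\<integral>x. f' x * indicator {0..s} x \<partial>lebesgue) = f s - f 0"
    proof -
      have "((\<lambda>x. f' x * indicator {0..s} x) has_integral (\<integral>x. f' x * indicator {0..s} x \<partial>lebesgue)) UNIV"
        using has_integral_integral_lebesgue[OF I] .
      moreover have "((\<lambda>x. f' x * indicator {0..s} x) has_integral (f s - f 0)) UNIV"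
        using int has_integral_restrict_UNIV[of "{0..s}" f' "f s - f 0"]
        by (simp add: indicator_def of_bool_def if_distrib cong: if_cong)
      ultimately show ?thesis by (rule has_integral_unique)
    qed
    then have "ennreal \<bar>f s - f 0\<bar> \<le> ennreal (\<integral>x. \<bar>f' x * indicator {0..s} x\<bar> \<partial>lebesgue)"
      using integral_abs_bound[of lebesgue "\<lambda>x. f' x * indicator {0..s} x"] by (metis ennreal_leI)
    also have "\<dots> = (\<integral>\<^sup>+t. ennreal \<bar>f' t * indicator {0..s} t\<bar> \<partial>lebesgue)"
      using I by (intro nn_integral_eq_integral[symmetric]) auto
    finally show ?thesis using le by simp
  qed
qed

section \<open>Comparison of the distance with a homogeneous gauge\<close>

text \<open>The last coordinate of \<open>a\<^sup>-\<^sup>1 \<cdot> a'\<close>.\<close>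

fun rel_z :: "heis \<Rightarrow> heis \<Rightarrow> real" where
  "rel_z (x, y, z) (x', y', z') = z' - z - (x * y' - y * x') / 2"

text \<open>The square root gives both terms degree one under the dilations
  \<open>(x, y, z) \<mapsto> (c x, c y, c\<^sup>2 z)\<close>, the scaling of the distance.\<close>

definition hgauge :: "heis \<Rightarrow> heis \<Rightarrow> real" where
  "hgauge a a' = norm (hor a' - hor a) + sqrt \<bar>rel_z a a'\<bar>"

lemma hgauge_nonneg: "0 \<le> hgauge a a'"
  by (simp add: hgauge_def)

lemma hor_eq: "hor a = (fst a, fst (snd a))"
  by (cases a) simp

text \<open>The coordinates of a curve, and the left-translated height as an affine function of
  them, inherit absolute continuity in this way.\<close>

lemma absolutely_continuous_on_lipschitz_compose:
  fixes f :: "real \<Rightarrow> 'a::real_normed_vector" and g :: "real \<Rightarrow> 'b::real_normed_vector"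
  assumes f: "absolutely_continuous_on S f"
    and le: "\<And>u v. norm (g u - g v) \<le> L * norm (f u - f v)"
  shows "absolutely_continuous_on S g"
  unfolding absolutely_continuous_on_def
proof (intro allI impI)
  fix e :: real assume e: "e > 0"
  define L' where "L' = max L 1"
  have L': "L' > 0" "L \<le> L'" by (auto simp: L'_def)
  then have "e / L' > 0" using e by simp
  then obtain \<delta> where \<delta>: "\<delta> > 0"
    and *: "\<forall>(n::nat) l r. (\<forall>i<n. l i \<le> r i \<and> {l i..r i} \<subseteq> S) \<and>
      disjoint_family_on (\<lambda>i. {l i<..<r i}) {..<n} \<and>
      (\<Sum>i<n. r i - l i) < \<delta> \<longrightarrow> (\<Sum>i<n. norm (f (r i) - f (l i))) < e / L'"
    using f unfolding absolutely_continuous_on_def by blast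
  show "\<exists>\<delta>>0. \<forall>(n::nat) l r. (\<forall>i<n. l i \<le> r i \<and> {l i..r i} \<subseteq> S) \<and>
      disjoint_family_on (\<lambda>i. {l i<..<r i}) {..<n} \<and>
      (\<Sum>i<n. r i - l i) < \<delta> \<longrightarrow> (\<Sum>i<n. norm (g (r i) - g (l i))) < e"
  proof (intro exI[of _ \<delta>] conjI \<delta> allI impI)
    fix n :: nat and l r :: "nat \<Rightarrow> real"
    assume "(\<forall>i<n. l i \<le> r i \<and> {l i..r i} \<subseteq> S) \<and>
      disjoint_family_on (\<lambda>i. {l i<..<r i}) {..<n} \<and> (\<Sum>i<n. r i - l i) < \<delta>"
    then have lt: "(\<Sum>i<n. norm (f (r i) - f (l i))) < e / L'" using * by blast
    have "(\<Sum>i<n. norm (g (r i) - g (l i))) \<le> (\<Sum>i<n. L' * norm (f (r i) - f (l i)))"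
      by (intro sum_mono order.trans[OF le] mult_right_mono L') auto
    also have "\<dots> = L' * (\<Sum>i<n. norm (f (r i) - f (l i)))" by (simp add: sum_distrib_left)
    also have "\<dots> < e" using lt L' by (simp add: field_simps)
    finally show "(\<Sum>i<n. norm (g (r i) - g (l i))) < e" .
  qed
qed

lemma abs_coords_le_norm:
  fixes u :: heis
  shows "\<bar>fst u\<bar> \<le> norm u" "\<bar>fst (snd u)\<bar> \<le> norm u" "\<bar>snd (snd u)\<bar> \<le> norm u"
proof -
  obtain x y z where u: "u = (x, y, z)" by (cases u)
  show "\<bar>fst u\<bar> \<le> norm u" using norm_fst_le[of x "(y, z)"] by (simp add: u)
  show "\<bar>fst (snd u)\<bar> \<le> norm u"
    using norm_fst_le[of y z] norm_snd_le[of "(y, z)" x] by (simp add: u)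
  show "\<bar>snd (snd u)\<bar> \<le> norm u"
    using norm_snd_le[of z y] norm_snd_le[of "(y, z)" x] by (simp add: u)
qed

text \<open>The horizontal coordinates of the two fields are \<open>(1, 0)\<close> and
  \<open>(0, 1)\<close>, so those of \<open>w\<close> are its coefficients.\<close>

lemma in_span_fields:
  "w \<in> span {field_X q, field_Y q} \<Longrightarrow> w = fst w *\<^sub>R field_X q + fst (snd w) *\<^sub>R field_Y q"
  by (cases q) (auto simp: span_insert span_singleton algebra_simps)

text \<open>The last coordinate is controlled after left translation to the starting point: its
  derivative is then at most the distance travelled times the speed.\<close>

lemma horizontal_curve_length_ge:
  assumes \<gamma>: "horizontal_curve \<gamma>" and ends: "\<gamma> 0 = a" "\<gamma> 1 = a'"
    and len: "hlength \<gamma> \<le> ennreal l" and l: "l \<ge> 0"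
  shows "hgauge a a' \<le> 3 * l"
proof -
  obtain x0 y0 z0 where a: "a = (x0, y0, z0)" by (cases a) auto
  obtain x1 y1 z1 where a': "a' = (x1, y1, z1)" by (cases a') auto
  define x where "x t = fst (\<gamma> t)" for t
  define y where "y t = fst (snd (\<gamma> t))" for t
  define z where "z t = snd (snd (\<gamma> t))" for t
  define p where "p t = fst (vector_derivative \<gamma> (at t))" for t
  define q where "q t = fst (snd (vector_derivative \<gamma> (at t)))" for t
  define \<nu> where "\<nu> t = hnorm (\<gamma> t) (vector_derivative \<gamma> (at t))" for t
  have ac: "absolutely_continuous_on {0..1} \<gamma>"
    and der: "AE t in lebesgue. t \<in> {0..1} \<longrightarrow> \<gamma> differentiable (at t) \<and>
      vector_derivative \<gamma> (at t) \<in> span {field_X (\<gamma> t), field_Y (\<gamma> t)}"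
    using \<gamma> by (auto simp: horizontal_curve_def)
  have D: "(x has_vector_derivative p t) (at t) \<and> (y has_vector_derivative q t) (at t) \<and>
    (z has_vector_derivative ((x t * q t - y t * p t) / 2)) (at t) \<and> \<nu> t = sqrt ((p t)\<^sup>2 + (q t)\<^sup>2)"
    if "\<gamma> differentiable (at t)" "vector_derivative \<gamma> (at t) \<in> span {field_X (\<gamma> t), field_Y (\<gamma> t)}" for t
  proof -
    have v: "vector_derivative \<gamma> (at t) = p t *\<^sub>R field_X (\<gamma> t) + q t *\<^sub>R field_Y (\<gamma> t)"
      using in_span_fields[OF that(2)] by (simp add: p_def q_def)
    have g: "(\<gamma> has_vector_derivative vector_derivative \<gamma> (at t)) (at t)"
      using that(1) vector_derivative_works by blast
    have \<gamma>t: "\<gamma> t = (x t, y t, z t)" by (simp add: x_def y_def z_def)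
    have v3: "vector_derivative \<gamma> (at t) = (p t, q t, (x t * q t - y t * p t) / 2)"
      unfolding v \<gamma>t by (simp add: field_simps)
    have "((\<lambda>t. fst (\<gamma> t)) has_vector_derivative fst (vector_derivative \<gamma> (at t))) (at t)"
      using bounded_linear.has_vector_derivative[OF bounded_linear_fst g] .
    moreover have sn: "((\<lambda>t. snd (\<gamma> t)) has_vector_derivative snd (vector_derivative \<gamma> (at t))) (at t)"
      using bounded_linear.has_vector_derivative[OF bounded_linear_snd g] .
    moreover note bounded_linear.has_vector_derivative[OF bounded_linear_fst sn]
      bounded_linear.has_vector_derivative[OF bounded_linear_snd sn]
    moreover have "\<nu> t = sqrt ((p t)\<^sup>2 + (q t)\<^sup>2)"
      unfolding \<nu>_def v by (rule hnorm_frame)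
    ultimately show ?thesis
      unfolding v3 by (simp add: x_def[abs_def] y_def[abs_def] z_def[abs_def])
  qed
  have len': "(\<integral>\<^sup>+t\<in>{0..1}. ennreal (\<nu> t) \<partial>lebesgue) \<le> ennreal l"
    using len by (simp add: hlength_def \<nu>_def)
  have acx: "absolutely_continuous_on {0..1} x"
    by (rule absolutely_continuous_on_lipschitz_compose[OF ac, where L = 1])
      (use abs_coords_le_norm(1) in \<open>simp add: x_def flip: fst_diff\<close>)
  have acy: "absolutely_continuous_on {0..1} y"
    by (rule absolutely_continuous_on_lipschitz_compose[OF ac, where L = 1])
      (use abs_coords_le_norm(2) in \<open>simp add: y_def flip: fst_diff snd_diff\<close>)
  have xy: "\<bar>x s - x0\<bar> \<le> l \<and> \<bar>y s - y0\<bar> \<le> l" if s: "s \<in> {0..1}" for s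
  proof -
    have 1: "ennreal \<bar>x s - x 0\<bar> \<le> (\<integral>\<^sup>+t\<in>{0..1}. ennreal (\<nu> t) \<partial>lebesgue)"
      by (rule absolutely_continuous_increment_le[OF acx s, where f' = p])
        (use der in eventually_elim, use D in auto)
    have 2: "ennreal \<bar>y s - y 0\<bar> \<le> (\<integral>\<^sup>+t\<in>{0..1}. ennreal (\<nu> t) \<partial>lebesgue)"
      by (rule absolutely_continuous_increment_le[OF acy s, where f' = q])
        (use der in eventually_elim, use D in auto)
    have "x 0 = x0" "y 0 = y0" using ends a by (auto simp: x_def y_def)
    then show ?thesis using order.trans[OF 1 len'] order.trans[OF 2 len'] l by simp
  qed
  have "sqrt \<bar>rel_z a a'\<bar> \<le> l"
  proof (rule dense_ge)
    \<comment> \<open>A level \<open>c > l\<close> in place of \<open>l\<close> permits division by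
      \<open>c\<close> even if \<open>l = 0\<close>. The division brings the derivative of the
      left-translated height below the speed \<nu>, so the increment estimate used for the
      coordinates applies again.\<close>
    fix c assume c: "l < c"
    then have c0: "c > 0" using l by simp
    define \<zeta> where "\<zeta> t = (z t - z0 - (x0 * y t - y0 * x t) / 2) / c" for t
    have ac\<zeta>: "absolutely_continuous_on {0..1} \<zeta>"
    proof (rule absolutely_continuous_on_lipschitz_compose[OF ac])
      fix u v
      have z: "\<bar>z u - z v\<bar> \<le> norm (\<gamma> u - \<gamma> v)"
        using abs_coords_le_norm(3)[of "\<gamma> u - \<gamma> v"] by (simp add: z_def)
      have y: "\<bar>y u - y v\<bar> \<le> norm (\<gamma> u - \<gamma> v)"
        using abs_coords_le_norm(2)[of "\<gamma> u - \<gamma> v"] by (simp add: y_def)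
      have x: "\<bar>x u - x v\<bar> \<le> norm (\<gamma> u - \<gamma> v)"
        using abs_coords_le_norm(1)[of "\<gamma> u - \<gamma> v"] by (simp add: x_def)
      have abs_ineq: "\<bar>P - (Q - R) / 2\<bar> \<le> \<bar>P\<bar> + (\<bar>Q\<bar> + \<bar>R\<bar>) / 2" for P Q R :: real
      proof -
        have "\<bar>P - (Q - R) / 2\<bar> \<le> \<bar>P\<bar> + \<bar>Q - R\<bar> / 2"
          using abs_triangle_ineq4[of P "(Q - R) / 2"] by (simp only: abs_divide abs_numeral)
        also have "\<dots> \<le> \<bar>P\<bar> + (\<bar>Q\<bar> + \<bar>R\<bar>) / 2"
          by (intro add_left_mono divide_right_mono abs_triangle_ineq4) simp
        finally show ?thesis .
      qed
      have "\<zeta> u - \<zeta> v = ((z u - z v) - (x0 * (y u - y v) - y0 * (x u - x v)) / 2) / c"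
        using c0 by (simp add: \<zeta>_def field_simps)
      also have "norm \<dots> \<le> (\<bar>z u - z v\<bar> + (\<bar>x0\<bar> * \<bar>y u - y v\<bar> + \<bar>y0\<bar> * \<bar>x u - x v\<bar>) / 2) / c"
      proof -
        have "\<bar>(z u - z v) - (x0 * (y u - y v) - y0 * (x u - x v)) / 2\<bar>
          \<le> \<bar>z u - z v\<bar> + (\<bar>x0 * (y u - y v)\<bar> + \<bar>y0 * (x u - x v)\<bar>) / 2" by (rule abs_ineq)
        then show ?thesis using c0 by (simp add: divide_right_mono abs_mult abs_divide)
      qed
      also have "\<dots> \<le> (norm (\<gamma> u - \<gamma> v) + (\<bar>x0\<bar> * norm (\<gamma> u - \<gamma> v) + \<bar>y0\<bar> * norm (\<gamma> u - \<gamma> v)) / 2) / c"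
        using x y z c0 by (intro divide_right_mono add_mono mult_left_mono) auto
      also have "\<dots> = ((1 + (\<bar>x0\<bar> + \<bar>y0\<bar>) / 2) / c) * norm (\<gamma> u - \<gamma> v)"
        by (simp add: field_simps)
      finally show "norm (\<zeta> u - \<zeta> v) \<le> ((1 + (\<bar>x0\<bar> + \<bar>y0\<bar>) / 2) / c) * norm (\<gamma> u - \<gamma> v)" .
    qed
    define \<zeta>' where "\<zeta>' t = ((x t * q t - y t * p t) / 2 - (x0 * q t - y0 * p t) / 2) / c" for t
    have 1: "ennreal \<bar>\<zeta> 1 - \<zeta> 0\<bar> \<le> (\<integral>\<^sup>+t\<in>{0..1}. ennreal (\<nu> t) \<partial>lebesgue)"
    proof (rule absolutely_continuous_increment_le[OF ac\<zeta>, where f' = \<zeta>'])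
      show "AE t in lebesgue. t \<in> {0..1} \<longrightarrow> (\<zeta> has_vector_derivative \<zeta>' t) (at t) \<and> \<bar>\<zeta>' t\<bar> \<le> \<nu> t"
        using der
      proof (eventually_elim, intro impI)
        fix t :: real assume *: "t \<in> {0..1} \<longrightarrow> \<gamma> differentiable (at t) \<and>
          vector_derivative \<gamma> (at t) \<in> span {field_X (\<gamma> t), field_Y (\<gamma> t)}" and t: "t \<in> {0..1}"
        note Dt = D[of t]
        have "(\<zeta> has_vector_derivative \<zeta>' t) (at t)"
          unfolding \<zeta>_def[abs_def] \<zeta>'_def
          using Dt * t c0
          by (auto simp: has_real_derivative_iff_has_vector_derivative[symmetric] intro!: derivative_eq_intros)
        moreover have "\<bar>\<zeta>' t\<bar> \<le> \<nu> t"
        proof -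
          have P: "\<bar>p t\<bar> \<le> \<nu> t" "\<bar>q t\<bar> \<le> \<nu> t" using Dt * t by auto
          have "\<bar>\<zeta>' t\<bar> = \<bar>(x t - x0) * q t - (y t - y0) * p t\<bar> / 2 / c"
          proof -
            have "\<zeta>' t = ((x t - x0) * q t - (y t - y0) * p t) / 2 / c"
              by (simp add: \<zeta>'_def diff_divide_distrib left_diff_distrib)
            then show ?thesis using c0 by (simp add: abs_divide)
          qed
          also have "\<dots> \<le> (c * \<nu> t + c * \<nu> t) / 2 / c"
          proof (intro divide_right_mono)
            have "\<bar>(x t - x0) * q t - (y t - y0) * p t\<bar> \<le> \<bar>x t - x0\<bar> * \<bar>q t\<bar> + \<bar>y t - y0\<bar> * \<bar>p t\<bar>"
              by (metis abs_mult abs_triangle_ineq4)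
            also have "\<dots> \<le> c * \<nu> t + c * \<nu> t"
              using xy[OF t] c P by (intro add_mono mult_mono) auto
            finally show "\<bar>(x t - x0) * q t - (y t - y0) * p t\<bar> \<le> c * \<nu> t + c * \<nu> t" .
          qed (use c0 in auto)
          also have "\<dots> = \<nu> t" using c0 by simp
          finally show ?thesis .
        qed
        ultimately show "(\<zeta> has_vector_derivative \<zeta>' t) (at t) \<and> \<bar>\<zeta>' t\<bar> \<le> \<nu> t" by blast
      qed
    qed auto
    have "\<bar>\<zeta> 1 - \<zeta> 0\<bar> \<le> l" using order.trans[OF 1 len'] l by simp
    moreover have "\<zeta> 0 = 0" "\<zeta> 1 = rel_z a a' / c"
      using ends by (auto simp: \<zeta>_def a a' x_def y_def z_def)
    ultimately have "\<bar>rel_z a a'\<bar> \<le> l * c" using c0 by (simp add: field_simps abs_divide)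
    also have "\<dots> \<le> c\<^sup>2" using c l by (simp add: power2_eq_square mult_right_mono)
    finally show "sqrt \<bar>rel_z a a'\<bar> \<le> c" using c0 by (simp add: real_le_lsqrt)
  qed
  moreover have "norm (hor a' - hor a) \<le> 2 * l"
  proof -
    have "x 1 = x1" "y 1 = y1" using ends a' by (auto simp: x_def y_def)
    then have "\<bar>x1 - x0\<bar> \<le> l" "\<bar>y1 - y0\<bar> \<le> l" using xy[of 1] by auto
    moreover have "norm (hor a' - hor a) \<le> norm (x1 - x0) + norm (y1 - y0)"
      using norm_Pair_le[of "x1 - x0" "y1 - y0"] by (simp add: a a')
    ultimately show ?thesis by simp
  qed
  ultimately show ?thesis by (simp add: hgauge_def)
qed

lemma C1_imp_absolutely_continuous_on:
  fixes f :: "real \<Rightarrow> 'a::real_normed_vector"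
  assumes "\<And>t. (f has_vector_derivative f' t) (at t)" "continuous_on {0..1} f'"
  shows "absolutely_continuous_on {0..1} f"
proof -
  have "compact (f' ` {0..1})" using assms(2) by (intro compact_continuous_image) auto
  then have "bounded (f' ` {0..1})" by (rule compact_imp_bounded)
  then obtain L where "\<forall>t\<in>{0..1}. norm (f' t) \<le> L" unfolding bounded_iff by auto
  then have L: "\<And>t. t \<in> {0..1} \<Longrightarrow> norm (f' t) \<le> L" by blast
  show ?thesis
  proof (rule lipschitz_imp_absolutely_continuous_on)
    fix u v :: real assume uv: "u \<in> {0..1}" "v \<in> {0..1}"
    have "norm (f u - f v) \<le> L * norm (u - v)"
    proof (rule differentiable_bound[of "{0..1}"])
      show "(f has_derivative (\<lambda>h. h *\<^sub>R f' t)) (at t within {0..1})" for t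
        using assms(1)[of t] by (simp add: has_vector_derivative_def has_derivative_at_withinI)
      show "onorm (\<lambda>h. h *\<^sub>R f' t) \<le> L" if "t \<in> {0..1}" for t
        using L[OF that] by (intro onorm_le) (simp add: mult.commute[of L] mult_left_mono)
    qed (use uv in auto)
    then show "norm (f u - f v) \<le> L * \<bar>u - v\<bar>" by simp
  qed
qed

text \<open>The planar loop \<open>(\<phi>, \<psi>)\<close> with \<open>\<phi> = t (1 - t) (1 - 2 t)\<close> and
  \<open>\<psi> = t (1 - t) (1 - 5 t + 5 t\<^sup>2)\<close> encloses the signed area \<open>- 1 / 70\<close>. Both components have mean
  zero, so adding a multiple of the loop to a straight segment changes the height by exactly
  the area of the loop.\<close>

lemma horizontal_curve_exists:
  obtains \<gamma> where "horizontal_curve \<gamma>" "\<gamma> 0 = a" "\<gamma> 1 = a'" "hlength \<gamma> \<le> ennreal (700 * hgauge a a')"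
proof -
  obtain x0 y0 z0 where a: "a = (x0, y0, z0)" by (cases a) auto
  obtain x1 y1 z1 where a': "a' = (x1, y1, z1)" by (cases a') auto
  define \<zeta> where "\<zeta> = rel_z a a'"
  \<comment> \<open>Scaling the coordinates of the loop by \<open>A\<close> and \<open>B\<close>
    multiplies its area \<open>- 1 / 70\<close> by \<open>A * B\<close>, so the height \<zeta>
    requires \<open>A * B = - 70 * \<zeta>\<close>. Equal absolute values keep the length of order
    \<open>sqrt \<bar>\<zeta>\<bar>\<close>.\<close>
  define A where "A = sqrt (70 * \<bar>\<zeta>\<bar>)"
  define B where "B = - sgn \<zeta> * A"
  have AB: "A * B = - 70 * \<zeta>"
  proof -
    have "A * A = 70 * \<bar>\<zeta>\<bar>" by (simp add: A_def)
    then have "A * B = - (70 * (sgn \<zeta> * \<bar>\<zeta>\<bar>))" by (simp add: B_def)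
    then show ?thesis by (simp add: sgn_mult_abs)
  qed
  define dx where "dx = x1 - x0"
  define dy where "dy = y1 - y0"
  define cx where "cx t = dx * t + A * (t - 3 * t^2 + 2 * t^3)" for t
  define cy where "cy t = dy * t + B * (t - 6 * t^2 + 10 * t^3 - 5 * t^4)" for t
  define cx' where "cx' t = dx + A * (1 - 6 * t + 6 * t^2)" for t
  define cy' where "cy' t = dy + B * (1 - 12 * t + 30 * t^2 - 20 * t^3)" for t
  \<comment> \<open>The antiderivative of \<open>cx * cy' - cy * cx'\<close>, twice the swept area.
    The \<open>dx * dy\<close> terms cancel, and the two mixed terms vanish at 1, which is where the
    zero means of the loop enter.\<close>
  define h where "h t = dx * B * (t^3 * (5 * t - 3 * t^2 - 2)) + A * dy * (t^3 - t^4)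
    + A * B * (t^3 * (4 * t - 1 - 33 / 5 * t^2 + 5 * t^3 - 10 / 7 * t^4))" for t
  define cz where "cz t = (x0 * cy t - y0 * cx t) / 2 + h t / 2" for t
  define \<gamma> where "\<gamma> t = (x0 + cx t, y0 + cy t, z0 + cz t)" for t
  define \<gamma>' where "\<gamma>' t = cx' t *\<^sub>R field_X (\<gamma> t) + cy' t *\<^sub>R field_Y (\<gamma> t)" for t
  have cx: "(cx has_real_derivative cx' t) (at t)" for t
    unfolding cx_def[abs_def] cx'_def by (auto intro!: derivative_eq_intros simp: algebra_simps)
  have cy: "(cy has_real_derivative cy' t) (at t)" for t
    unfolding cy_def[abs_def] cy'_def by (auto intro!: derivative_eq_intros simp: algebra_simps)
  have h1: "((\<lambda>t::real. t^3 * (5 * t - 3 * t^2 - 2)) has_real_derivative (20 * t^3 - 6 * t^2 - 15 * t^4)) (at t)" for t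
    by (rule derivative_eq_intros refl)+ (simp, algebra)
  have h2: "((\<lambda>t::real. t^3 - t^4) has_real_derivative (3 * t^2 - 4 * t^3)) (at t)" for t
    by (rule derivative_eq_intros refl)+ simp
  have h3: "((\<lambda>t::real. t^3 * (4 * t - 1 - 33 / 5 * t^2 + 5 * t^3 - 10 / 7 * t^4))
    has_real_derivative (t^2 * (16 * t - 3 - 33 * t^2 + 30 * t^3 - 10 * t^4))) (at t)" for t
    by (rule derivative_eq_intros refl)+ (simp, algebra)
  have h: "(h has_real_derivative (cx t * cy' t - cy t * cx' t)) (at t)" for t
  proof -
    have "(h has_real_derivative (dx * B * (20 * t^3 - 6 * t^2 - 15 * t^4) + A * dy * (3 * t^2 - 4 * t^3)
      + A * B * (t^2 * (16 * t - 3 - 33 * t^2 + 30 * t^3 - 10 * t^4)))) (at t)"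
      unfolding h_def[abs_def] by (intro DERIV_add DERIV_cmult h1 h2 h3)
    moreover have "dx * B * (20 * t^3 - 6 * t^2 - 15 * t^4) + A * dy * (3 * t^2 - 4 * t^3)
      + A * B * (t^2 * (16 * t - 3 - 33 * t^2 + 30 * t^3 - 10 * t^4)) = cx t * cy' t - cy t * cx' t"
      unfolding cx_def cy_def cx'_def cy'_def by algebra
    ultimately show ?thesis by simp
  qed
  have cz: "(cz has_real_derivative ((x0 + cx t) * cy' t - (y0 + cy t) * cx' t) / 2) (at t)" for t
    unfolding cz_def[abs_def]
    by (rule DERIV_cong, rule DERIV_add[OF DERIV_cdivide[OF DERIV_diff[OF DERIV_cmult[OF cy] DERIV_cmult[OF cx]]] DERIV_cdivide[OF h]])
      (simp add: field_simps)
  have \<gamma>: "(\<gamma> has_vector_derivative \<gamma>' t) (at t)" for t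
  proof -
    have "((\<lambda>t. (x0 + cx t, y0 + cy t, z0 + cz t)) has_vector_derivative
      (0 + cx' t, 0 + cy' t, 0 + ((x0 + cx t) * cy' t - (y0 + cy t) * cx' t) / 2)) (at t)"
      by (intro has_vector_derivative_Pair has_vector_derivative_add has_vector_derivative_const
        cx[unfolded has_real_derivative_iff_has_vector_derivative]
        cy[unfolded has_real_derivative_iff_has_vector_derivative]
        cz[unfolded has_real_derivative_iff_has_vector_derivative])
    moreover have "\<gamma>' t = (0 + cx' t, 0 + cy' t, 0 + ((x0 + cx t) * cy' t - (y0 + cy t) * cx' t) / 2)"
      by (simp add: \<gamma>'_def \<gamma>_def field_simps)
    ultimately show ?thesis by (simp only: \<gamma>_def[abs_def])
  qed
  have cont: "continuous_on {0..1} \<gamma>'"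
  proof -
    have "\<gamma>' = (\<lambda>t. (cx' t, cy' t, ((x0 + cx t) * cy' t - (y0 + cy t) * cx' t) / 2))"
      by (simp add: \<gamma>'_def \<gamma>_def field_simps fun_eq_iff)
    moreover have "continuous_on {0..1} cx" "continuous_on {0..1} cx'"
      "continuous_on {0..1} cy" "continuous_on {0..1} cy'"
      unfolding cx_def[abs_def] cx'_def[abs_def] cy_def[abs_def] cy'_def[abs_def]
      by (auto intro!: continuous_intros)
    ultimately show ?thesis by (auto intro!: continuous_intros)
  qed
  have hc: "horizontal_curve \<gamma>"
    unfolding horizontal_curve_def
  proof (intro conjI AE_I2 impI)
    show "absolutely_continuous_on {0..1} \<gamma>" by (rule C1_imp_absolutely_continuous_on[OF \<gamma> cont])
    show "\<gamma> differentiable at t" for t using \<gamma>[of t] by (rule differentiableI_vector)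
    show "vector_derivative \<gamma> (at t) \<in> span {field_X (\<gamma> t), field_Y (\<gamma> t)}" for t
      unfolding vector_derivative_at[OF \<gamma>] \<gamma>'_def by (intro span_add span_scale span_base) auto
  qed
  have g0: "\<gamma> 0 = a" by (simp add: \<gamma>_def a cx_def cy_def cz_def h_def)
  have g1: "\<gamma> 1 = a'"
  proof -
    have "h 1 = A * B * (- 1 / 35)" by (simp add: h_def)
    then have h1: "h 1 = 2 * \<zeta>" by (simp add: AB)
    have c1: "cx 1 = dx" "cy 1 = dy" by (simp_all add: cx_def cy_def)
    have "\<zeta> = z1 - z0 - (x0 * dy - y0 * dx) / 2"
      by (simp add: \<zeta>_def a a' dx_def dy_def algebra_simps)
    moreover have "cz 1 = (x0 * dy - y0 * dx) / 2 + \<zeta>" by (simp add: cz_def h1 c1)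
    ultimately have "z0 + cz 1 = z1" by linarith
    then show ?thesis by (simp add: \<gamma>_def a' c1 dx_def dy_def)
  qed
  have "hlength \<gamma> \<le> (\<integral>\<^sup>+ t \<in> {0..1::real}. ennreal (700 * hgauge a a') \<partial>lebesgue)"
    unfolding hlength_def
  proof (rule nn_integral_mono)
    fix t :: real
    show "ennreal (hnorm (\<gamma> t) (vector_derivative \<gamma> (at t))) * indicator {0..1} t
      \<le> ennreal (700 * hgauge a a') * indicator {0..1} t"
    proof (cases "t \<in> {0..1}")
      case t: True
      have pw: "0 \<le> t" "t \<le> 1" "0 \<le> t ^ 2" "t ^ 2 \<le> 1" "0 \<le> t ^ 3" "t ^ 3 \<le> 1"
        using t by (auto simp: power_le_one)
      \<comment> \<open>Crude sums of coefficients: \<open>13 = 1 + 6 + 6\<close> and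
        \<open>63 = 1 + 12 + 30 + 20\<close>. Their sum 76, times the bound 9 for the square root of
        70, is 684; this explains the factor 700.\<close>
      have "\<bar>1 - 6 * t + 6 * t^2\<bar> \<le> 13" unfolding abs_le_iff using pw by linarith
      then have 1: "\<bar>cx' t\<bar> \<le> \<bar>dx\<bar> + A * 13"
        unfolding cx'_def by (intro order.trans[OF abs_triangle_ineq] add_mono)
          (auto simp: abs_mult A_def intro!: mult_left_mono)
      have "\<bar>1 - 12 * t + 30 * t^2 - 20 * t^3\<bar> \<le> 63" unfolding abs_le_iff using pw by linarith
      moreover have "\<bar>B\<bar> \<le> A" by (simp add: B_def abs_mult A_def sgn_if)
      ultimately have 2: "\<bar>cy' t\<bar> \<le> \<bar>dy\<bar> + A * 63"
        unfolding cy'_def by (intro order.trans[OF abs_triangle_ineq] add_mono)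
          (auto simp: abs_mult A_def intro!: mult_mono)
      have "hnorm (\<gamma> t) (vector_derivative \<gamma> (at t)) = sqrt ((cx' t)\<^sup>2 + (cy' t)\<^sup>2)"
        unfolding vector_derivative_at[OF \<gamma>] \<gamma>'_def by (rule hnorm_frame)
      also have "\<dots> \<le> \<bar>cx' t\<bar> + \<bar>cy' t\<bar>" by (rule sqrt_sum_squares_le_sum_abs)
      also have "\<dots> \<le> \<bar>dx\<bar> + \<bar>dy\<bar> + 76 * A" using 1 2 by simp
      also have "\<dots> \<le> 2 * norm (hor a' - hor a) + 76 * (9 * sqrt \<bar>\<zeta>\<bar>)"
      proof -
        have "A \<le> 9 * sqrt \<bar>\<zeta>\<bar>"
          unfolding A_def by (rule real_le_lsqrt) (auto simp: power_mult_distrib)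
        moreover have "\<bar>dx\<bar> \<le> norm (hor a' - hor a)" "\<bar>dy\<bar> \<le> norm (hor a' - hor a)"
          using norm_fst_le[of dx dy] norm_snd_le[of dy dx]
          by (auto simp: a a' dx_def dy_def)
        ultimately show ?thesis by simp
      qed
      also have "\<dots> \<le> 700 * hgauge a a'"
        by (simp add: hgauge_def \<zeta>_def)
      finally show ?thesis using t by (simp add: ennreal_leI)
    qed simp
  qed
  also have "\<dots> = ennreal (700 * hgauge a a')"
    by (simp add: nn_integral_cmult_indicator)
  finally show ?thesis using that hc g0 g1 by blast
qed

lemma dist_H_le: "dist_H a a' \<le> 700 * hgauge a a'"
proof -
  obtain \<gamma> where \<gamma>: "horizontal_curve \<gamma>" "\<gamma> 0 = a" "\<gamma> 1 = a'" "hlength \<gamma> \<le> ennreal (700 * hgauge a a')"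
    by (rule horizontal_curve_exists)
  have "(INF \<gamma> \<in> {\<gamma>. horizontal_curve \<gamma> \<and> \<gamma> 0 = a \<and> \<gamma> 1 = a'}. hlength \<gamma>) \<le> ennreal (700 * hgauge a a')"
    using \<gamma> by (intro INF_lower2[of \<gamma>]) auto
  then show ?thesis
    unfolding dist_H_def using enn2real_mono[of _ "ennreal (700 * hgauge a a')"] hgauge_nonneg[of a a']
    by auto
qed

lemma dist_H_nonneg: "0 \<le> dist_H a a'"
  by (simp add: dist_H_def)

lemma hgauge_le: "hgauge a a' \<le> 3 * dist_H a a'"
proof -
  define I where "I = (INF \<gamma> \<in> {\<gamma>. horizontal_curve \<gamma> \<and> \<gamma> 0 = a \<and> \<gamma> 1 = a'}. hlength \<gamma>)"
  obtain \<gamma> where \<gamma>: "horizontal_curve \<gamma>" "\<gamma> 0 = a" "\<gamma> 1 = a'" "hlength \<gamma> \<le> ennreal (700 * hgauge a a')"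
    by (rule horizontal_curve_exists)
  have "I \<le> hlength \<gamma>" unfolding I_def using \<gamma> by (intro INF_lower) auto
  also note \<gamma>(4)
  \<comment> \<open>\<open>enn2real\<close> sends infinity to 0 and is monotone only below finite
    values; the explicit curve supplies finiteness.\<close>
  finally have "I < \<infinity>" by (rule order.strict_trans1) simp
  have "ennreal (hgauge a a' / 3) \<le> I"
    unfolding I_def
  proof (rule INF_greatest, safe)
    fix \<gamma> assume g: "horizontal_curve \<gamma>" "a = \<gamma> 0" "a' = \<gamma> 1"
    show "ennreal (hgauge (\<gamma> 0) (\<gamma> 1) / 3) \<le> hlength \<gamma>"
    proof (cases "hlength \<gamma>")
      case (real l)
      then have "hgauge (\<gamma> 0) (\<gamma> 1) \<le> 3 * l" using g by (intro horizontal_curve_length_ge[of \<gamma>]) auto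
      then show ?thesis using real by (simp add: ennreal_leI)
    qed simp
  qed
  then have "enn2real (ennreal (hgauge a a' / 3)) \<le> enn2real I"
    using \<open>I < \<infinity>\<close> by (intro enn2real_mono) auto
  then show ?thesis using hgauge_nonneg[of a a'] by (simp add: dist_H_def I_def)
qed

section \<open>Increments of planar Brownian motion\<close>

lemma sets_Collect_vimage:
  "f \<in> measurable N K \<Longrightarrow> A \<in> sets K \<Longrightarrow> {x \<in> space N. f x \<in> A} \<in> sets N"
  using measurable_sets[of f N K A] by (simp add: vimage_def Int_def conj_commute)

lemma standard_BM_increments:
  assumes "standard_BM M W" "0 \<le> \<theta> 0" "\<And>i. i < n \<Longrightarrow> \<theta> i \<le> \<theta> (Suc i)"
  shows "prob_space.indep_vars M (\<lambda>_. borel) (\<lambda>i \<omega>. W (\<theta> (Suc i)) \<omega> - W (\<theta> i) \<omega>) {..<n::nat}"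
proof -
  have "\<forall>(n::nat) \<theta>. 0 \<le> \<theta> 0 \<and> (\<forall>i<n. \<theta> i \<le> \<theta> (Suc i)) \<longrightarrow>
      prob_space.indep_vars M (\<lambda>_. borel) (\<lambda>i \<omega>. W (\<theta> (Suc i)) \<omega> - W (\<theta> i) \<omega>) {..<n}"
    using assms(1) unfolding standard_BM_def by (elim conjE)
  then show ?thesis using assms(2,3) by simp
qed

text \<open>Once the times of \<open>J\<close> are sorted between 0 and \<open>s\<close> and
  \<open>t\<close> is appended, the values at \<open>J\<close> are partial sums of increments before
  the last one, and independence of increments separates them from it.\<close>

lemma standard_BM_past_indep_increment:
  assumes W: "standard_BM M W" and st: "0 \<le> s" "s \<le> t"
    and J: "finite J" "J \<subseteq> {0..s}" and E: "\<And>q. q \<in> J \<Longrightarrow> E q \<in> sets borel" and D: "D \<in> sets borel"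
  shows "measure M {\<omega>\<in>space M. (\<forall>q\<in>J. W q \<omega> \<in> E q) \<and> W t \<omega> - W s \<omega> \<in> D} =
    measure M {\<omega>\<in>space M. \<forall>q\<in>J. W q \<omega> \<in> E q} * measure M {\<omega>\<in>space M. W t \<omega> - W s \<omega> \<in> D}"
proof -
  interpret prob_space M using W by (simp add: standard_BM_def)
  have rv [measurable]: "W u \<in> borel_measurable M" if "0 \<le> u" for u
    using W that by (simp add: standard_BM_def)
  \<comment> \<open>Inserting 0 makes the partial sums start at \<open>W 0\<close>; inserting
    \<open>s\<close> makes the last increment, the one of index \<open>n - 1\<close>, equal to
    \<open>W t - W s\<close>.\<close>
  define xs where "xs = sorted_list_of_set (insert 0 (insert s J))"
  have set_xs: "set xs = insert 0 (insert s J)" unfolding xs_def using J by (intro set_sorted_list_of_set) auto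
  have sorted: "sorted xs" by (simp add: xs_def)
  define n where "n = length xs"
  have n0: "n > 0" using set_xs by (auto simp: n_def)
  define \<theta> where "\<theta> i = (if i < n then xs ! i else t)" for i
  have xs_range: "xs ! i \<in> {0..s}" if "i < n" for i
    using nth_mem[of i xs] that set_xs J st by (auto simp: n_def)
  have xs0: "xs ! 0 = 0"
  proof -
    obtain i where i: "i < n" "xs ! i = 0" using set_xs in_set_conv_nth[of 0 xs] by (auto simp: n_def)
    then have "xs ! 0 \<le> 0" using sorted_nth_mono[OF sorted, of 0 i] by (simp add: n_def)
    then show ?thesis using xs_range[OF n0] by simp
  qed
  have xsl: "xs ! (n - 1) = s"
  proof -
    obtain i where i: "i < n" "xs ! i = s" using set_xs in_set_conv_nth[of s xs] by (auto simp: n_def)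
    then have "s \<le> xs ! (n - 1)" using sorted_nth_mono[OF sorted, of i "n - 1"] by (simp add: n_def)
    then show ?thesis using xs_range[of "n - 1"] n0 by simp
  qed
  define V where "V i \<omega> = W (\<theta> (Suc i)) \<omega> - W (\<theta> i) \<omega>" for i \<omega>
  have \<theta>0: "\<theta> i \<ge> 0" for i using xs_range[of i] st by (auto simp: \<theta>_def)
  have Vn: "V (n - 1) = (\<lambda>\<omega>. W t \<omega> - W s \<omega>)"
    using n0 xsl by (simp add: V_def \<theta>_def fun_eq_iff)
  have "\<theta> i \<le> \<theta> (Suc i)" if "i < n" for i
    using that sorted_nth_mono[OF sorted, of i "Suc i"] xs_range[of i] st by (auto simp: \<theta>_def n_def)
  moreover have "0 \<le> \<theta> 0" using xs0 n0 by (simp add: \<theta>_def)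
  ultimately have "indep_vars (\<lambda>_. borel) V {..<n}"
    using standard_BM_increments[OF W] unfolding V_def[abs_def] by simp
  then have ind: "indep_var (PiM {..<n-1} (\<lambda>_. borel)) (\<lambda>\<omega>. restrict (\<lambda>i. V i \<omega>) {..<n-1})
      (PiM {n-1} (\<lambda>_. borel)) (\<lambda>\<omega>. restrict (\<lambda>i. V i \<omega>) {n-1})"
    using n0 by (intro indep_var_restrict[where I = "{..<n}"]) auto
  define idx where "idx q = (SOME i. i < n \<and> xs ! i = q)" for q
  have idx: "idx q < n \<and> xs ! (idx q) = q" if "q \<in> J" for q
  proof -
    have "\<exists>i. i < n \<and> xs ! i = q" using that set_xs in_set_conv_nth[of q xs] by (auto simp: n_def)
    then show ?thesis unfolding idx_def by (rule someI_ex)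
  qed
  define A where "A = {v \<in> space (PiM {..<n-1} (\<lambda>_. borel :: real measure)). \<forall>q\<in>J. (\<Sum>i<idx q. v i) \<in> E q}"
  define B where "B = {v \<in> space (PiM {n-1} (\<lambda>_. borel :: real measure)). v (n-1) \<in> D}"
  have A: "A \<in> sets (PiM {..<n-1} (\<lambda>_. borel))"
    unfolding A_def
  proof (rule sets.sets_Collect_finite_All[OF _ J(1)])
    fix q assume q: "q \<in> J"
    have "(\<lambda>v. \<Sum>i<idx q. v i) \<in> borel_measurable (PiM {..<n-1} (\<lambda>_. borel :: real measure))"
      using idx[OF q] by (intro borel_measurable_sum measurable_component_singleton) auto
    from sets_Collect_vimage[OF this E[OF q]]
    show "{v \<in> space (PiM {..<n-1} (\<lambda>_. borel :: real measure)). (\<Sum>i<idx q. v i) \<in> E q}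
      \<in> sets (PiM {..<n-1} (\<lambda>_. borel))" .
  qed
  have B: "B \<in> sets (PiM {n-1} (\<lambda>_. borel))"
    unfolding B_def
    by (rule sets_Collect_vimage[where K = borel, OF measurable_component_singleton[where M = "\<lambda>_. borel"] D]) simp
  \<comment> \<open>\<open>W 0\<close> vanishes only almost surely. The exact identities therefore
    concern \<open>W q - W 0\<close>, and null sets are discarded at the end.\<close>
  define A' where "A' = {\<omega>\<in>space M. \<forall>q\<in>J. W q \<omega> - W 0 \<omega> \<in> E q}"
  have sumV: "(\<Sum>i<idx q. V i \<omega>) = W q \<omega> - W 0 \<omega>" if "q \<in> J" for q \<omega>
    using idx[OF that] n0 xs0 unfolding V_def
    by (subst sum_lessThan_telescope) (auto simp: \<theta>_def)
  have A'_eq: "(\<lambda>\<omega>. restrict (\<lambda>i. V i \<omega>) {..<n-1}) -` A \<inter> space M = A'"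
  proof -
    have "(\<Sum>i<idx q. restrict (\<lambda>i. V i \<omega>) {..<n-1} i) = W q \<omega> - W 0 \<omega>" if "q \<in> J" for q \<omega>
      unfolding sumV[OF that, symmetric] using idx[OF that] by (intro sum.cong) auto
    then show ?thesis by (auto simp: A_def A'_def space_PiM)
  qed
  have B'_eq: "(\<lambda>\<omega>. restrict (\<lambda>i. V i \<omega>) {n-1}) -` B \<inter> space M = {\<omega>\<in>space M. W t \<omega> - W s \<omega> \<in> D}"
    by (auto simp: B_def space_PiM Vn[simplified])
  have "prob (A' \<inter> {\<omega>\<in>space M. W t \<omega> - W s \<omega> \<in> D}) = prob A' * prob {\<omega>\<in>space M. W t \<omega> - W s \<omega> \<in> D}"
  proof -
    have "(\<lambda>x. ((\<lambda>\<omega>. restrict (\<lambda>i. V i \<omega>) {..<n-1}) x, (\<lambda>\<omega>. restrict (\<lambda>i. V i \<omega>) {n-1}) x)) -` (A \<times> B) \<inter> space M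
      = A' \<inter> {\<omega>\<in>space M. W t \<omega> - W s \<omega> \<in> D}"
      unfolding A'_eq[symmetric] B'_eq[symmetric] by auto
    then show ?thesis using indep_varD[OF ind A B] A'_eq B'_eq by simp
  qed
  moreover have J0: "0 \<le> q" if "q \<in> J" for q using J that by auto
  have W0: "AE \<omega> in M. W 0 \<omega> = 0" using W by (simp add: standard_BM_def)
  have mJ: "{\<omega>\<in>space M. \<forall>q\<in>J. W q \<omega> \<in> E q} \<in> events"
    by (rule sets.sets_Collect_finite_All[OF _ J(1)]) (use E J0 rv in \<open>auto intro!: sets_Collect_vimage[where K = borel]\<close>)
  have mA': "A' \<in> events"
    unfolding A'_def by (rule sets.sets_Collect_finite_All[OF _ J(1)]) (use E J0 rv in \<open>auto intro!: sets_Collect_vimage[where K = borel]\<close>)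
  have mD: "{\<omega>\<in>space M. W t \<omega> - W s \<omega> \<in> D} \<in> events"
    using st by (intro sets_Collect_vimage[OF borel_measurable_diff[OF rv rv] D]) auto
  have 1: "prob A' = prob {\<omega>\<in>space M. \<forall>q\<in>J. W q \<omega> \<in> E q}"
    by (rule finite_measure_eq_AE[OF _ mA' mJ]) (use W0 in \<open>auto simp: A'_def\<close>)
  have 2: "prob (A' \<inter> {\<omega>\<in>space M. W t \<omega> - W s \<omega> \<in> D})
    = prob ({\<omega>\<in>space M. \<forall>q\<in>J. W q \<omega> \<in> E q} \<inter> {\<omega>\<in>space M. W t \<omega> - W s \<omega> \<in> D})"
    by (rule finite_measure_eq_AE) (use W0 mA' mJ mD in \<open>auto simp: A'_def\<close>)
  have 3: "{\<omega>\<in>space M. \<forall>q\<in>J. W q \<omega> \<in> E q} \<inter> {\<omega>\<in>space M. W t \<omega> - W s \<omega> \<in> D}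
    = {\<omega>\<in>space M. (\<forall>q\<in>J. W q \<omega> \<in> E q) \<and> W t \<omega> - W s \<omega> \<in> D}" by auto
  ultimately show ?thesis by (simp only: 1 2 3)
qed

locale planar_brownian = prob_space M for M :: "'w measure" +
  fixes B1 B2 :: "real \<Rightarrow> 'w \<Rightarrow> real"
  assumes planar: "planar_BM M B1 B2"
begin

abbreviation "\<F> \<equiv> natural_filtration M B1 B2"

lemma BM1: "standard_BM M B1" and BM2: "standard_BM M B2" and indep12: "indep_processes M B1 B2"
  using planar by (simp_all add: planar_BM_def)

lemma B1_measurable [measurable]: "0 \<le> t \<Longrightarrow> B1 t \<in> borel_measurable M"
  using BM1 by (simp add: standard_BM_def)

lemma B2_measurable [measurable]: "0 \<le> t \<Longrightarrow> B2 t \<in> borel_measurable M"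
  using BM2 by (simp add: standard_BM_def)

lemma space_\<F> [simp]: "space (\<F> t) = space M"
  by (simp add: natural_filtration_def)

lemma B_pair_measurable_\<F>:
  assumes "0 \<le> s" "s \<le> t" shows "(\<lambda>\<omega>. (B1 s \<omega>, B2 s \<omega>)) \<in> borel_measurable (\<F> t)"
proof -
  have "(\<lambda>\<omega>. \<lambda>s\<in>{0..t}. (B1 s \<omega>, B2 s \<omega>)) \<in> measurable (\<F> t) (PiM {0..t} (\<lambda>_. borel))"
    unfolding natural_filtration_def
    by (rule measurable_vimage_algebra1) (auto simp: space_PiM)
  from measurable_compose[OF this measurable_component_singleton[of s]] assms
  show ?thesis by simp
qed

lemma B1_measurable_\<F>: "0 \<le> s \<Longrightarrow> s \<le> t \<Longrightarrow> B1 s \<in> borel_measurable (\<F> t)"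
  using measurable_compose[OF B_pair_measurable_\<F>, of s t fst borel] by (simp flip: borel_prod)

lemma B2_measurable_\<F>: "0 \<le> s \<Longrightarrow> s \<le> t \<Longrightarrow> B2 s \<in> borel_measurable (\<F> t)"
  using measurable_compose[OF B_pair_measurable_\<F>, of s t snd borel] by (simp flip: borel_prod)

lemma \<F>_least:
  assumes "space N = space M" "\<And>s. 0 \<le> s \<Longrightarrow> s \<le> t \<Longrightarrow> B1 s \<in> borel_measurable N"
    "\<And>s. 0 \<le> s \<Longrightarrow> s \<le> t \<Longrightarrow> B2 s \<in> borel_measurable N"
  shows "sets (\<F> t) \<subseteq> sets N"
  unfolding natural_filtration_def
proof (rule sets_image_in_sets[OF assms(1)], rule measurable_restrict)
  fix s assume "s \<in> {0..t}"
  then show "(\<lambda>\<omega>. (B1 s \<omega>, B2 s \<omega>)) \<in> borel_measurable N"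
    using assms(2,3) by (intro borel_measurable_Pair) auto
qed

lemma sets_\<F>: "sets (\<F> t) \<subseteq> events"
  by (rule \<F>_least) auto

lemma sets_\<F>_mono: "s \<le> t \<Longrightarrow> sets (\<F> s) \<subseteq> sets (\<F> t)"
  by (rule \<F>_least) (auto intro: B1_measurable_\<F> B2_measurable_\<F>)

lemma measurable_\<F>_M: "Z \<in> measurable (\<F> s) N \<Longrightarrow> Z \<in> measurable M N"
  by (rule measurable_from_subalg[of M "\<F> s"]) (use sets_\<F> in \<open>auto simp: subalgebra_def\<close>)

lemma measurable_\<F>_mono: "Z \<in> measurable (\<F> s) N \<Longrightarrow> s \<le> t \<Longrightarrow> Z \<in> measurable (\<F> t) N"
  by (rule measurable_from_subalg[of "\<F> t" "\<F> s"]) (use sets_\<F>_mono in \<open>auto simp: subalgebra_def\<close>)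

text \<open>Cylinder sets \<open>G\<close> of the past and rectangles \<open>H\<close> of the
  increment are stable under intersection and generate the two sigma-algebras. On them independence
  follows by splitting \<open>B1\<close> from \<open>B2\<close>, and then, within each, the past
  from the increment.\<close>

lemma indep_past_increment:
  assumes st: "0 \<le> s" "s \<le> t"
    and Z: "Z \<in> borel_measurable (\<F> s)" and g: "g \<in> borel_measurable (borel :: (real \<times> real) measure)"
  shows "indep_var borel (Z :: 'w \<Rightarrow> real) borel (\<lambda>\<omega>. g (B1 t \<omega> - B1 s \<omega>, B2 t \<omega> - B2 s \<omega>) :: real)"
proof -
  have t: "0 \<le> t" using st by simp
  let ?D1 = "\<lambda>\<omega>. B1 t \<omega> - B1 s \<omega>" and ?D2 = "\<lambda>\<omega>. B2 t \<omega> - B2 s \<omega>"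
  define G where "G = {{\<omega>\<in>space M. \<forall>q\<in>J. B1 q \<omega> \<in> E1 q \<and> B2 q \<omega> \<in> E2 q} | J E1 E2.
    finite J \<and> J \<subseteq> {0..s} \<and> (\<forall>q. E1 q \<in> sets borel \<and> E2 q \<in> sets borel)}"
  define H where "H = {{\<omega>\<in>space M. ?D1 \<omega> \<in> C1 \<and> ?D2 \<omega> \<in> C2} | C1 C2. C1 \<in> sets borel \<and> C2 \<in> sets borel}"
  \<comment> \<open>The mixed events are regrouped by process, so that independence of the two whole
    processes applies.\<close>
  have joint: "prob {\<omega>\<in>space M. ((\<forall>q\<in>J. B1 q \<omega> \<in> E1 q) \<and> ?D1 \<omega> \<in> C1) \<and> (\<forall>q\<in>J. B2 q \<omega> \<in> E2 q) \<and> ?D2 \<omega> \<in> C2}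
    = prob {\<omega>\<in>space M. (\<forall>q\<in>J. B1 q \<omega> \<in> E1 q) \<and> ?D1 \<omega> \<in> C1}
      * prob {\<omega>\<in>space M. (\<forall>q\<in>J. B2 q \<omega> \<in> E2 q) \<and> ?D2 \<omega> \<in> C2}"
    if "finite J" "J \<subseteq> {0..s}" "\<And>q. E1 q \<in> sets borel" "\<And>q. E2 q \<in> sets borel" "C1 \<in> sets borel" "C2 \<in> sets borel"
    for J E1 E2 C1 C2
  proof -
    define S where "S E C = {u \<in> space (PiM {0..} (\<lambda>_. borel :: real measure)). (\<forall>q\<in>J. u q \<in> E q) \<and> u t - u s \<in> C}"
      for E :: "real \<Rightarrow> real set" and C
    have S: "S E C \<in> sets (PiM {0..} (\<lambda>_. borel))" if "\<And>q. E q \<in> sets borel" "C \<in> sets borel" for E C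
      unfolding S_def
    proof (intro sets.sets_Collect_conj sets.sets_Collect_finite_All \<open>finite J\<close>)
      have comp: "(\<lambda>u. u q) \<in> borel_measurable (PiM {0..} (\<lambda>_. borel :: real measure))" if "0 \<le> q" for q
        using that by (intro measurable_component_singleton) auto
      show "{u \<in> space (PiM {0..} (\<lambda>_. borel)). u q \<in> E q} \<in> sets (PiM {0..} (\<lambda>_. borel))" if "q \<in> J" for q
        using that \<open>J \<subseteq> {0..s}\<close> \<open>\<And>q. E q \<in> sets borel\<close> by (intro sets_Collect_vimage[OF comp]) auto
      show "{u \<in> space (PiM {0..} (\<lambda>_. borel)). u t - u s \<in> C} \<in> sets (PiM {0..} (\<lambda>_. borel))"
        by (rule sets_Collect_vimage[OF borel_measurable_diff[OF comp[OF t] comp[OF st(1)]] \<open>C \<in> sets borel\<close>])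
    qed
    have restr: "(\<lambda>\<omega>. \<lambda>u\<in>{0..}. W u \<omega>) -` S E C \<inter> space M = {\<omega>\<in>space M. (\<forall>q\<in>J. W q \<omega> \<in> E q) \<and> W t \<omega> - W s \<omega> \<in> C}"
      for W E C
    proof -
      have "0 \<le> q" if "q \<in> J" for q using that \<open>J \<subseteq> {0..s}\<close> by auto
      then show ?thesis using st t by (auto simp: S_def space_PiM)
    qed
    from indep_varD[OF indep12[unfolded indep_processes_def] S[OF that(3,5)] S[OF that(4,6)]]
    have "prob ((\<lambda>x. (\<lambda>u\<in>{0..}. B1 u x, \<lambda>u\<in>{0..}. B2 u x)) -` (S E1 C1 \<times> S E2 C2) \<inter> space M) =
      prob {\<omega>\<in>space M. (\<forall>q\<in>J. B1 q \<omega> \<in> E1 q) \<and> ?D1 \<omega> \<in> C1}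
      * prob {\<omega>\<in>space M. (\<forall>q\<in>J. B2 q \<omega> \<in> E2 q) \<and> ?D2 \<omega> \<in> C2}"
      unfolding restr .
    moreover have "(\<lambda>x. (\<lambda>u\<in>{0..}. B1 u x, \<lambda>u\<in>{0..}. B2 u x)) -` (S E1 C1 \<times> S E2 C2) \<inter> space M
      = ((\<lambda>\<omega>. \<lambda>u\<in>{0..}. B1 u \<omega>) -` S E1 C1 \<inter> space M) \<inter> ((\<lambda>\<omega>. \<lambda>u\<in>{0..}. B2 u \<omega>) -` S E2 C2 \<inter> space M)"
      by auto
    moreover have "\<dots> = {\<omega>\<in>space M. ((\<forall>q\<in>J. B1 q \<omega> \<in> E1 q) \<and> ?D1 \<omega> \<in> C1) \<and> (\<forall>q\<in>J. B2 q \<omega> \<in> E2 q) \<and> ?D2 \<omega> \<in> C2}"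
      unfolding restr by auto
    ultimately show ?thesis by simp
  qed
  have GH: "indep_set G H"
  proof (rule indep_setI)
    show "G \<subseteq> events"
    proof (clarsimp simp: G_def)
      fix J and E1 E2 :: "real \<Rightarrow> real set" assume "finite J" "J \<subseteq> {0..s}" "\<forall>q. E1 q \<in> sets borel \<and> E2 q \<in> sets borel"
      then show "{\<omega>\<in>space M. \<forall>q\<in>J. B1 q \<omega> \<in> E1 q \<and> B2 q \<omega> \<in> E2 q} \<in> events"
        by (intro sets.sets_Collect_finite_All sets.sets_Collect_conj sets_Collect_vimage[where K = borel]
          B1_measurable B2_measurable) auto
    qed
    show "H \<subseteq> events"
    proof (clarsimp simp: H_def)
      fix C1 C2 :: "real set" assume "C1 \<in> sets borel" "C2 \<in> sets borel"
      then show "{\<omega>\<in>space M. ?D1 \<omega> \<in> C1 \<and> ?D2 \<omega> \<in> C2} \<in> events"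
        using st t by (intro sets.sets_Collect_conj sets_Collect_vimage[where K = borel]
          borel_measurable_diff B1_measurable B2_measurable) auto
    qed
  next
    fix a b assume "a \<in> G" "b \<in> H"
    then obtain J E1 E2 C1 C2 where
      a: "a = {\<omega>\<in>space M. \<forall>q\<in>J. B1 q \<omega> \<in> E1 q \<and> B2 q \<omega> \<in> E2 q}" and
      b: "b = {\<omega>\<in>space M. ?D1 \<omega> \<in> C1 \<and> ?D2 \<omega> \<in> C2}" and
      J: "finite J" "J \<subseteq> {0..s}" and E': "\<forall>q. E1 q \<in> sets borel \<and> E2 q \<in> sets borel" and
      C: "C1 \<in> sets borel" "C2 \<in> sets borel"
      unfolding G_def H_def by auto
    have E: "E1 q \<in> sets borel" "E2 q \<in> sets borel" for q using E' by auto
    \<comment> \<open>Both marginals are instances of \<open>joint\<close>: the whole line imposes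
      no condition on the increment, the empty set of times none on the past.\<close>
    have a': "a = {\<omega>\<in>space M. ((\<forall>q\<in>J. B1 q \<omega> \<in> E1 q) \<and> ?D1 \<omega> \<in> UNIV) \<and> (\<forall>q\<in>J. B2 q \<omega> \<in> E2 q) \<and> ?D2 \<omega> \<in> UNIV}"
      unfolding a by auto
    have b': "b = {\<omega>\<in>space M. ((\<forall>q\<in>{}. B1 q \<omega> \<in> E1 q) \<and> ?D1 \<omega> \<in> C1) \<and> (\<forall>q\<in>{}. B2 q \<omega> \<in> E2 q) \<and> ?D2 \<omega> \<in> C2}"
      unfolding b by auto
    have ab: "a \<inter> b = {\<omega>\<in>space M. ((\<forall>q\<in>J. B1 q \<omega> \<in> E1 q) \<and> ?D1 \<omega> \<in> C1) \<and> (\<forall>q\<in>J. B2 q \<omega> \<in> E2 q) \<and> ?D2 \<omega> \<in> C2}"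
      unfolding a b by auto
    have pa: "prob a = prob {\<omega>\<in>space M. \<forall>q\<in>J. B1 q \<omega> \<in> E1 q} * prob {\<omega>\<in>space M. \<forall>q\<in>J. B2 q \<omega> \<in> E2 q}"
      unfolding a' using joint[OF J E, of UNIV UNIV] by simp
    have pb: "prob b = prob {\<omega>\<in>space M. ?D1 \<omega> \<in> C1} * prob {\<omega>\<in>space M. ?D2 \<omega> \<in> C2}"
      unfolding b' using joint[OF _ _ E C, of "{}"] by simp
    show "prob (a \<inter> b) = prob a * prob b"
      unfolding ab pa pb joint[OF J E C]
        standard_BM_past_indep_increment[OF BM1 st J E(1) C(1)]
        standard_BM_past_indep_increment[OF BM2 st J E(2) C(2)]
      by simp
  qed
  have stG: "Int_stable G"
    unfolding Int_stable_def
  proof (intro ballI)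
    fix a b assume "a \<in> G" "b \<in> G"
    then obtain J E1 E2 J' E1' E2' where
      a: "a = {\<omega>\<in>space M. \<forall>q\<in>J. B1 q \<omega> \<in> E1 q \<and> B2 q \<omega> \<in> E2 q}" and
      b: "b = {\<omega>\<in>space M. \<forall>q\<in>J'. B1 q \<omega> \<in> E1' q \<and> B2 q \<omega> \<in> E2' q}" and
      J: "finite J" "J \<subseteq> {0..s}" "finite J'" "J' \<subseteq> {0..s}" and
      E: "\<forall>q. E1 q \<in> sets borel \<and> E2 q \<in> sets borel" "\<forall>q. E1' q \<in> sets borel \<and> E2' q \<in> sets borel"
      unfolding G_def by auto
    \<comment> \<open>A time that occurs in only one of the two cylinders gets the whole line as the
      constraint from the other.\<close>
    define F1 where "F1 q = (if q \<in> J then E1 q else UNIV) \<inter> (if q \<in> J' then E1' q else UNIV)" for q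
    define F2 where "F2 q = (if q \<in> J then E2 q else UNIV) \<inter> (if q \<in> J' then E2' q else UNIV)" for q
    have "a \<inter> b = {\<omega>\<in>space M. \<forall>q\<in>J \<union> J'. B1 q \<omega> \<in> F1 q \<and> B2 q \<omega> \<in> F2 q}"
      unfolding a b F1_def F2_def by auto
    moreover have "finite (J \<union> J')" "J \<union> J' \<subseteq> {0..s}" "\<forall>q. F1 q \<in> sets borel \<and> F2 q \<in> sets borel"
      using J E by (auto simp: F1_def F2_def)
    ultimately show "a \<inter> b \<in> G" unfolding G_def mem_Collect_eq
      by (intro exI[of _ "J \<union> J'"] exI[of _ F1] exI[of _ F2] conjI)
  qed
  have stH: "Int_stable H"
    unfolding Int_stable_def
  proof (intro ballI)
    fix a b assume "a \<in> H" "b \<in> H"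
    then obtain C1 C2 C1' C2' where
      a: "a = {\<omega>\<in>space M. ?D1 \<omega> \<in> C1 \<and> ?D2 \<omega> \<in> C2}" and b: "b = {\<omega>\<in>space M. ?D1 \<omega> \<in> C1' \<and> ?D2 \<omega> \<in> C2'}"
      and C: "C1 \<in> sets borel" "C2 \<in> sets borel" "C1' \<in> sets borel" "C2' \<in> sets borel"
      unfolding H_def by auto
    have "a \<inter> b = {\<omega>\<in>space M. ?D1 \<omega> \<in> C1 \<inter> C1' \<and> ?D2 \<omega> \<in> C2 \<inter> C2'}" unfolding a b by auto
    moreover have "C1 \<inter> C1' \<in> sets borel" "C2 \<inter> C2' \<in> sets borel" using C by auto
    ultimately show "a \<inter> b \<in> H" unfolding H_def mem_Collect_eq
      by (intro exI[of _ "C1 \<inter> C1'"] exI[of _ "C2 \<inter> C2'"] conjI)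
  qed
  have Gpow: "G \<subseteq> Pow (space M)" and Hpow: "H \<subseteq> Pow (space M)" by (auto simp: G_def H_def)
  have FG: "sets (\<F> s) \<subseteq> sigma_sets (space M) G"
  proof -
    have "sets (\<F> s) \<subseteq> sets (sigma (space M) G)"
    proof (rule \<F>_least)
      show "space (sigma (space M) G) = space M" using Gpow by (simp add: space_measure_of)
      fix u assume u: "0 \<le> u" "u \<le> s"
      show "B1 u \<in> borel_measurable (sigma (space M) G)"
      proof (rule measurableI)
        fix A :: "real set" assume A: "A \<in> sets borel"
        have "{\<omega>\<in>space M. \<forall>q\<in>{u}. B1 q \<omega> \<in> (\<lambda>_. A) q \<and> B2 q \<omega> \<in> (\<lambda>_. UNIV) q} \<in> G"
          unfolding G_def mem_Collect_eq using u A
          by (intro exI[of _ "{u}"] exI[of _ "\<lambda>_. A"] exI[of _ "\<lambda>_. UNIV"] conjI refl) auto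
        moreover have "B1 u -` A \<inter> space (sigma (space M) G)
          = {\<omega>\<in>space M. \<forall>q\<in>{u}. B1 q \<omega> \<in> (\<lambda>_. A) q \<and> B2 q \<omega> \<in> (\<lambda>_. UNIV) q}"
          using Gpow by (auto simp: space_measure_of)
        ultimately show "B1 u -` A \<inter> space (sigma (space M) G) \<in> sets (sigma (space M) G)"
          using Gpow by (simp add: sets_measure_of sigma_sets.Basic)
      qed simp
      show "B2 u \<in> borel_measurable (sigma (space M) G)"
      proof (rule measurableI)
        fix A :: "real set" assume A: "A \<in> sets borel"
        have "{\<omega>\<in>space M. \<forall>q\<in>{u}. B1 q \<omega> \<in> (\<lambda>_. UNIV) q \<and> B2 q \<omega> \<in> (\<lambda>_. A) q} \<in> G"
          unfolding G_def mem_Collect_eq using u A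
          by (intro exI[of _ "{u}"] exI[of _ "\<lambda>_. UNIV"] exI[of _ "\<lambda>_. A"] conjI refl) auto
        moreover have "B2 u -` A \<inter> space (sigma (space M) G)
          = {\<omega>\<in>space M. \<forall>q\<in>{u}. B1 q \<omega> \<in> (\<lambda>_. UNIV) q \<and> B2 q \<omega> \<in> (\<lambda>_. A) q}"
          using Gpow by (auto simp: space_measure_of)
        ultimately show "B2 u -` A \<inter> space (sigma (space M) G) \<in> sets (sigma (space M) G)"
          using Gpow by (simp add: sets_measure_of sigma_sets.Basic)
      qed simp
    qed
    then show ?thesis using Gpow by (simp add: sets_measure_of)
  qed
  have DH: "(\<lambda>\<omega>. (?D1 \<omega>, ?D2 \<omega>)) \<in> borel_measurable (sigma (space M) H)"
  proof (rule borel_measurable_Pair)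
    show "?D1 \<in> borel_measurable (sigma (space M) H)"
    proof (rule measurableI)
      fix A :: "real set" assume A: "A \<in> sets borel"
      have "{\<omega>\<in>space M. ?D1 \<omega> \<in> A \<and> ?D2 \<omega> \<in> UNIV} \<in> H" unfolding H_def mem_Collect_eq using A by (intro exI[of _ A] exI[of _ UNIV] conjI refl) auto
      moreover have "?D1 -` A \<inter> space (sigma (space M) H) = {\<omega>\<in>space M. ?D1 \<omega> \<in> A \<and> ?D2 \<omega> \<in> UNIV}"
        using Hpow by (auto simp: space_measure_of)
      ultimately show "?D1 -` A \<inter> space (sigma (space M) H) \<in> sets (sigma (space M) H)"
        using Hpow by (simp add: sets_measure_of sigma_sets.Basic)
    qed simp
    show "?D2 \<in> borel_measurable (sigma (space M) H)"
    proof (rule measurableI)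
      fix A :: "real set" assume A: "A \<in> sets borel"
      have "{\<omega>\<in>space M. ?D1 \<omega> \<in> UNIV \<and> ?D2 \<omega> \<in> A} \<in> H" unfolding H_def mem_Collect_eq using A by (intro exI[of _ UNIV] exI[of _ A] conjI refl) auto
      moreover have "?D2 -` A \<inter> space (sigma (space M) H) = {\<omega>\<in>space M. ?D1 \<omega> \<in> UNIV \<and> ?D2 \<omega> \<in> A}"
        using Hpow by (auto simp: space_measure_of)
      ultimately show "?D2 -` A \<inter> space (sigma (space M) H) \<in> sets (sigma (space M) H)"
        using Hpow by (simp add: sets_measure_of sigma_sets.Basic)
    qed simp
  qed
  have gD: "(\<lambda>\<omega>. g (?D1 \<omega>, ?D2 \<omega>)) \<in> borel_measurable (sigma (space M) H)"
    using measurable_compose[OF DH g] .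
  have "indep_set (sigma_sets (space M) G) (sigma_sets (space M) H)"
    by (rule indep_set_sigma_sets[OF GH stG stH])
  then have ind: "indep_sets (case_bool (sigma_sets (space M) G) (sigma_sets (space M) H)) UNIV"
    by (simp add: indep_set_def)
  show ?thesis
    unfolding indep_var_eq
  proof (intro conjI)
    show "Z \<in> borel_measurable M" using Z by (rule measurable_\<F>_M)
    show "(\<lambda>\<omega>. g (?D1 \<omega>, ?D2 \<omega>)) \<in> borel_measurable M"
      by (rule measurable_compose[OF borel_measurable_Pair g]) (use st t in \<open>auto intro!: borel_measurable_diff B1_measurable B2_measurable\<close>)
    show "indep_set (sigma_sets (space M) {Z -` A \<inter> space M |A. A \<in> sets borel})
      (sigma_sets (space M) {(\<lambda>\<omega>. g (?D1 \<omega>, ?D2 \<omega>)) -` A \<inter> space M |A. A \<in> sets borel})"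
      unfolding indep_set_def
    proof (rule indep_sets_mono_sets[OF ind])
      have "sigma_sets (space M) {Z -` A \<inter> space M |A. A \<in> sets borel} \<subseteq> sigma_sets (space M) G"
        using measurable_sets[OF Z] FG by (intro sigma_sets_mono) auto
      moreover have "sigma_sets (space M) {(\<lambda>\<omega>. g (?D1 \<omega>, ?D2 \<omega>)) -` A \<inter> space M |A. A \<in> sets borel} \<subseteq> sigma_sets (space M) H"
        using measurable_sets[OF gD] Hpow by (intro sigma_sets_mono) (auto simp: sets_measure_of space_measure_of)
      ultimately show "(case i of True \<Rightarrow> sigma_sets (space M) {Z -` A \<inter> space M |A. A \<in> sets borel}
        | False \<Rightarrow> sigma_sets (space M) {(\<lambda>\<omega>. g (?D1 \<omega>, ?D2 \<omega>)) -` A \<inter> space M |A. A \<in> sets borel})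
        \<subseteq> (case i of True \<Rightarrow> sigma_sets (space M) G | False \<Rightarrow> sigma_sets (space M) H)" for i
        by (simp split: bool.split)
    qed
  qed
qed

end

section \<open>Moments of increments and discrete martingales\<close>

lemma standard_BM_increment_moments:
  assumes W: "standard_BM M W" and st: "0 \<le> s" "s \<le> t"
  shows "integrable M (\<lambda>\<omega>. (W t \<omega> - W s \<omega>) ^ k)"
    and "(\<integral>\<omega>. W t \<omega> - W s \<omega> \<partial>M) = 0"
    and "(\<integral>\<omega>. (W t \<omega> - W s \<omega>)\<^sup>2 \<partial>M) = t - s"
    and "(\<integral>\<omega>. (W t \<omega> - W s \<omega>) ^ 4 \<partial>M) = 3 * (t - s)\<^sup>2"
proof -
  interpret prob_space M using W by (simp add: standard_BM_def)
  have "integrable M (\<lambda>\<omega>. (W t \<omega> - W s \<omega>) ^ k) \<and> (\<integral>\<omega>. W t \<omega> - W s \<omega> \<partial>M) = 0 \<and>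
    (\<integral>\<omega>. (W t \<omega> - W s \<omega>)\<^sup>2 \<partial>M) = t - s \<and> (\<integral>\<omega>. (W t \<omega> - W s \<omega>) ^ 4 \<partial>M) = 3 * (t - s)\<^sup>2"
  \<comment> \<open>A density is prescribed only for \<open>s < t\<close>; equal times give the
    constant increment 0.\<close>
  proof (cases "s = t")
    case True
    then show ?thesis by (simp add: power_0_left)
  next
    case False
    define \<sigma> where "\<sigma> = sqrt (t - s)"
    have \<sigma>: "\<sigma> > 0" "\<sigma>\<^sup>2 = t - s" using False st by (auto simp: \<sigma>_def)
    have dist: "distributed M lborel (\<lambda>\<omega>. W t \<omega> - W s \<omega>) (normal_density 0 \<sigma>)"
      using W False st unfolding standard_BM_def \<sigma>_def by simp
    have int: "(\<integral>\<omega>. (W t \<omega> - W s \<omega>) ^ j \<partial>M) = (\<integral>x. normal_density 0 \<sigma> x * x ^ j \<partial>lborel)" for j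
      using distributed_integral[OF dist, of "\<lambda>x. x ^ j"] by simp
    have "integrable M (\<lambda>\<omega>. (W t \<omega> - W s \<omega>) ^ k)"
      using distributed_integrable[OF dist, of "\<lambda>x. x ^ k"] integrable_normal_moment[OF \<sigma>(1), of 0 k]
      by simp
    moreover have "(\<integral>\<omega>. W t \<omega> - W s \<omega> \<partial>M) = 0"
      using int[of 1] integral_normal_moment_odd[OF \<sigma>(1), of 0 0] by simp
    moreover have "(\<integral>\<omega>. (W t \<omega> - W s \<omega>)\<^sup>2 \<partial>M) = t - s"
      using int[of 2] integral_normal_moment_even[OF \<sigma>(1), of 0 1] \<sigma>(2) by simp
    moreover have "(\<integral>\<omega>. (W t \<omega> - W s \<omega>) ^ 4 \<partial>M) = 3 * (t - s)\<^sup>2"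
    proof -
      have "(\<integral>\<omega>. (W t \<omega> - W s \<omega>) ^ 4 \<partial>M) = fact 4 / ((2 / \<sigma>\<^sup>2)\<^sup>2 * fact 2)"
        using int[of 4] integral_normal_moment_even[OF \<sigma>(1), of 0 2] by simp
      also have "\<dots> = 3 * (\<sigma>\<^sup>2)\<^sup>2"
        using \<sigma>(1) by (simp add: fact_numeral power_divide)
      finally show ?thesis by (simp add: \<sigma>(2))
    qed
    ultimately show ?thesis by blast
  qed
  then show "integrable M (\<lambda>\<omega>. (W t \<omega> - W s \<omega>) ^ k)" "(\<integral>\<omega>. W t \<omega> - W s \<omega> \<partial>M) = 0"
    "(\<integral>\<omega>. (W t \<omega> - W s \<omega>)\<^sup>2 \<partial>M) = t - s" "(\<integral>\<omega>. (W t \<omega> - W s \<omega>) ^ 4 \<partial>M) = 3 * (t - s)\<^sup>2"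
    by blast+
qed

lemma integrable_mult_of_squares:
  fixes f g :: "'a \<Rightarrow> real"
  assumes "integrable M (\<lambda>x. (f x)\<^sup>2)" "integrable M (\<lambda>x. (g x)\<^sup>2)"
    and [measurable]: "f \<in> borel_measurable M" "g \<in> borel_measurable M"
  shows "integrable M (\<lambda>x. f x * g x)"
proof (rule Bochner_Integration.integrable_bound)
  show "integrable M (\<lambda>x. (f x)\<^sup>2 + (g x)\<^sup>2)" using assms(1,2) by (rule Bochner_Integration.integrable_add)
  have "\<bar>a * b\<bar> \<le> a\<^sup>2 + b\<^sup>2" for a b :: real
  proof -
    have "2 * (\<bar>a\<bar> * \<bar>b\<bar>) \<le> a\<^sup>2 + b\<^sup>2" using sum_squares_bound[of "\<bar>a\<bar>" "\<bar>b\<bar>"] by simp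
    moreover have "0 \<le> \<bar>a\<bar> * \<bar>b\<bar>" by simp
    ultimately show ?thesis by (simp only: abs_mult)
  qed
  then show "AE x in M. norm (f x * g x) \<le> norm ((f x)\<^sup>2 + (g x)\<^sup>2)" by simp
qed measurable

definition lin :: "real \<times> real \<Rightarrow> real \<times> real \<Rightarrow> real" where
  "lin c d = fst c * fst d + snd c * snd d"

text \<open>Rotation by a right angle: \<open>perp u\<close> is the direction of the component
  \<open>w\<close> of the planar motion.\<close>

definition perp :: "real \<times> real \<Rightarrow> real \<times> real" where
  "perp c = (- snd c, fst c)"

lemma norm_perp [simp]: "norm (perp c) = norm c"
  by (cases c) (simp add: perp_def norm_Pair add.commute)

lemma lin_measurable [measurable]: "lin c \<in> borel_measurable borel"
  unfolding lin_def[abs_def] by (intro borel_measurable_continuous_onI continuous_intros)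

lemma norm_eq_1_coords: "norm (c :: real \<times> real) = 1 \<Longrightarrow> (fst c)\<^sup>2 + (snd c)\<^sup>2 = 1"
  by (cases c) (simp add: norm_Pair)

context planar_brownian
begin

text \<open>A general \<open>g\<close> lets one independence statement serve the increments in a
  direction, their squares, and products of orthogonal components.\<close>

definition incr :: "(real \<times> real \<Rightarrow> real) \<Rightarrow> real \<Rightarrow> real \<Rightarrow> 'w \<Rightarrow> real" where
  "incr g s t \<omega> = g (B1 t \<omega> - B1 s \<omega>, B2 t \<omega> - B2 s \<omega>)"

lemma incr_measurable_\<F>:
  assumes "0 \<le> s" "s \<le> t" "g \<in> borel_measurable borel"
  shows "incr g s t \<in> borel_measurable (\<F> t)"
  unfolding incr_def[abs_def]
  by (rule measurable_compose[OF borel_measurable_Pair assms(3)])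
    (use assms in \<open>auto intro!: borel_measurable_diff B1_measurable_\<F> B2_measurable_\<F>\<close>)

lemma incr_measurable:
  "0 \<le> s \<Longrightarrow> s \<le> t \<Longrightarrow> g \<in> borel_measurable borel \<Longrightarrow> incr g s t \<in> borel_measurable M"
  by (rule measurable_\<F>_M[OF incr_measurable_\<F>])

lemma past_mult_incr:
  assumes st: "0 \<le> s" "s \<le> t" and Z: "Z \<in> borel_measurable (\<F> s)" "integrable M Z"
    and g: "g \<in> borel_measurable borel" "integrable M (incr g s t)"
  shows "integrable M (\<lambda>\<omega>. Z \<omega> * incr g s t \<omega>)"
    and "(\<integral>\<omega>. Z \<omega> * incr g s t \<omega> \<partial>M) = (\<integral>\<omega>. Z \<omega> \<partial>M) * (\<integral>\<omega>. incr g s t \<omega> \<partial>M)"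
proof -
  have ind: "indep_var borel Z borel (incr g s t)"
    unfolding incr_def[abs_def] by (rule indep_past_increment[OF st Z(1) g(1)])
  show "integrable M (\<lambda>\<omega>. Z \<omega> * incr g s t \<omega>)"
    by (rule indep_var_integrable[OF ind Z(2) g(2)])
  show "(\<integral>\<omega>. Z \<omega> * incr g s t \<omega> \<partial>M) = (\<integral>\<omega>. Z \<omega> \<partial>M) * (\<integral>\<omega>. incr g s t \<omega> \<partial>M)"
    by (rule indep_var_lebesgue_integral[OF ind Z(2) g(2)])
qed

lemma incr_pair_moments:
  assumes st: "0 \<le> s" "s \<le> t"
  shows "integrable M (\<lambda>\<omega>. (B1 t \<omega> - B1 s \<omega>) * (B2 t \<omega> - B2 s \<omega>))"
    and "(\<integral>\<omega>. (B1 t \<omega> - B1 s \<omega>) * (B2 t \<omega> - B2 s \<omega>) \<partial>M) = 0"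
proof -
  have t: "0 \<le> t" using st by simp
  have comp: "(\<lambda>u. u t - u s) \<in> borel_measurable (PiM {0..} (\<lambda>_. borel :: real measure))"
    using st t by (intro borel_measurable_diff measurable_component_singleton) auto
  have "indep_var borel ((\<lambda>u. u t - u s) \<circ> (\<lambda>\<omega>. \<lambda>t\<in>{0..}. B1 t \<omega>)) borel ((\<lambda>u. u t - u s) \<circ> (\<lambda>\<omega>. \<lambda>t\<in>{0..}. B2 t \<omega>))"
    by (rule indep_var_compose[OF indep12[unfolded indep_processes_def] comp comp])
  then have ind: "indep_var borel (\<lambda>\<omega>. B1 t \<omega> - B1 s \<omega>) borel (\<lambda>\<omega>. B2 t \<omega> - B2 s \<omega>)"
    using st t by (simp add: comp_def)
  have i: "integrable M (\<lambda>\<omega>. B1 t \<omega> - B1 s \<omega>)" "integrable M (\<lambda>\<omega>. B2 t \<omega> - B2 s \<omega>)"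
    using standard_BM_increment_moments(1)[OF BM1 st, of 1] standard_BM_increment_moments(1)[OF BM2 st, of 1]
    by simp_all
  show "integrable M (\<lambda>\<omega>. (B1 t \<omega> - B1 s \<omega>) * (B2 t \<omega> - B2 s \<omega>))"
    by (rule indep_var_integrable[OF ind i])
  show "(\<integral>\<omega>. (B1 t \<omega> - B1 s \<omega>) * (B2 t \<omega> - B2 s \<omega>) \<partial>M) = 0"
    using indep_var_lebesgue_integral[OF ind i] standard_BM_increment_moments(2)[OF BM1 st] by simp
qed

lemma lin_incr_moments:
  assumes st: "0 \<le> s" "s \<le> t" and c: "norm c = 1"
  shows "integrable M (incr (lin c) s t)" "integrable M (\<lambda>\<omega>. (incr (lin c) s t \<omega>)\<^sup>2)"
    "integrable M (\<lambda>\<omega>. (incr (lin c) s t \<omega>) ^ 4)"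
    and "(\<integral>\<omega>. incr (lin c) s t \<omega> \<partial>M) = 0"
    and "(\<integral>\<omega>. (incr (lin c) s t \<omega>)\<^sup>2 \<partial>M) = t - s"
    and "(\<integral>\<omega>. (incr (lin c) s t \<omega>) ^ 4 \<partial>M) \<le> 48 * (t - s)\<^sup>2"
proof -
  let ?D1 = "\<lambda>\<omega>. B1 t \<omega> - B1 s \<omega>" and ?D2 = "\<lambda>\<omega>. B2 t \<omega> - B2 s \<omega>"
  let ?c1 = "fst c" and ?c2 = "snd c"
  note m1 = standard_BM_increment_moments[OF BM1 st] and m2 = standard_BM_increment_moments[OF BM2 st]
  note c12 = norm_eq_1_coords[OF c]
  have e: "incr (lin c) s t = (\<lambda>\<omega>. ?c1 * ?D1 \<omega> + ?c2 * ?D2 \<omega>)"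
    by (simp add: incr_def lin_def fun_eq_iff)
  have i1: "integrable M ?D1" "integrable M ?D2" using m1(1)[of 1] m2(1)[of 1] by simp_all
  show "integrable M (incr (lin c) s t)" unfolding e using i1 by auto
  show "(\<integral>\<omega>. incr (lin c) s t \<omega> \<partial>M) = 0" unfolding e using i1 m1(2) m2(2) by simp
  have e2: "(\<lambda>\<omega>. (incr (lin c) s t \<omega>)\<^sup>2) =
      (\<lambda>\<omega>. ?c1\<^sup>2 * (?D1 \<omega>)\<^sup>2 + ?c2\<^sup>2 * (?D2 \<omega>)\<^sup>2 + 2 * ?c1 * ?c2 * (?D1 \<omega> * ?D2 \<omega>))"
    unfolding e by (rule ext) algebra
  show "integrable M (\<lambda>\<omega>. (incr (lin c) s t \<omega>)\<^sup>2)"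
    unfolding e2 using m1(1)[of 2] m2(1)[of 2] incr_pair_moments[OF st]
    by (intro Bochner_Integration.integrable_add integrable_mult_right) auto
  have "(\<integral>\<omega>. (incr (lin c) s t \<omega>)\<^sup>2 \<partial>M) = ?c1\<^sup>2 * (t - s) + ?c2\<^sup>2 * (t - s) + 2 * ?c1 * ?c2 * 0"
    unfolding e2 using m1(1)[of 2] m2(1)[of 2] incr_pair_moments[OF st] m1(3) m2(3)
    by (subst Bochner_Integration.integral_add Bochner_Integration.integral_mult_right_zero | simp)+
  also have "\<dots> = (?c1\<^sup>2 + ?c2\<^sup>2) * (t - s)" by (simp add: algebra_simps)
  finally show "(\<integral>\<omega>. (incr (lin c) s t \<omega>)\<^sup>2 \<partial>M) = t - s" using c12 by simp
  \<comment> \<open>Applying \<open>(a + b)\<^sup>2 \<le> 2 * a\<^sup>2 + 2 * b\<^sup>2\<close>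
    twice gives the factor 8, and two fourth moments \<open>3 * (t - s)\<^sup>2\<close> then give
    48. The sharp constant is 3, but only the order in \<open>t - s\<close> matters.\<close>
  have bd: "(incr (lin c) s t \<omega>) ^ 4 \<le> 8 * (?D1 \<omega>) ^ 4 + 8 * (?D2 \<omega>) ^ 4" for \<omega>
  proof -
    have sq: "(a + b)\<^sup>2 \<le> 2 * a\<^sup>2 + 2 * b\<^sup>2" for a b :: real
      using zero_le_power2[of "a - b"] by (simp add: power2_eq_square algebra_simps)
    have "\<bar>?c1 * ?D1 \<omega> + ?c2 * ?D2 \<omega>\<bar> \<le> \<bar>?D1 \<omega>\<bar> + \<bar>?D2 \<omega>\<bar>"
    proof -
      have "\<bar>?c1\<bar> \<le> 1" "\<bar>?c2\<bar> \<le> 1"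
        using c12 by (simp_all add: abs_square_le_1[symmetric] power2_eq_square)
          (smt (verit) zero_le_square)+
      then have "\<bar>?c1\<bar> * \<bar>?D1 \<omega>\<bar> \<le> 1 * \<bar>?D1 \<omega>\<bar>" "\<bar>?c2\<bar> * \<bar>?D2 \<omega>\<bar> \<le> 1 * \<bar>?D2 \<omega>\<bar>"
        by (intro mult_right_mono; simp)+
      then show ?thesis
        using abs_triangle_ineq[of "?c1 * ?D1 \<omega>" "?c2 * ?D2 \<omega>"] by (simp add: abs_mult)
    qed
    then have "(?c1 * ?D1 \<omega> + ?c2 * ?D2 \<omega>)\<^sup>2 \<le> (\<bar>?D1 \<omega>\<bar> + \<bar>?D2 \<omega>\<bar>)\<^sup>2"
      by (rule power2_le_iff_abs_le[THEN iffD2, rotated]) simp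
    also have "\<dots> \<le> 2 * (?D1 \<omega>)\<^sup>2 + 2 * (?D2 \<omega>)\<^sup>2" using sq[of "\<bar>?D1 \<omega>\<bar>" "\<bar>?D2 \<omega>\<bar>"] by simp
    finally have "((?c1 * ?D1 \<omega> + ?c2 * ?D2 \<omega>)\<^sup>2)\<^sup>2 \<le> (2 * (?D1 \<omega>)\<^sup>2 + 2 * (?D2 \<omega>)\<^sup>2)\<^sup>2"
      by (rule power_mono) simp
    also have "\<dots> \<le> 2 * (2 * (?D1 \<omega>)\<^sup>2)\<^sup>2 + 2 * (2 * (?D2 \<omega>)\<^sup>2)\<^sup>2" by (rule sq)
    finally show ?thesis unfolding e by (simp add: power_mult_distrib flip: power_mult)
  qed
  have ib: "integrable M (\<lambda>\<omega>. 8 * (?D1 \<omega>) ^ 4 + 8 * (?D2 \<omega>) ^ 4)"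
    using m1(1)[of 4] m2(1)[of 4] by (intro Bochner_Integration.integrable_add integrable_mult_right) auto
  show i4: "integrable M (\<lambda>\<omega>. (incr (lin c) s t \<omega>) ^ 4)"
  proof (rule Bochner_Integration.integrable_bound[OF ib])
    show "(\<lambda>\<omega>. incr (lin c) s t \<omega> ^ 4) \<in> borel_measurable M"
      using incr_measurable[OF st lin_measurable] by measurable
    show "AE \<omega> in M. norm (incr (lin c) s t \<omega> ^ 4) \<le> norm (8 * (?D1 \<omega>) ^ 4 + 8 * (?D2 \<omega>) ^ 4)"
      using bd by (auto simp: power_even_abs_numeral abs_of_nonneg)
  qed
  have "(\<integral>\<omega>. (incr (lin c) s t \<omega>) ^ 4 \<partial>M) \<le> (\<integral>\<omega>. 8 * (?D1 \<omega>) ^ 4 + 8 * (?D2 \<omega>) ^ 4 \<partial>M)"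
    by (rule integral_mono[OF i4 ib bd])
  also have "\<dots> = 48 * (t - s)\<^sup>2"
    using m1(1)[of 4] m2(1)[of 4] m1(4) m2(4) by simp
  finally show "(\<integral>\<omega>. (incr (lin c) s t \<omega>) ^ 4 \<partial>M) \<le> 48 * (t - s)\<^sup>2" .
qed

text \<open>The covariation increment of two orthogonal components; it appears when the separation
  is averaged over both ends of a cell instead of being taken at the left end.\<close>

definition lin_perp :: "real \<times> real \<Rightarrow> real \<times> real \<Rightarrow> real" where
  "lin_perp c d = lin c d * lin (perp c) d"

lemma lin_perp_measurable [measurable]: "lin_perp c \<in> borel_measurable borel"
  unfolding lin_perp_def[abs_def] by measurable

text \<open>In coordinates the mean is a multiple of the difference of two equal variances plus a
  multiple of a vanishing covariance. The second moment reduces to fourth moments by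
  \<open>2 * a\<^sup>2 * b\<^sup>2 \<le> a ^ 4 + b ^ 4\<close>.\<close>

lemma lin_perp_incr_moments:
  assumes st: "0 \<le> s" "s \<le> t" and c: "norm c = 1"
  shows "integrable M (incr (lin_perp c) s t)" "integrable M (\<lambda>\<omega>. (incr (lin_perp c) s t \<omega>)\<^sup>2)"
    and "(\<integral>\<omega>. incr (lin_perp c) s t \<omega> \<partial>M) = 0"
    and "(\<integral>\<omega>. (incr (lin_perp c) s t \<omega>)\<^sup>2 \<partial>M) \<le> 48 * (t - s)\<^sup>2"
proof -
  let ?D1 = "\<lambda>\<omega>. B1 t \<omega> - B1 s \<omega>" and ?D2 = "\<lambda>\<omega>. B2 t \<omega> - B2 s \<omega>"
  let ?c1 = "fst c" and ?c2 = "snd c"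
  note m1 = standard_BM_increment_moments[OF BM1 st] and m2 = standard_BM_increment_moments[OF BM2 st]
  have e: "incr (lin_perp c) s t =
      (\<lambda>\<omega>. (?c1 * ?c2) * (?D2 \<omega>)\<^sup>2 + (- (?c1 * ?c2)) * (?D1 \<omega>)\<^sup>2 + (?c1\<^sup>2 - ?c2\<^sup>2) * (?D1 \<omega> * ?D2 \<omega>))"
    unfolding incr_def lin_perp_def lin_def perp_def fst_conv snd_conv by (rule ext) algebra
  show int: "integrable M (incr (lin_perp c) s t)"
    unfolding e using m1(1)[of 2] m2(1)[of 2] incr_pair_moments[OF st]
    by (intro Bochner_Integration.integrable_add integrable_mult_right) auto
  have "(\<integral>\<omega>. incr (lin_perp c) s t \<omega> \<partial>M) = (?c1 * ?c2) * (t - s) + (- (?c1 * ?c2)) * (t - s) + (?c1\<^sup>2 - ?c2\<^sup>2) * 0"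
    unfolding e using m1(1)[of 2] m2(1)[of 2] incr_pair_moments[OF st] m1(3) m2(3)
    by (subst Bochner_Integration.integral_add Bochner_Integration.integral_mult_right_zero | simp)+
  then show "(\<integral>\<omega>. incr (lin_perp c) s t \<omega> \<partial>M) = 0" by simp
  note l1 = lin_incr_moments[OF st c] and l2 = lin_incr_moments[OF st, of "perp c", unfolded norm_perp, OF c]
  have bd: "(incr (lin_perp c) s t \<omega>)\<^sup>2 \<le> (1 / 2) * (incr (lin c) s t \<omega>) ^ 4 + (1 / 2) * (incr (lin (perp c)) s t \<omega>) ^ 4" for \<omega>
  proof -
    have "2 * (a\<^sup>2 * b\<^sup>2) \<le> a ^ 4 + b ^ 4" for a b :: real
      using sum_squares_bound[of "a\<^sup>2" "b\<^sup>2"] by (simp flip: power_mult)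
    from this[of "incr (lin c) s t \<omega>" "incr (lin (perp c)) s t \<omega>"]
    show ?thesis by (simp add: incr_def lin_perp_def power_mult_distrib)
  qed
  have ib: "integrable M (\<lambda>\<omega>. (1 / 2) * (incr (lin c) s t \<omega>) ^ 4 + (1 / 2) * (incr (lin (perp c)) s t \<omega>) ^ 4)"
    using l1(3) l2(3) by (intro Bochner_Integration.integrable_add integrable_mult_right) auto
  show i4: "integrable M (\<lambda>\<omega>. (incr (lin_perp c) s t \<omega>)\<^sup>2)"
  proof (rule Bochner_Integration.integrable_bound[OF ib])
    show "(\<lambda>\<omega>. (incr (lin_perp c) s t \<omega>)\<^sup>2) \<in> borel_measurable M"
      using incr_measurable[OF st lin_perp_measurable] by measurable
    show "AE \<omega> in M. norm ((incr (lin_perp c) s t \<omega>)\<^sup>2) \<le> norm ((1 / 2) * (incr (lin c) s t \<omega>) ^ 4 + (1 / 2) * (incr (lin (perp c)) s t \<omega>) ^ 4)"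
      using bd by (auto simp: abs_of_nonneg)
  qed
  have "(\<integral>\<omega>. (incr (lin_perp c) s t \<omega>)\<^sup>2 \<partial>M) \<le> (\<integral>\<omega>. (1 / 2) * (incr (lin c) s t \<omega>) ^ 4 + (1 / 2) * (incr (lin (perp c)) s t \<omega>) ^ 4 \<partial>M)"
    by (rule integral_mono[OF i4 ib bd])
  also have "\<dots> \<le> 48 * (t - s)\<^sup>2"
    using l1(3,6) l2(3,6) by simp
  finally show "(\<integral>\<omega>. (incr (lin_perp c) s t \<omega>)\<^sup>2 \<partial>M) \<le> 48 * (t - s)\<^sup>2" .
qed

text \<open>The discrete isometry. In the square of the next sum the mixed term is a past variable
  times a centred independent increment and has mean zero, while the last term factorises.
  Measurability and square integrability are carried through the induction because the mixed term
  needs them.\<close>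

lemma martingale_sum:
  fixes Z :: "nat \<Rightarrow> 'w \<Rightarrow> real"
  assumes \<theta>: "\<And>i. 0 \<le> \<theta> i" "\<And>i. \<theta> i \<le> \<theta> (Suc i)"
    and Z: "\<And>i. Z i \<in> borel_measurable (\<F> (\<theta> i))" and bound: "\<And>i \<omega>. \<bar>Z i \<omega>\<bar> \<le> C"
    and g: "g \<in> borel_measurable borel"
    and g2: "\<And>i. integrable M (\<lambda>\<omega>. (incr g (\<theta> i) (\<theta> (Suc i)) \<omega>)\<^sup>2)"
    and g1: "\<And>i. (\<integral>\<omega>. incr g (\<theta> i) (\<theta> (Suc i)) \<omega> \<partial>M) = 0"
  defines "S \<equiv> \<lambda>n \<omega>. \<Sum>i<n. Z i \<omega> * incr g (\<theta> i) (\<theta> (Suc i)) \<omega>"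
  shows "S n \<in> borel_measurable (\<F> (\<theta> n)) \<and> integrable M (\<lambda>\<omega>. (S n \<omega>)\<^sup>2) \<and> (\<integral>\<omega>. S n \<omega> \<partial>M) = 0 \<and>
    (\<integral>\<omega>. (S n \<omega>)\<^sup>2 \<partial>M) =
      (\<Sum>i<n. (\<integral>\<omega>. (Z i \<omega>)\<^sup>2 \<partial>M) * (\<integral>\<omega>. (incr g (\<theta> i) (\<theta> (Suc i)) \<omega>)\<^sup>2 \<partial>M))"
proof (induction n)
  case 0
  then show ?case by (simp add: S_def)
next
  case (Suc n)
  let ?I = "incr g (\<theta> n) (\<theta> (Suc n))"
  note st = \<theta>(1)[of n] \<theta>(2)[of n]
  have Sn: "S n \<in> borel_measurable (\<F> (\<theta> n))" and Sn2: "integrable M (\<lambda>\<omega>. (S n \<omega>)\<^sup>2)" using Suc by auto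
  have SnM: "S n \<in> borel_measurable M" and ZM: "Z n \<in> borel_measurable M"
    using Sn Z by (auto intro: measurable_\<F>_M)
  have IM: "?I \<in> borel_measurable M" by (rule incr_measurable[OF st g])
  have I1: "integrable M ?I" using IM g2 by (rule square_integrable_imp_integrable)
  have Zi: "integrable M (Z n)"
    by (rule integrable_const_bound[of _ C]) (use bound ZM in auto)
  have C0: "0 \<le> C" using bound[of 0 undefined] by linarith
  have Z2: "integrable M (\<lambda>\<omega>. (Z n \<omega>)\<^sup>2)"
  proof (rule integrable_const_bound[of _ "C\<^sup>2"])
    show "AE \<omega> in M. norm ((Z n \<omega>)\<^sup>2) \<le> C\<^sup>2"
      using bound C0 by (auto simp: power2_le_iff_abs_le)
  qed (use ZM in measurable)
  have SZ: "integrable M (\<lambda>\<omega>. S n \<omega> * Z n \<omega>)"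
    by (rule integrable_mult_of_squares[OF Sn2 Z2 SnM ZM])
  have S1: "integrable M (S n)" by (rule square_integrable_imp_integrable[OF SnM Sn2])
  have SSuc: "S (Suc n) = (\<lambda>\<omega>. S n \<omega> + Z n \<omega> * ?I \<omega>)" by (simp add: S_def)
  have sq_Suc: "(\<lambda>\<omega>. (S (Suc n) \<omega>)\<^sup>2) =
      (\<lambda>\<omega>. (S n \<omega>)\<^sup>2 + 2 * ((S n \<omega> * Z n \<omega>) * ?I \<omega>) + (Z n \<omega>)\<^sup>2 * (?I \<omega>)\<^sup>2)"
    unfolding SSuc by (rule ext) algebra
  note p1 = past_mult_incr[OF st Z Zi g I1]
  have p2: "integrable M (\<lambda>\<omega>. (S n \<omega> * Z n \<omega>) * ?I \<omega>)"
    "(\<integral>\<omega>. (S n \<omega> * Z n \<omega>) * ?I \<omega> \<partial>M) = (\<integral>\<omega>. S n \<omega> * Z n \<omega> \<partial>M) * (\<integral>\<omega>. ?I \<omega> \<partial>M)"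
    by (rule past_mult_incr[OF st _ SZ g I1], use Sn Z in measurable)+
  have I2: "(\<lambda>\<omega>. (?I \<omega>)\<^sup>2) = incr (\<lambda>d. (g d)\<^sup>2) (\<theta> n) (\<theta> (Suc n))" by (simp add: incr_def fun_eq_iff)
  have g2m: "(\<lambda>d. (g d)\<^sup>2) \<in> borel_measurable borel" using g by measurable
  have Z2m: "(\<lambda>\<omega>. (Z n \<omega>)\<^sup>2) \<in> borel_measurable (\<F> (\<theta> n))" using Z by measurable
  have p3: "integrable M (\<lambda>\<omega>. (Z n \<omega>)\<^sup>2 * (?I \<omega>)\<^sup>2)"
    "(\<integral>\<omega>. (Z n \<omega>)\<^sup>2 * (?I \<omega>)\<^sup>2 \<partial>M) = (\<integral>\<omega>. (Z n \<omega>)\<^sup>2 \<partial>M) * (\<integral>\<omega>. (?I \<omega>)\<^sup>2 \<partial>M)"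
    using past_mult_incr[OF st Z2m Z2 g2m] g2[of n] unfolding fun_cong[OF I2] I2 by auto
  show ?case
  proof (intro conjI)
    show "S (Suc n) \<in> borel_measurable (\<F> (\<theta> (Suc n)))"
      unfolding SSuc
      using measurable_\<F>_mono[OF Sn st(2)] measurable_\<F>_mono[OF Z st(2)] incr_measurable_\<F>[OF st g]
      by measurable
    show "integrable M (\<lambda>\<omega>. (S (Suc n) \<omega>)\<^sup>2)"
      unfolding sq_Suc using Sn2 p2 p3 by (intro Bochner_Integration.integrable_add integrable_mult_right)
    show "(\<integral>\<omega>. S (Suc n) \<omega> \<partial>M) = 0"
      unfolding SSuc using S1 p1 Suc g1 by simp
    have "(\<integral>\<omega>. (S (Suc n) \<omega>)\<^sup>2 \<partial>M) = (\<integral>\<omega>. (S n \<omega>)\<^sup>2 \<partial>M) + 2 * ((\<integral>\<omega>. S n \<omega> * Z n \<omega> \<partial>M) * 0)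
      + (\<integral>\<omega>. (Z n \<omega>)\<^sup>2 \<partial>M) * (\<integral>\<omega>. (?I \<omega>)\<^sup>2 \<partial>M)"
      unfolding sq_Suc using Sn2 p2 p3 g1[of n]
      by (subst Bochner_Integration.integral_add Bochner_Integration.integral_mult_right_zero | simp)+
    then show "(\<integral>\<omega>. (S (Suc n) \<omega>)\<^sup>2 \<partial>M) =
      (\<Sum>i<Suc n. (\<integral>\<omega>. (Z i \<omega>)\<^sup>2 \<partial>M) * (\<integral>\<omega>. (incr g (\<theta> i) (\<theta> (Suc i)) \<omega>)\<^sup>2 \<partial>M))"
      using Suc by simp
  qed
qed

end

section \<open>The Ito integral as a limit of Riemann sums\<close>

context planar_brownian
begin

lemma lin_incr_split: "incr (lin c) s u \<omega> = incr (lin c) s t \<omega> + incr (lin c) t u \<omega>"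
  by (simp add: incr_def lin_def algebra_simps)

text \<open>One summand of an elementary integral. Blocks may overlap, so integrals over different
  subdivisions can be subtracted without a common refinement.\<close>

definition block :: "real \<times> real \<Rightarrow> ('w \<Rightarrow> real) \<Rightarrow> real \<Rightarrow> real \<Rightarrow> 'w \<Rightarrow> real" where
  "block c Z a b \<omega> = Z \<omega> * incr (lin c) a b \<omega>"

lemma block_square_integrable:
  assumes c: "norm c = 1" and ab: "0 \<le> a" "a \<le> b"
    and Z: "Z \<in> borel_measurable (\<F> a)" "integrable M (\<lambda>\<omega>. (Z \<omega>)\<^sup>2)"
  shows "block c Z a b \<in> borel_measurable (\<F> b)" "block c Z a b \<in> borel_measurable M"
    "integrable M (\<lambda>\<omega>. (block c Z a b \<omega>)\<^sup>2)"
proof -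
  show "block c Z a b \<in> borel_measurable (\<F> b)"
    unfolding block_def[abs_def]
    using measurable_\<F>_mono[OF Z(1) ab(2)] incr_measurable_\<F>[OF ab lin_measurable] by measurable
  then show "block c Z a b \<in> borel_measurable M" by (rule measurable_\<F>_M)
  have Z2: "(\<lambda>\<omega>. (Z \<omega>)\<^sup>2) \<in> borel_measurable (\<F> a)" using Z(1) by measurable
  have g: "(\<lambda>d. (lin c d)\<^sup>2) \<in> borel_measurable borel" by measurable
  have "integrable M (incr (\<lambda>d. (lin c d)\<^sup>2) a b)"
    using lin_incr_moments(2)[OF ab c] by (simp add: incr_def[abs_def])
  from past_mult_incr(1)[OF ab Z2 Z(2) g this]
  show "integrable M (\<lambda>\<omega>. (block c Z a b \<omega>)\<^sup>2)"
    by (simp add: block_def incr_def power_mult_distrib)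
qed

text \<open>Only the common part of the two intervals survives: elsewhere an increment of mean zero
  meets a factor from its own past.\<close>

lemma block_product_aux:
  assumes c: "norm c = 1" and ab: "0 \<le> a" "a \<le> b" and ab': "a \<le> a'" "a' \<le> b'"
    and Z: "Z \<in> borel_measurable (\<F> a)" "integrable M (\<lambda>\<omega>. (Z \<omega>)\<^sup>2)"
    and Z': "Z' \<in> borel_measurable (\<F> a')" "integrable M (\<lambda>\<omega>. (Z' \<omega>)\<^sup>2)"
  shows "(\<integral>\<omega>. block c Z a b \<omega> * block c Z' a' b' \<omega> \<partial>M) =
    (\<integral>\<omega>. Z \<omega> * Z' \<omega> \<partial>M) * max 0 (min b b' - max a a')"
proof -
  have a'0: "0 \<le> a'" using ab ab' by simp
  have Z'M: "Z' \<in> borel_measurable M" and ZM: "Z \<in> borel_measurable M"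
    using Z Z' by (auto intro: measurable_\<F>_M)
  have ZZ: "integrable M (\<lambda>\<omega>. Z \<omega> * Z' \<omega>)" by (rule integrable_mult_of_squares[OF Z(2) Z'(2) ZM Z'M])
  have ZZm: "(\<lambda>\<omega>. Z \<omega> * Z' \<omega>) \<in> borel_measurable (\<F> a')"
    using measurable_\<F>_mono[OF Z(1) ab'(1)] Z'(1) by measurable
  \<comment> \<open>Used with \<open>e = b\<close> for disjoint intervals, and with
    \<open>e = a'\<close> for the portion of the first interval that precedes the second.\<close>
  have vanish: "integrable M (\<lambda>\<omega>. (block c Z a e \<omega> * Z' \<omega>) * incr (lin c) a' b' \<omega>)"
    "(\<integral>\<omega>. (block c Z a e \<omega> * Z' \<omega>) * incr (lin c) a' b' \<omega> \<partial>M) = 0"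
    if e: "a \<le> e" "e \<le> a'" for e
  proof -
    note B = block_square_integrable[OF c ab(1) e(1) Z]
    have i: "integrable M (\<lambda>\<omega>. block c Z a e \<omega> * Z' \<omega>)"
      by (rule integrable_mult_of_squares[OF B(3) Z'(2) B(2) Z'M])
    have m: "(\<lambda>\<omega>. block c Z a e \<omega> * Z' \<omega>) \<in> borel_measurable (\<F> a')"
      using measurable_\<F>_mono[OF B(1) e(2)] Z'(1) by measurable
    note p = past_mult_incr[OF a'0 ab'(2) m i lin_measurable lin_incr_moments(1)[OF a'0 ab'(2) c]]
    show "integrable M (\<lambda>\<omega>. (block c Z a e \<omega> * Z' \<omega>) * incr (lin c) a' b' \<omega>)" by (rule p(1))
    show "(\<integral>\<omega>. (block c Z a e \<omega> * Z' \<omega>) * incr (lin c) a' b' \<omega> \<partial>M) = 0"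
      using p(2) lin_incr_moments(4)[OF a'0 ab'(2) c] by simp
  qed
  show ?thesis
  proof (cases "b \<le> a'")
    case True
    have "(\<integral>\<omega>. block c Z a b \<omega> * block c Z' a' b' \<omega> \<partial>M) = 0"
      using vanish(2)[OF ab(2) True] by (simp add: block_def[of c Z'] mult_ac)
    moreover have "max 0 (min b b' - max a a') = 0" using True ab' by simp
    ultimately show ?thesis by simp
  next
    case False
    \<comment> \<open>The overlap is \<open>[a', m]\<close>. Beyond \<open>m\<close> only the longer
      of the two intervals continues, up to \<open>M'\<close>, with an increment independent of
      everything before.\<close>
    define m where "m = min b b'"
    define M' where "M' = max b b'"
    have m: "a' \<le> m" "0 \<le> m" "m \<le> M'" using False ab' a'0 by (auto simp: m_def M'_def)
    let ?D = "incr (lin c)"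
    have prod: "block c Z a b \<omega> * block c Z' a' b' \<omega> = (block c Z a a' \<omega> * Z' \<omega>) * ?D a' b' \<omega>
      + (Z \<omega> * Z' \<omega>) * (?D a' m \<omega>)\<^sup>2 + ((Z \<omega> * Z' \<omega>) * ?D a' m \<omega>) * ?D m M' \<omega>" for \<omega>
    proof -
      have "?D a' b \<omega> * ?D a' b' \<omega> = ?D a' m \<omega> * ?D a' M' \<omega>"
        by (auto simp: m_def M'_def min_def max_def)
      also have "\<dots> = (?D a' m \<omega>)\<^sup>2 + ?D a' m \<omega> * ?D m M' \<omega>"
        unfolding lin_incr_split[of c a' M' \<omega> m] by algebra
      finally have *: "?D a' b \<omega> * ?D a' b' \<omega> = (?D a' m \<omega>)\<^sup>2 + ?D a' m \<omega> * ?D m M' \<omega>" .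
      have "block c Z a b \<omega> * block c Z' a' b' \<omega> = (block c Z a a' \<omega> * Z' \<omega>) * ?D a' b' \<omega>
        + (Z \<omega> * Z' \<omega>) * (?D a' b \<omega> * ?D a' b' \<omega>)"
        unfolding block_def lin_incr_split[of c a b \<omega> a'] by algebra
      then show ?thesis unfolding * by algebra
    qed
    have g: "(\<lambda>d. (lin c d)\<^sup>2) \<in> borel_measurable borel" by measurable
    have sq: "(\<lambda>\<omega>. (?D a' m \<omega>)\<^sup>2) = incr (\<lambda>d. (lin c d)\<^sup>2) a' m" by (simp add: incr_def fun_eq_iff)
    have p2: "integrable M (\<lambda>\<omega>. (Z \<omega> * Z' \<omega>) * (?D a' m \<omega>)\<^sup>2)"
      "(\<integral>\<omega>. (Z \<omega> * Z' \<omega>) * (?D a' m \<omega>)\<^sup>2 \<partial>M) = (\<integral>\<omega>. Z \<omega> * Z' \<omega> \<partial>M) * (m - a')"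
      using past_mult_incr[OF a'0 m(1) ZZm ZZ g] lin_incr_moments(2,5)[OF a'0 m(1) c]
      unfolding sq fun_cong[OF sq] by auto
    note p3 = past_mult_incr(1)[OF a'0 m(1) ZZm ZZ lin_measurable lin_incr_moments(1)[OF a'0 m(1) c]]
    have m3: "(\<lambda>\<omega>. (Z \<omega> * Z' \<omega>) * ?D a' m \<omega>) \<in> borel_measurable (\<F> m)"
      using measurable_\<F>_mono[OF ZZm m(1)] incr_measurable_\<F>[OF a'0 m(1) lin_measurable] by measurable
    note p4 = past_mult_incr[OF m(2,3) m3 p3 lin_measurable lin_incr_moments(1)[OF m(2,3) c]]
    have "(\<integral>\<omega>. block c Z a b \<omega> * block c Z' a' b' \<omega> \<partial>M) = 0 + (\<integral>\<omega>. Z \<omega> * Z' \<omega> \<partial>M) * (m - a') + 0"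
      unfolding prod using vanish[OF ab'(1) order_refl] p2 p4 lin_incr_moments(4)[OF m(2,3) c]
      by (subst Bochner_Integration.integral_add | simp)+
    moreover have "max 0 (min b b' - max a a') = m - a'" using m ab' by (simp add: m_def)
    ultimately show ?thesis by simp
  qed
qed

lemma block_product:
  assumes c: "norm c = 1" and ab: "0 \<le> a" "a \<le> b" and ab': "0 \<le> a'" "a' \<le> b'"
    and Z: "Z \<in> borel_measurable (\<F> a)" "integrable M (\<lambda>\<omega>. (Z \<omega>)\<^sup>2)"
    and Z': "Z' \<in> borel_measurable (\<F> a')" "integrable M (\<lambda>\<omega>. (Z' \<omega>)\<^sup>2)"
  shows "(\<integral>\<omega>. block c Z a b \<omega> * block c Z' a' b' \<omega> \<partial>M) =
    (\<integral>\<omega>. Z \<omega> * Z' \<omega> \<partial>M) * max 0 (min b b' - max a a')"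
proof (cases "a \<le> a'")
  case True
  then show ?thesis using block_product_aux[OF c ab True ab'(2) Z Z'] by simp
next
  case False
  then have "a' \<le> a" by simp
  from block_product_aux[OF c ab' this ab(2) Z' Z] show ?thesis
    by (simp add: mult.commute min.commute max.commute)
qed

lemma integral_double_sum:
  fixes f :: "nat \<Rightarrow> nat \<Rightarrow> 'a \<Rightarrow> real"
  assumes "\<And>i j. i < N \<Longrightarrow> j < N \<Longrightarrow> integrable N' (f i j)"
  shows "(\<integral>x. (\<Sum>i<N. \<Sum>j<N. f i j x) \<partial>N') = (\<Sum>i<N. \<Sum>j<N. (\<integral>x. f i j x \<partial>N'))"
proof -
  have "(\<integral>x. (\<Sum>i<N. \<Sum>j<N. f i j x) \<partial>N') = (\<Sum>i<N. (\<integral>x. (\<Sum>j<N. f i j x) \<partial>N'))"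
    using assms by (intro Bochner_Integration.integral_sum Bochner_Integration.integrable_sum) auto
  also have "\<dots> = (\<Sum>i<N. \<Sum>j<N. (\<integral>x. f i j x \<partial>N'))"
    using assms by (intro sum.cong refl Bochner_Integration.integral_sum) auto
  finally show ?thesis .
qed

lemma integral_indicator_overlap:
  fixes a b a' b' :: real
  shows "integrable lborel (\<lambda>s. indicator {a..<b} s * indicator {a'..<b'} s :: real)"
    and "(\<integral>s. indicator {a..<b} s * indicator {a'..<b'} s \<partial>lborel) = max 0 (min b b' - max a a')"
proof -
  have e: "(\<lambda>s. indicator {a..<b} s * indicator {a'..<b'} s :: real) = indicator {max a a'..<min b b'}"
    by (auto simp: indicator_def fun_eq_iff)
  show "integrable lborel (\<lambda>s. indicator {a..<b} s * indicator {a'..<b'} s :: real)"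
    unfolding e by (cases "max a a' \<le> min b b'") auto
  show "(\<integral>s. indicator {a..<b} s * indicator {a'..<b'} s \<partial>lborel) = max 0 (min b b' - max a a')"
    unfolding e by (cases "max a a' \<le> min b b'") (auto simp: max_def)
qed

text \<open>Both sides expand to the same double sum, with mean products of \<open>Z i\<close> and
  \<open>Z j\<close> as coefficients and lengths of overlaps as weights.\<close>

lemma block_isometry:
  fixes N :: nat and a b :: "nat \<Rightarrow> real"
  assumes c: "norm c = 1" and ab: "\<And>i. i < N \<Longrightarrow> 0 \<le> a i" "\<And>i. i < N \<Longrightarrow> a i \<le> b i" "\<And>i. i < N \<Longrightarrow> b i \<le> T"
    and Z: "\<And>i. i < N \<Longrightarrow> Z i \<in> borel_measurable (\<F> (a i))" "\<And>i. i < N \<Longrightarrow> integrable M (\<lambda>\<omega>. (Z i \<omega>)\<^sup>2)"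
  shows "(\<integral>\<^sup>+\<omega>. ennreal ((\<Sum>i<N. block c (Z i) (a i) (b i) \<omega>)\<^sup>2) \<partial>M) =
    (\<integral>\<^sup>+\<omega>. (\<integral>\<^sup>+s\<in>{0..T}. ennreal ((\<Sum>i<N. Z i \<omega> * indicator {a i..<b i} s)\<^sup>2) \<partial>lborel) \<partial>M)"
proof -
  define ov where "ov i j = max 0 (min (b i) (b j) - max (a i) (a j))" for i j
  note B = block_square_integrable[OF c ab(1,2) Z]
  have ZM: "Z i \<in> borel_measurable M" if "i < N" for i using Z(1)[OF that] by (rule measurable_\<F>_M)
  have sq: "(\<Sum>i<N. f i)\<^sup>2 = (\<Sum>i<N. \<Sum>j<N. f i * f j)" for f :: "nat \<Rightarrow> real"
    by (simp add: power2_eq_square sum_product)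
  have inner: "(\<integral>\<^sup>+s\<in>{0..T}. ennreal ((\<Sum>i<N. Z i \<omega> * indicator {a i..<b i} s)\<^sup>2) \<partial>lborel)
    = ennreal (\<Sum>i<N. \<Sum>j<N. Z i \<omega> * Z j \<omega> * ov i j)"
    and pos: "0 \<le> (\<Sum>i<N. \<Sum>j<N. Z i \<omega> * Z j \<omega> * ov i j)" for \<omega>
  proof -
    define q where "q s = (\<Sum>i<N. Z i \<omega> * indicator {a i..<b i} s)" for s :: real
    have q0: "q s = 0" if "s \<notin> {0..T}" for s
      unfolding q_def
    proof (rule sum.neutral, rule ballI)
      fix i assume "i \<in> {..<N}"
      then have "s \<notin> {a i..<b i}" using that ab(1,3)[of i] by auto
      then show "Z i \<omega> * indicator {a i..<b i} s = 0" by simp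
    qed
    have q2: "(q s)\<^sup>2 = (\<Sum>i<N. \<Sum>j<N. (Z i \<omega> * Z j \<omega>) * (indicator {a i..<b i} s * indicator {a j..<b j} s))" for s
      unfolding q_def sq by (intro sum.cong refl) (simp add: mult_ac)
    have int: "integrable lborel (\<lambda>s. (q s)\<^sup>2)"
      unfolding q2 by (intro Bochner_Integration.integrable_sum integrable_mult_right integral_indicator_overlap)
    have val: "(\<integral>s. (q s)\<^sup>2 \<partial>lborel) = (\<Sum>i<N. \<Sum>j<N. Z i \<omega> * Z j \<omega> * ov i j)"
      unfolding q2 ov_def
      by (simp add: Bochner_Integration.integral_sum integrable_mult_right integral_indicator_overlap
          Bochner_Integration.integrable_sum)
    have "(\<integral>\<^sup>+s\<in>{0..T}. ennreal ((q s)\<^sup>2) \<partial>lborel) = (\<integral>\<^sup>+s. ennreal ((q s)\<^sup>2) \<partial>lborel)"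
      by (intro nn_integral_cong) (auto simp: indicator_def q0)
    also have "\<dots> = ennreal (\<integral>s. (q s)\<^sup>2 \<partial>lborel)"
      by (rule nn_integral_eq_integral[OF int]) simp
    also note val
    finally show "(\<integral>\<^sup>+s\<in>{0..T}. ennreal ((\<Sum>i<N. Z i \<omega> * indicator {a i..<b i} s)\<^sup>2) \<partial>lborel)
      = ennreal (\<Sum>i<N. \<Sum>j<N. Z i \<omega> * Z j \<omega> * ov i j)" unfolding q_def .
    \<comment> \<open>The sign, invisible in the double sum, comes from its being the integral of a
      square; it allows the passage to extended nonnegative reals.\<close>
    show "0 \<le> (\<Sum>i<N. \<Sum>j<N. Z i \<omega> * Z j \<omega> * ov i j)"
      unfolding val[symmetric] by (rule Bochner_Integration.integral_nonneg) simp
  qed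
  have iZ: "integrable M (\<lambda>\<omega>. Z i \<omega> * Z j \<omega>)" if "i < N" "j < N" for i j
    by (rule integrable_mult_of_squares[OF Z(2)[OF that(1)] Z(2)[OF that(2)] ZM[OF that(1)] ZM[OF that(2)]])
  have iB: "integrable M (\<lambda>\<omega>. block c (Z i) (a i) (b i) \<omega> * block c (Z j) (a j) (b j) \<omega>)" if "i < N" "j < N" for i j
    using that by (intro integrable_mult_of_squares B)
  have "(\<integral>\<^sup>+\<omega>. ennreal ((\<Sum>i<N. block c (Z i) (a i) (b i) \<omega>)\<^sup>2) \<partial>M)
    = ennreal (\<integral>\<omega>. (\<Sum>i<N. block c (Z i) (a i) (b i) \<omega>)\<^sup>2 \<partial>M)"
  proof (rule nn_integral_eq_integral)
    show "integrable M (\<lambda>\<omega>. (\<Sum>i<N. block c (Z i) (a i) (b i) \<omega>)\<^sup>2)"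
      unfolding sq using iB by (intro Bochner_Integration.integrable_sum) auto
  qed simp
  also have "(\<integral>\<omega>. (\<Sum>i<N. block c (Z i) (a i) (b i) \<omega>)\<^sup>2 \<partial>M)
    = (\<Sum>i<N. \<Sum>j<N. (\<integral>\<omega>. block c (Z i) (a i) (b i) \<omega> * block c (Z j) (a j) (b j) \<omega> \<partial>M))"
    unfolding sq by (rule integral_double_sum[OF iB])
  also have "\<dots> = (\<Sum>i<N. \<Sum>j<N. (\<integral>\<omega>. Z i \<omega> * Z j \<omega> \<partial>M) * ov i j)"
    unfolding ov_def using ab Z by (intro sum.cong refl block_product[OF c]) auto
  also have "\<dots> = (\<integral>\<omega>. (\<Sum>i<N. \<Sum>j<N. Z i \<omega> * Z j \<omega> * ov i j) \<partial>M)"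
    using iZ by (subst integral_double_sum) auto
  also have "ennreal \<dots> = (\<integral>\<^sup>+\<omega>. ennreal (\<Sum>i<N. \<Sum>j<N. Z i \<omega> * Z j \<omega> * ov i j) \<partial>M)"
  proof (rule nn_integral_eq_integral[symmetric])
    show "integrable M (\<lambda>\<omega>. \<Sum>i<N. \<Sum>j<N. Z i \<omega> * Z j \<omega> * ov i j)"
      using iZ by (intro Bochner_Integration.integrable_sum integrable_mult_left) auto
  qed (use pos in auto)
  finally show ?thesis unfolding inner .
qed

end

section \<open>Comparison of the Ito integral with Riemann sums\<close>

text \<open>Exchanging the integrals over time and over the sample space requires joint
  measurability, while \<open>f\<close> is only known to be measurable at each time. Step processes
  on ever finer grids are jointly measurable, and their limit recovers every continuous
  path.\<close>

lemma jointly_measurable_version: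
  fixes f :: "real \<Rightarrow> 'w \<Rightarrow> real"
  assumes f: "\<And>t. 0 \<le> t \<Longrightarrow> f t \<in> borel_measurable M"
    and cont: "AE \<omega> in M. continuous_on {0..} (\<lambda>t. f t \<omega>)"
  obtains g where "(\<lambda>(\<omega>, s). g s \<omega>) \<in> borel_measurable (M \<Otimes>\<^sub>M lborel)"
    and "AE \<omega> in M. \<forall>s\<ge>0. g s \<omega> = f s \<omega>"
proof -
  \<comment> \<open>Left end of the cell, with the floor as \<open>i\<close>. The maximum with 0
    keeps the time in the range where \<open>f\<close> is measurable, for negative arguments
    too.\<close>
  define h where "h m i = max 0 (real_of_int i / real (Suc m))" for m i
  define fm where "fm m s \<omega> = f (h m \<lfloor>real (Suc m) * s\<rfloor>) \<omega>" for m s \<omega>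
  define g where "g s \<omega> = lim (\<lambda>m. fm m s \<omega>)" for s \<omega>
  have "(\<lambda>x. fm m (snd x) (fst x)) \<in> borel_measurable (M \<Otimes>\<^sub>M lborel)" for m
    unfolding fm_def
  proof (rule measurable_compose_countable[where g = "\<lambda>x. \<lfloor>real (Suc m) * snd x\<rfloor>" and f = "\<lambda>i x. f (h m i) (fst x)"])
    show "(\<lambda>x. f (h m i) (fst x)) \<in> borel_measurable (M \<Otimes>\<^sub>M lborel)" for i
      using measurable_compose[OF measurable_fst f, of "h m i"] by (simp add: h_def)
    show "(\<lambda>x. \<lfloor>real (Suc m) * snd x\<rfloor>) \<in> measurable (M \<Otimes>\<^sub>M lborel) (count_space UNIV)"
      by measurable
  qed
  then have "(\<lambda>x. g (snd x) (fst x)) \<in> borel_measurable (M \<Otimes>\<^sub>M lborel)"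
    unfolding g_def by (rule borel_measurable_lim_metric)
  then have meas: "(\<lambda>(\<omega>, s). g s \<omega>) \<in> borel_measurable (M \<Otimes>\<^sub>M lborel)" by (simp add: case_prod_unfold)
  have "AE \<omega> in M. \<forall>s\<ge>0. g s \<omega> = f s \<omega>"
    using cont
  proof eventually_elim
    case (elim \<omega>)
    show ?case
    proof (intro allI impI)
      fix s :: real assume s: "0 \<le> s"
      have h: "h m \<lfloor>real (Suc m) * s\<rfloor> = real_of_int \<lfloor>real (Suc m) * s\<rfloor> / real (Suc m)" for m
        using s by (auto simp: h_def max_def not_le[symmetric])
      have "(\<lambda>m. h m \<lfloor>real (Suc m) * s\<rfloor>) \<longlonglongrightarrow> s"
      proof (rule tendsto_sandwich[of "\<lambda>m. s - 1 / real (Suc m)" _ _ "\<lambda>_. s"])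
        show "\<forall>\<^sub>F m in sequentially. s - 1 / real (Suc m) \<le> h m \<lfloor>real (Suc m) * s\<rfloor>"
        proof (intro always_eventually allI)
          fix m
          have "s - 1 / real (Suc m) = (real (Suc m) * s - 1) / real (Suc m)"
            by (simp add: field_simps del: of_nat_Suc)
          also have "\<dots> \<le> real_of_int \<lfloor>real (Suc m) * s\<rfloor> / real (Suc m)"
            by (intro divide_right_mono) linarith+
          finally show "s - 1 / real (Suc m) \<le> h m \<lfloor>real (Suc m) * s\<rfloor>" unfolding h .
        qed
        show "\<forall>\<^sub>F m in sequentially. h m \<lfloor>real (Suc m) * s\<rfloor> \<le> s"
          unfolding h by (intro always_eventually allI) (simp add: field_simps)
        have "(\<lambda>m. 1 / real (Suc m)) \<longlonglongrightarrow> 0" using LIMSEQ_inverse_real_of_nat by (simp add: inverse_eq_divide)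
        from tendsto_diff[OF tendsto_const this, of s] show "(\<lambda>m. s - 1 / real (Suc m)) \<longlonglongrightarrow> s" by simp
      qed simp
      moreover have "\<forall>\<^sub>F m in sequentially. h m \<lfloor>real (Suc m) * s\<rfloor> \<in> {0..}" by (simp add: h_def)
      ultimately have "(\<lambda>m. fm m s \<omega>) \<longlonglongrightarrow> f s \<omega>"
        unfolding fm_def using continuous_on_tendsto_compose[OF elim] s by auto
      then show "g s \<omega> = f s \<omega>" unfolding g_def by (rule limI)
    qed
  qed
  then show ?thesis by (rule that[OF meas])
qed

lemma sum_lessThan_add: "(\<Sum>i<m + n. h i) = (\<Sum>i<m. h i) + (\<Sum>i<n. h (m + i :: nat) :: real)"
  by (induction n) (simp_all add: add.assoc)

lemma ennreal_square_diff_le: "ennreal ((x - y)\<^sup>2) \<le> 2 * ennreal ((x - z)\<^sup>2) + 2 * ennreal ((z - y)\<^sup>2)"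
proof -
  have "(x - y)\<^sup>2 \<le> 2 * (x - z)\<^sup>2 + 2 * (z - y)\<^sup>2"
    using zero_le_power2[of "(x - z) - (z - y)"] by (simp add: power2_eq_square algebra_simps)
  then have "ennreal ((x - y)\<^sup>2) \<le> ennreal (2 * (x - z)\<^sup>2 + 2 * (z - y)\<^sup>2)" by (rule ennreal_leI)
  also have "\<dots> = 2 * ennreal ((x - z)\<^sup>2) + 2 * ennreal ((z - y)\<^sup>2)"
    by (simp add: ennreal_plus ennreal_mult)
  finally show ?thesis .
qed

lemma nn_integral_square_diff_le:
  assumes [measurable]: "f \<in> borel_measurable N" "g \<in> borel_measurable N" "h \<in> borel_measurable N"
  shows "(\<integral>\<^sup>+x. ennreal ((f x - g x)\<^sup>2) \<partial>N)
    \<le> 2 * (\<integral>\<^sup>+x. ennreal ((f x - h x)\<^sup>2) \<partial>N) + 2 * (\<integral>\<^sup>+x. ennreal ((h x - g x)\<^sup>2) \<partial>N)"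
proof -
  have "(\<integral>\<^sup>+x. ennreal ((f x - g x)\<^sup>2) \<partial>N) \<le> (\<integral>\<^sup>+x. 2 * ennreal ((f x - h x)\<^sup>2) + 2 * ennreal ((h x - g x)\<^sup>2) \<partial>N)"
    by (intro nn_integral_mono ennreal_square_diff_le)
  also have "\<dots> = 2 * (\<integral>\<^sup>+x. ennreal ((f x - h x)\<^sup>2) \<partial>N) + 2 * (\<integral>\<^sup>+x. ennreal ((h x - g x)\<^sup>2) \<partial>N)"
    by (subst nn_integral_add) (auto simp: nn_integral_cmult)
  finally show ?thesis .
qed

context planar_brownian
begin

lemma coordinate_process:
  assumes "W = B1 \<or> W = B2"
  shows "\<exists>c. norm c = 1 \<and> (\<forall>s t \<omega>. W t \<omega> - W s \<omega> = incr (lin c) s t \<omega>)"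
    and "standard_BM M W" and "0 \<le> s \<Longrightarrow> s \<le> t \<Longrightarrow> W s \<in> borel_measurable (\<F> t)"
proof -
  have 1: "norm (1 :: real, 0 :: real) = 1" "norm (0 :: real, 1 :: real) = 1" by (simp_all add: norm_Pair)
  have 2: "B1 t \<omega> - B1 s \<omega> = incr (lin (1, 0)) s t \<omega>" "B2 t \<omega> - B2 s \<omega> = incr (lin (0, 1)) s t \<omega>" for s t \<omega>
    by (simp_all add: incr_def lin_def)
  show "\<exists>c. norm c = 1 \<and> (\<forall>s t \<omega>. W t \<omega> - W s \<omega> = incr (lin c) s t \<omega>)"
    using assms
  proof
    assume "W = B1"
    then show ?thesis using 1 2 by (intro exI[of _ "(1, 0)"]) simp
  next
    assume "W = B2"
    then show ?thesis using 1 2 by (intro exI[of _ "(0, 1)"]) simp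
  qed
  show "standard_BM M W" using assms BM1 BM2 by auto
  show "0 \<le> s \<Longrightarrow> s \<le> t \<Longrightarrow> W s \<in> borel_measurable (\<F> t)"
    using assms B1_measurable_\<F> B2_measurable_\<F> by auto
qed

text \<open>An elementary integral \<open>J\<close> close to \<open>I\<close> serves as
  intermediary: the isometry turns the distance from \<open>J\<close> to the Riemann sum into a
  distance of integrands. Two uses of \<open>(x - y)\<^sup>2 \<le> 2 * (x - z)\<^sup>2 + 2 * (z -
  y)\<^sup>2\<close> cost the factor 4, and the integrand error of the Riemann sum is
  \<open>T\<^sup>2 / n\<close>.\<close>

lemma ito_integral_riemann:
  assumes f: "f = B1 \<or> f = B2" and W: "W = B1 \<or> W = B2" and T: "0 \<le> T" and n: "0 < (n::nat)"
    and ito: "ito_integral M \<F> W f T I"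
  defines "\<tau> \<equiv> \<lambda>i. real i * T / real n"
  shows "(\<integral>\<^sup>+\<omega>. ennreal ((I \<omega> - (\<Sum>i<n. f (\<tau> i) \<omega> * (W (\<tau> (Suc i)) \<omega> - W (\<tau> i) \<omega>)))\<^sup>2) \<partial>M)
    \<le> ennreal (4 * T\<^sup>2 / real n)"
proof -
  obtain c where c: "norm c = 1" and "\<forall>s t \<omega>. W t \<omega> - W s \<omega> = incr (lin c) s t \<omega>"
    using coordinate_process(1)[OF W] by (elim exE conjE)
  then have Wc: "W t \<omega> - W s \<omega> = incr (lin c) s t \<omega>" for s t \<omega> by simp
  note fBM = coordinate_process(2)[OF f] and fF = coordinate_process(3)[OF f]
  have fM: "f s \<in> borel_measurable M" if "0 \<le> s" for s using fBM that by (simp add: standard_BM_def)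
  have f0: "AE \<omega> in M. f 0 \<omega> = 0" and fcont: "AE \<omega> in M. continuous_on {0..} (\<lambda>t. f t \<omega>)"
    using fBM by (simp_all add: standard_BM_def)
  have f2: "integrable M (\<lambda>\<omega>. (f s \<omega>)\<^sup>2)" if s: "0 \<le> s" for s
  proof -
    have i: "integrable M (\<lambda>\<omega>. (f s \<omega> - f 0 \<omega>)\<^sup>2)"
      using standard_BM_increment_moments(1)[OF fBM order_refl s] .
    have "integrable M (\<lambda>\<omega>. (f s \<omega> - f 0 \<omega>)\<^sup>2) \<longleftrightarrow> integrable M (\<lambda>\<omega>. (f s \<omega>)\<^sup>2)"
      using f0 fM[OF s] fM[of 0] by (intro integrable_cong_AE) (auto elim: eventually_mono)
    then show ?thesis using i by simp
  qed
  have \<tau>0: "0 \<le> \<tau> i" for i using T by (simp add: \<tau>_def)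
  have \<tau>mono: "\<tau> i \<le> \<tau> (Suc i)" for i using T by (simp add: \<tau>_def divide_right_mono mult_right_mono)
  have \<tau>T: "\<tau> i \<le> T" if "i \<le> n" for i
  proof -
    have "real i * T \<le> real n * T" using that T by (intro mult_right_mono) auto
    then show ?thesis using n by (simp add: \<tau>_def field_simps)
  qed
  define R where "R \<omega> = (\<Sum>i<n. f (\<tau> i) \<omega> * (W (\<tau> (Suc i)) \<omega> - W (\<tau> i) \<omega>))" for \<omega>
  define r where "r s \<omega> = (\<Sum>i<n. f (\<tau> i) \<omega> * indicator {\<tau> i..<\<tau> (Suc i)} s)" for s \<omega>
  obtain g where gm: "(\<lambda>(\<omega>, s). g s \<omega>) \<in> borel_measurable (M \<Otimes>\<^sub>M lborel)"
    and gf: "AE \<omega> in M. \<forall>s\<ge>0. g s \<omega> = f s \<omega>"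
    using jointly_measurable_version[OF fM fcont] .
  have gm' [measurable]: "(\<lambda>x. g (snd x) (fst x)) \<in> borel_measurable (M \<Otimes>\<^sub>M lborel)"
    using gm by (simp add: case_prod_unfold)
  have RM: "R \<in> borel_measurable M"
    unfolding R_def[abs_def] Wc
    by (intro borel_measurable_sum borel_measurable_times fM incr_measurable \<tau>0 \<tau>mono lin_measurable)
  have rm [measurable]: "(\<lambda>x. r (snd x) (fst x)) \<in> borel_measurable (M \<Otimes>\<^sub>M lborel)"
    unfolding r_def
    by (intro borel_measurable_sum borel_measurable_times measurable_compose[OF measurable_fst fM] \<tau>0) measurable
  have grm: "(\<lambda>x. ennreal ((g (snd x) (fst x) - r (snd x) (fst x))\<^sup>2) * indicator {0..T} (snd x))
    \<in> borel_measurable (M \<Otimes>\<^sub>M lborel)" by measurable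
  interpret P: pair_sigma_finite M lborel ..
  \<comment> \<open>Within a cell the mean squared error at time \<open>s\<close> is the time
    elapsed since its left end, at most \<open>T / n\<close>; integration over \<open>[0, T]\<close>
    gives another factor \<open>T\<close>.\<close>
  have gr: "(\<integral>\<^sup>+\<omega>. (\<integral>\<^sup>+s\<in>{0..T}. ennreal ((g s \<omega> - r s \<omega>)\<^sup>2) \<partial>lborel) \<partial>M) \<le> ennreal (T\<^sup>2 / real n)"
  proof -
    have "(\<integral>\<^sup>+\<omega>. (\<integral>\<^sup>+s. ennreal ((g s \<omega> - r s \<omega>)\<^sup>2) * indicator {0..T} s \<partial>lborel) \<partial>M)
      = (\<integral>\<^sup>+s. (\<integral>\<^sup>+\<omega>. ennreal ((g s \<omega> - r s \<omega>)\<^sup>2) * indicator {0..T} s \<partial>M) \<partial>lborel)"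
      by (rule P.Fubini'[symmetric]) (simp only: case_prod_unfold, rule grm)
    also have "\<dots> \<le> (\<integral>\<^sup>+s. ennreal (T / real n) * indicator {0..T} s \<partial>lborel)"
    proof (rule nn_integral_mono_AE)
      \<comment> \<open>The half-open cells do not cover the endpoint \<open>T\<close>, where the
        step process is 0.\<close>
      have "AE s in lborel. s \<noteq> T" by (rule AE_lborel_singleton)
      then show "AE s in lborel. (\<integral>\<^sup>+\<omega>. ennreal ((g s \<omega> - r s \<omega>)\<^sup>2) * indicator {0..T} s \<partial>M)
        \<le> ennreal (T / real n) * indicator {0..T} s"
      proof eventually_elim
        case (elim s)
        show ?case
        proof (cases "s \<in> {0..T}")
          case True
          then have s: "0 \<le> s" "s < T" using elim by auto
          then have T0: "T > 0" by simp
          define i where "i = nat \<lfloor>s * real n / T\<rfloor>"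
          have fl: "0 \<le> s * real n / T" using s T0 by simp
          have i1: "real i \<le> s * real n / T" "s * real n / T < real i + 1"
            unfolding i_def using fl by linarith+
          have s1: "\<tau> i \<le> s" "s < \<tau> (Suc i)"
            using i1 n T0 by (simp_all add: \<tau>_def field_simps)
          have "real i < real n"
          proof (rule ccontr)
            assume "\<not> real i < real n"
            then have "real n * T \<le> real i * T" using T0 by simp
            moreover have "real i * T \<le> s * real n" using s1(1) n by (simp add: \<tau>_def field_simps)
            moreover have "s * real n < T * real n" using s n by simp
            ultimately show False by (simp add: mult.commute)
          qed
          then have i: "i < n" by simp
          have uniq: "j = i" if "s \<in> {\<tau> j..<\<tau> (Suc j)}" for j
          proof -
            have j1: "real j \<le> s * real n / T" "s * real n / T < real j + 1"
              using that n T0 by (simp_all add: \<tau>_def field_simps)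
            then show ?thesis using i1 by linarith
          qed
          have rs: "r s \<omega> = f (\<tau> i) \<omega>" for \<omega>
          proof -
            have "r s \<omega> = (\<Sum>j<n. if j = i then f (\<tau> i) \<omega> else 0)"
              unfolding r_def
            proof (rule sum.cong[OF refl])
              fix j
              show "f (\<tau> j) \<omega> * indicator {\<tau> j..<\<tau> (Suc j)} s = (if j = i then f (\<tau> i) \<omega> else 0)"
              proof (cases "j = i")
                case False
                then have "s \<notin> {\<tau> j..<\<tau> (Suc j)}" using uniq[of j] by blast
                then show ?thesis using False by simp
              qed (use s1 in simp)
            qed
            then show ?thesis using i by simp
          qed
          have "(\<integral>\<^sup>+\<omega>. ennreal ((g s \<omega> - r s \<omega>)\<^sup>2) * indicator {0..T} s \<partial>M)
            = (\<integral>\<^sup>+\<omega>. ennreal ((f s \<omega> - f (\<tau> i) \<omega>)\<^sup>2) \<partial>M)"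
            using gf True s by (intro nn_integral_cong_AE) (auto simp: rs elim: eventually_mono)
          also have "\<dots> = ennreal (\<integral>\<omega>. (f s \<omega> - f (\<tau> i) \<omega>)\<^sup>2 \<partial>M)"
            using standard_BM_increment_moments(1)[OF fBM \<tau>0 s1(1), of 2]
            by (intro nn_integral_eq_integral) auto
          also have "\<dots> = ennreal (s - \<tau> i)"
            using standard_BM_increment_moments(3)[OF fBM \<tau>0 s1(1)] by simp
          also have "\<dots> \<le> ennreal (T / real n)"
          proof (rule ennreal_leI)
            have "\<tau> (Suc i) = \<tau> i + T / real n" by (simp add: \<tau>_def add_divide_distrib distrib_right)
            then show "s - \<tau> i \<le> T / real n" using s1 by linarith
          qed
          finally show ?thesis using True by simp
        qed simp
      qed
    qed
    also have "\<dots> = ennreal (T / real n) * ennreal T" using T by (simp add: nn_integral_cmult_indicator)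
    also have "\<dots> = ennreal (T\<^sup>2 / real n)"
      using T by (simp add: ennreal_mult[symmetric] power2_eq_square)
    finally show ?thesis .
  qed
  obtain n' \<theta>' e' where el: "\<forall>k. elementary M \<F> T (n' k) (\<theta>' k) (e' k)"
    and l1: "(\<lambda>k. \<integral>\<^sup>+ \<omega>. (\<integral>\<^sup>+ s \<in> {0..T}.
          ennreal ((f s \<omega> - elem_process (n' k) (\<theta>' k) (e' k) s \<omega>)\<^sup>2) \<partial>lborel) \<partial>M) \<longlonglongrightarrow> 0"
    and l2: "(\<lambda>k. \<integral>\<^sup>+ \<omega>. ennreal ((I \<omega> - elem_integral W (n' k) (\<theta>' k) (e' k) \<omega>)\<^sup>2) \<partial>M) \<longlonglongrightarrow> 0"
    and IM: "I \<in> borel_measurable M"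
    using ito unfolding ito_integral_def by (elim conjE exE)
  have bound: "(\<integral>\<^sup>+\<omega>. ennreal ((I \<omega> - R \<omega>)\<^sup>2) \<partial>M)
    \<le> 2 * (\<integral>\<^sup>+ \<omega>. ennreal ((I \<omega> - elem_integral W (n' k) (\<theta>' k) (e' k) \<omega>)\<^sup>2) \<partial>M)
      + (4 * (\<integral>\<^sup>+ \<omega>. (\<integral>\<^sup>+ s \<in> {0..T}. ennreal ((f s \<omega> - elem_process (n' k) (\<theta>' k) (e' k) s \<omega>)\<^sup>2) \<partial>lborel) \<partial>M)
        + 4 * ennreal (T\<^sup>2 / real n))" for k
  proof -
    define m where "m = n' k"
    define th where "th = \<theta>' k"
    define e where "e = e' k"
    have E: "elementary M \<F> T m th e" using el by (simp add: m_def th_def e_def)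
    have th_mono: "th i \<le> th (Suc i)" if "i < m" for i using E that by (simp add: elementary_def)
    have th_le: "th i \<le> th j" if "i \<le> j" "j \<le> m" for i j
      using that
    proof (induction j rule: dec_induct)
      case (step j)
      then show ?case using th_mono[of j] by simp
    qed simp
    have th0: "0 \<le> th i" if "i \<le> m" for i using th_le[of 0 i] that E by (simp add: elementary_def)
    have thT: "th i \<le> T" if "i \<le> m" for i using th_le[of i m] that E by (simp add: elementary_def)
    have eF: "e i \<in> borel_measurable (\<F> (th i))" "integrable M (\<lambda>\<omega>. (e i \<omega>)\<^sup>2)" if "i < m" for i
      using E that by (simp_all add: elementary_def)
    have eM: "e i \<in> borel_measurable M" if "i < m" for i using eF(1)[OF that] by (rule measurable_\<F>_M)
    define J where "J \<omega> = elem_integral W m th e \<omega>" for \<omega>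
    define p where "p s \<omega> = elem_process m th e s \<omega>" for s \<omega>
    have JM: "J \<in> borel_measurable M"
      unfolding J_def[abs_def] elem_integral_def Wc using th0 th_mono eM
      by (intro borel_measurable_sum borel_measurable_times incr_measurable lin_measurable) auto
    have pm [measurable]: "(\<lambda>x. p (snd x) (fst x)) \<in> borel_measurable (M \<Otimes>\<^sub>M lborel)"
      unfolding p_def elem_process_def
    proof (intro borel_measurable_sum borel_measurable_times)
      fix i assume "i \<in> {..<m}"
      then show "(\<lambda>x. e i (fst x)) \<in> borel_measurable (M \<Otimes>\<^sub>M lborel)"
        using measurable_compose[OF measurable_fst eM] by simp
    qed measurable
    \<comment> \<open>One list of blocks for the difference \<open>J - R\<close>: first the
      \<open>m\<close> elementary blocks, then the \<open>n\<close> Riemann blocks with the opposite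
      sign.\<close>
    define Z where "Z i = (if i < m then e i else (\<lambda>\<omega>. - f (\<tau> (i - m)) \<omega>))" for i
    define a where "a i = (if i < m then th i else \<tau> (i - m))" for i
    define b where "b i = (if i < m then th (Suc i) else \<tau> (Suc (i - m)))" for i
    have iso: "(\<integral>\<^sup>+\<omega>. ennreal ((\<Sum>i<m + n. block c (Z i) (a i) (b i) \<omega>)\<^sup>2) \<partial>M) =
      (\<integral>\<^sup>+\<omega>. (\<integral>\<^sup>+s\<in>{0..T}. ennreal ((\<Sum>i<m + n. Z i \<omega> * indicator {a i..<b i} s)\<^sup>2) \<partial>lborel) \<partial>M)"
    proof (rule block_isometry[OF c])
      fix i assume i: "i < m + n"
      show "0 \<le> a i" using th0 \<tau>0 by (simp add: a_def)
      show "a i \<le> b i" using th_mono \<tau>mono by (simp add: a_def b_def)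
      show "b i \<le> T" using thT[of "Suc i"] \<tau>T[of "Suc (i - m)"] i by (simp add: b_def)
      show "Z i \<in> borel_measurable (\<F> (a i))"
      proof (cases "i < m")
        case False
        have "f (\<tau> (i - m)) \<in> borel_measurable (\<F> (\<tau> (i - m)))" by (rule fF[OF \<tau>0 order_refl])
        then show ?thesis using False by (simp add: Z_def a_def)
      qed (use eF in \<open>simp add: Z_def a_def\<close>)
      show "integrable M (\<lambda>\<omega>. (Z i \<omega>)\<^sup>2)"
        using eF f2[OF \<tau>0] by (simp add: Z_def)
    qed
    have s1: "(\<Sum>i<m + n. block c (Z i) (a i) (b i) \<omega>) = J \<omega> - R \<omega>" for \<omega>
      unfolding sum_lessThan_add J_def R_def elem_integral_def Wc
      by (simp add: Z_def a_def b_def block_def sum_negf)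
    have s2: "(\<Sum>i<m + n. Z i \<omega> * indicator {a i..<b i} s) = p s \<omega> - r s \<omega>" for s \<omega>
      unfolding sum_lessThan_add p_def r_def elem_process_def
      by (simp add: Z_def a_def b_def sum_negf)
    have inner: "(\<integral>\<^sup>+s\<in>{0..T}. ennreal ((p s \<omega> - r s \<omega>)\<^sup>2) \<partial>lborel)
      \<le> 2 * (\<integral>\<^sup>+s\<in>{0..T}. ennreal ((g s \<omega> - p s \<omega>)\<^sup>2) \<partial>lborel)
        + 2 * (\<integral>\<^sup>+s\<in>{0..T}. ennreal ((g s \<omega> - r s \<omega>)\<^sup>2) \<partial>lborel)" if \<omega>: "\<omega> \<in> space M" for \<omega>
    proof -
      have gs [measurable]: "(\<lambda>s. g s \<omega>) \<in> borel_measurable lborel"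
        using measurable_compose[OF measurable_Pair1'[OF \<omega>] gm'] by simp
      have ps [measurable]: "(\<lambda>s. p s \<omega>) \<in> borel_measurable lborel"
        using measurable_compose[OF measurable_Pair1'[OF \<omega>] pm] by simp
      have rs [measurable]: "(\<lambda>s. r s \<omega>) \<in> borel_measurable lborel"
        using measurable_compose[OF measurable_Pair1'[OF \<omega>] rm] by simp
      have sw: "(p s \<omega> - g s \<omega>)\<^sup>2 = (g s \<omega> - p s \<omega>)\<^sup>2" for s by (rule power2_commute)
      have key: "ennreal ((p s \<omega> - r s \<omega>)\<^sup>2) \<le> 2 * ennreal ((g s \<omega> - p s \<omega>)\<^sup>2) + 2 * ennreal ((g s \<omega> - r s \<omega>)\<^sup>2)" for s
        using ennreal_square_diff_le[of "p s \<omega>" "r s \<omega>" "g s \<omega>"] by (simp only: sw)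
      have "(\<integral>\<^sup>+s\<in>{0..T}. ennreal ((p s \<omega> - r s \<omega>)\<^sup>2) \<partial>lborel)
        \<le> (\<integral>\<^sup>+s. 2 * (ennreal ((g s \<omega> - p s \<omega>)\<^sup>2) * indicator {0..T} s) + 2 * (ennreal ((g s \<omega> - r s \<omega>)\<^sup>2) * indicator {0..T} s) \<partial>lborel)"
        by (intro nn_integral_mono) (use key in \<open>auto simp: indicator_def\<close>)
      also have "\<dots> = 2 * (\<integral>\<^sup>+s\<in>{0..T}. ennreal ((g s \<omega> - p s \<omega>)\<^sup>2) \<partial>lborel)
        + 2 * (\<integral>\<^sup>+s\<in>{0..T}. ennreal ((g s \<omega> - r s \<omega>)\<^sup>2) \<partial>lborel)"
        by (subst nn_integral_add) (auto simp: nn_integral_cmult)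
      finally show ?thesis .
    qed
    have m1: "(\<lambda>\<omega>. \<integral>\<^sup>+s\<in>{0..T}. ennreal ((g s \<omega> - p s \<omega>)\<^sup>2) \<partial>lborel) \<in> borel_measurable M"
    proof -
      have "(\<lambda>x. ennreal ((g (snd x) (fst x) - p (snd x) (fst x))\<^sup>2) * indicator {0..T} (snd x)) \<in> borel_measurable (M \<Otimes>\<^sub>M lborel)"
        by measurable
      from lborel.borel_measurable_nn_integral_fst[OF this] show ?thesis by simp
    qed
    have m2: "(\<lambda>\<omega>. \<integral>\<^sup>+s\<in>{0..T}. ennreal ((g s \<omega> - r s \<omega>)\<^sup>2) \<partial>lborel) \<in> borel_measurable M"
      using lborel.borel_measurable_nn_integral_fst[OF grm] by simp
    \<comment> \<open>Back from the measurable version to \<open>f\<close>: for almost every path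
      the two inner integrals coincide.\<close>
    have gp: "(\<integral>\<^sup>+\<omega>. (\<integral>\<^sup>+s\<in>{0..T}. ennreal ((g s \<omega> - p s \<omega>)\<^sup>2) \<partial>lborel) \<partial>M)
      = (\<integral>\<^sup>+\<omega>. (\<integral>\<^sup>+s\<in>{0..T}. ennreal ((f s \<omega> - p s \<omega>)\<^sup>2) \<partial>lborel) \<partial>M)"
    proof (rule nn_integral_cong_AE)
      show "AE \<omega> in M. (\<integral>\<^sup>+s\<in>{0..T}. ennreal ((g s \<omega> - p s \<omega>)\<^sup>2) \<partial>lborel)
        = (\<integral>\<^sup>+s\<in>{0..T}. ennreal ((f s \<omega> - p s \<omega>)\<^sup>2) \<partial>lborel)"
        using gf by eventually_elim (intro nn_integral_cong, auto simp: indicator_def)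
    qed
    have "(\<integral>\<^sup>+\<omega>. ennreal ((J \<omega> - R \<omega>)\<^sup>2) \<partial>M) = (\<integral>\<^sup>+\<omega>. (\<integral>\<^sup>+s\<in>{0..T}. ennreal ((p s \<omega> - r s \<omega>)\<^sup>2) \<partial>lborel) \<partial>M)"
      using iso unfolding s1 s2 .
    also have "\<dots> \<le> (\<integral>\<^sup>+\<omega>. 2 * (\<integral>\<^sup>+s\<in>{0..T}. ennreal ((g s \<omega> - p s \<omega>)\<^sup>2) \<partial>lborel)
        + 2 * (\<integral>\<^sup>+s\<in>{0..T}. ennreal ((g s \<omega> - r s \<omega>)\<^sup>2) \<partial>lborel) \<partial>M)"
      by (intro nn_integral_mono inner)
    also have "\<dots> = 2 * (\<integral>\<^sup>+\<omega>. (\<integral>\<^sup>+s\<in>{0..T}. ennreal ((f s \<omega> - p s \<omega>)\<^sup>2) \<partial>lborel) \<partial>M)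
        + 2 * (\<integral>\<^sup>+\<omega>. (\<integral>\<^sup>+s\<in>{0..T}. ennreal ((g s \<omega> - r s \<omega>)\<^sup>2) \<partial>lborel) \<partial>M)"
      unfolding gp[symmetric] using m1 m2 by (subst nn_integral_add) (auto simp: nn_integral_cmult)
    also have "\<dots> \<le> 2 * (\<integral>\<^sup>+\<omega>. (\<integral>\<^sup>+s\<in>{0..T}. ennreal ((f s \<omega> - p s \<omega>)\<^sup>2) \<partial>lborel) \<partial>M) + 2 * ennreal (T\<^sup>2 / real n)"
      by (intro add_left_mono mult_left_mono gr) simp
    finally have JR: "(\<integral>\<^sup>+\<omega>. ennreal ((J \<omega> - R \<omega>)\<^sup>2) \<partial>M)
      \<le> 2 * (\<integral>\<^sup>+\<omega>. (\<integral>\<^sup>+s\<in>{0..T}. ennreal ((f s \<omega> - p s \<omega>)\<^sup>2) \<partial>lborel) \<partial>M) + 2 * ennreal (T\<^sup>2 / real n)" .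
    have "(\<integral>\<^sup>+\<omega>. ennreal ((I \<omega> - R \<omega>)\<^sup>2) \<partial>M)
      \<le> 2 * (\<integral>\<^sup>+ \<omega>. ennreal ((I \<omega> - J \<omega>)\<^sup>2) \<partial>M) + 2 * (\<integral>\<^sup>+\<omega>. ennreal ((J \<omega> - R \<omega>)\<^sup>2) \<partial>M)"
      by (rule nn_integral_square_diff_le[OF IM RM JM])
    also have "\<dots> \<le> 2 * (\<integral>\<^sup>+ \<omega>. ennreal ((I \<omega> - J \<omega>)\<^sup>2) \<partial>M)
      + 2 * (2 * (\<integral>\<^sup>+\<omega>. (\<integral>\<^sup>+s\<in>{0..T}. ennreal ((f s \<omega> - p s \<omega>)\<^sup>2) \<partial>lborel) \<partial>M) + 2 * ennreal (T\<^sup>2 / real n))"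
      by (intro add_left_mono mult_left_mono JR) simp
    finally show ?thesis
      by (simp add: J_def p_def m_def th_def e_def distrib_left mult.assoc[symmetric])
  qed
  \<comment> \<open>The bound holds for every \<open>k\<close>; in the limit only the error of the
    Riemann integrand remains.\<close>
  have "(\<lambda>k. 2 * (\<integral>\<^sup>+ \<omega>. ennreal ((I \<omega> - elem_integral W (n' k) (\<theta>' k) (e' k) \<omega>)\<^sup>2) \<partial>M)
      + (4 * (\<integral>\<^sup>+ \<omega>. (\<integral>\<^sup>+ s \<in> {0..T}. ennreal ((f s \<omega> - elem_process (n' k) (\<theta>' k) (e' k) s \<omega>)\<^sup>2) \<partial>lborel) \<partial>M)
        + 4 * ennreal (T\<^sup>2 / real n))) \<longlonglongrightarrow> 2 * 0 + (4 * 0 + 4 * ennreal (T\<^sup>2 / real n))"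
    by (intro tendsto_add ennreal_tendsto_cmult l1 l2 tendsto_const) simp_all
  from LIMSEQ_le_const[OF this] bound
  have "(\<integral>\<^sup>+\<omega>. ennreal ((I \<omega> - R \<omega>)\<^sup>2) \<partial>M) \<le> 4 * ennreal (T\<^sup>2 / real n)" by simp
  also have "\<dots> = ennreal (4 * T\<^sup>2 / real n)"
    using ennreal_mult[of 4 "T\<^sup>2 / real n"] by simp
  finally show ?thesis by (simp add: R_def)
qed

end

section \<open>The separation of the coupled horizontal parts\<close>

definition alive :: "real \<Rightarrow> (nat \<Rightarrow> real) \<Rightarrow> nat \<Rightarrow> bool" where
  "alive K x i \<longleftrightarrow> (\<forall>j\<le>i. 0 < x j \<and> x j < K)"

text \<open>Written with a factor decided before each step, so that the stopped walk is a martingale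
  transform.\<close>

definition stopped :: "real \<Rightarrow> (nat \<Rightarrow> real) \<Rightarrow> nat \<Rightarrow> real" where
  "stopped K x n = x 0 + (\<Sum>i<n. of_bool (alive K x i) * (x (Suc i) - x i))"

text \<open>The index \<open>m\<close> is the first exit from \<open>(0, K)\<close>, capped at
  \<open>n\<close>. The step that leaves the strip is still taken, so the exit value may lie beyond
  the boundary.\<close>

lemma stopped_eq:
  "\<exists>m\<le>n. stopped K x n = x m \<and> (\<forall>j<m. 0 < x j \<and> x j < K) \<and> (m < n \<longrightarrow> \<not> (0 < x m \<and> x m < K))"
proof (induction n)
  case 0
  then show ?case by (simp add: stopped_def)
next
  case (Suc n)
  then obtain m where m: "m \<le> n" "stopped K x n = x m" "\<forall>j<m. 0 < x j \<and> x j < K"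
    "m < n \<longrightarrow> \<not> (0 < x m \<and> x m < K)" by blast
  have S: "stopped K x (Suc n) = stopped K x n + of_bool (alive K x n) * (x (Suc n) - x n)"
    by (simp add: stopped_def)
  show ?case
  proof (cases "0 < x m \<and> x m < K")
    case True
    then have "m = n" using m by auto
    then have "alive K x n" using True m(3) by (auto simp: alive_def le_less)
    then have "stopped K x (Suc n) = x (Suc n)" using S m \<open>m = n\<close> by simp
    moreover have "\<forall>j<Suc n. 0 < x j \<and> x j < K" using \<open>alive K x n\<close> by (auto simp: alive_def)
    ultimately show ?thesis by (intro exI[of _ "Suc n"]) simp
  next
    case False
    then have "\<not> alive K x n" using m(1) by (auto simp: alive_def)
    then have "stopped K x (Suc n) = x m" using S m by simp
    then show ?thesis using m False by (intro exI[of _ m]) auto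
  qed
qed

text \<open>A final value below \<open>K\<close> rules out an exit at the top, and positivity up to
  \<open>i\<close> rules out an exit at the bottom. Thus one event about the final value controls
  the whole path until the meeting.\<close>

lemma alive_of_stopped_less:
  assumes "stopped K x n < K" "i \<le> n" "\<And>j. j \<le> i \<Longrightarrow> 0 < x j"
  shows "alive K x i"
proof -
  obtain m where m: "m \<le> n" "stopped K x n = x m" "\<forall>j<m. 0 < x j \<and> x j < K"
    "m < n \<longrightarrow> \<not> (0 < x m \<and> x m < K)" using stopped_eq[of n K x] by blast
  show ?thesis
  proof (cases "i < m")
    case True
    then show ?thesis using m(3) by (auto simp: alive_def)
  next
    case False
    then have "0 < x m \<and> x m < K" using assms m(2) by auto
    then have "m = n" using m by auto
    then have "i = m" using False assms(2) by auto
    then show ?thesis using m(3) \<open>0 < x m \<and> x m < K\<close> by (auto simp: alive_def le_less)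
  qed
qed

text \<open>The walk leaves \<open>(0, K)\<close> with an overshoot of at most its largest step \<open>\<mu>\<close>, and \<open>\<mu> ^ 4 \<le> Q\<close>.\<close>

lemma stopped_overshoot:
  fixes x :: "nat \<Rightarrow> real" and n :: nat
  assumes x0: "0 \<le> x 0" "x 0 < K" and \<delta>: "\<delta> > 0"
  defines "Q \<equiv> \<Sum>i<n. (x (Suc i) - x i) ^ 4"
  shows "- (\<delta> + Q / \<delta> ^ 3) \<le> stopped K x n"
    and "- (K * (\<delta> + Q / \<delta> ^ 3) + (\<delta>\<^sup>2 + Q / \<delta>\<^sup>2)) \<le> stopped K x n * (K - stopped K x n)"
proof -
  have K: "K > 0" using x0 by simp
  have Q0: "0 \<le> Q" unfolding Q_def by (intro sum_nonneg) simp
  \<comment> \<open>Adding \<open>\<delta> ^ 4\<close> ensures \<open>\<mu> \<ge> \<delta>\<close>.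
    Division by powers of \<delta> then bounds \<open>\<mu>\<close> and \<open>\<mu>\<^sup>2\<close>
    by expressions linear in \<open>Q\<close>, whose mean is available.\<close>
  define \<mu> where "\<mu> = sqrt (sqrt (\<delta> ^ 4 + Q))"
  have \<mu>4: "\<mu> ^ 4 = \<delta> ^ 4 + Q"
  proof -
    have "\<mu> ^ 4 = (\<mu>\<^sup>2)\<^sup>2" by simp
    then show ?thesis using Q0 \<delta> by (simp add: \<mu>_def)
  qed
  have "\<mu> \<ge> 0" using Q0 \<delta> by (simp add: \<mu>_def)
  have \<mu>\<delta>: "\<delta> \<le> \<mu>"
  proof (rule ccontr)
    assume "\<not> \<delta> \<le> \<mu>"
    then have "\<mu> ^ 4 < \<delta> ^ 4" using \<open>\<mu> \<ge> 0\<close> by (intro power_strict_mono) auto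
    then show False using \<mu>4 Q0 by simp
  qed
  have \<mu>1: "\<mu> \<le> \<delta> + Q / \<delta> ^ 3"
  proof -
    have "\<mu> * \<delta> ^ 3 \<le> \<mu> * \<mu> ^ 3"
      using \<mu>\<delta> \<delta> \<open>\<mu> \<ge> 0\<close> by (intro mult_left_mono power_mono) auto
    also have "\<dots> = \<delta> ^ 4 + Q" using \<mu>4 by (simp add: power4_eq_xxxx power3_eq_cube)
    also have "\<dots> = (\<delta> + Q / \<delta> ^ 3) * \<delta> ^ 3" using \<delta> by (simp add: field_simps power4_eq_xxxx power3_eq_cube)
    finally show ?thesis using \<delta> by simp
  qed
  have \<mu>2: "\<mu>\<^sup>2 \<le> \<delta>\<^sup>2 + Q / \<delta>\<^sup>2"
  proof -
    have "\<mu>\<^sup>2 * \<delta>\<^sup>2 \<le> \<mu>\<^sup>2 * \<mu>\<^sup>2"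
      using \<mu>\<delta> \<delta> \<open>\<mu> \<ge> 0\<close> by (intro mult_left_mono power_mono) auto
    also have "\<dots> = \<delta> ^ 4 + Q" using \<mu>4 by (simp flip: power_add)
    also have "\<dots> = (\<delta>\<^sup>2 + Q / \<delta>\<^sup>2) * \<delta>\<^sup>2" using \<delta> by (simp add: field_simps flip: power_add)
    finally show ?thesis using \<delta> by simp
  qed
  have step: "\<bar>x (Suc i) - x i\<bar> \<le> \<mu>" if "i < n" for i
  proof (rule power_le_imp_le_base[of _ 3])
    have "(x (Suc i) - x i) ^ 4 \<le> Q"
      unfolding Q_def using that by (intro member_le_sum) auto
    moreover have "0 < \<delta> ^ 4" using \<delta> by simp
    moreover have "\<bar>x (Suc i) - x i\<bar> ^ 4 = (x (Suc i) - x i) ^ 4" by (simp add: power_even_abs)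
    ultimately have "\<bar>x (Suc i) - x i\<bar> ^ 4 \<le> \<mu> ^ 4" using \<mu>4 by linarith
    moreover have "Suc 3 = 4" by simp
    ultimately show "\<bar>x (Suc i) - x i\<bar> ^ Suc 3 \<le> \<mu> ^ Suc 3" by (simp only:)
  qed fact
  obtain m where m: "m \<le> n" "stopped K x n = x m" "\<forall>j<m. 0 < x j \<and> x j < K"
    using stopped_eq[of n K x] by blast
  have y: "- \<mu> \<le> x m" "x m \<le> K + \<mu>"
  proof -
    have "- \<mu> \<le> x m \<and> x m \<le> K + \<mu>"
    proof (cases m)
      case 0
      then show ?thesis using x0 \<open>\<mu> \<ge> 0\<close> by simp
    next
      case (Suc k)
      then have "0 < x k" "x k < K" "\<bar>x m - x k\<bar> \<le> \<mu>" using m step[of k] by auto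
      then show ?thesis by linarith
    qed
    then show "- \<mu> \<le> x m" "x m \<le> K + \<mu>" by auto
  qed
  show "- (\<delta> + Q / \<delta> ^ 3) \<le> stopped K x n" using y(1) \<mu>1 m(2) by linarith
  \<comment> \<open>The exit value lies in \<open>[- \<mu>, K + \<mu>]\<close>; expanding this
    product gives \<open>x m * (K - x m) + K * \<mu> + \<mu>\<^sup>2\<close>.\<close>
  have "0 \<le> (x m + \<mu>) * (K + \<mu> - x m)" using y by simp
  then have "- (K * \<mu> + \<mu>\<^sup>2) \<le> x m * (K - x m)" by (simp add: power2_eq_square algebra_simps)
  moreover have "K * \<mu> \<le> K * (\<delta> + Q / \<delta> ^ 3)" using \<mu>1 K by (intro mult_left_mono) auto
  ultimately show "- (K * (\<delta> + Q / \<delta> ^ 3) + (\<delta>\<^sup>2 + Q / \<delta>\<^sup>2)) \<le> stopped K x n * (K - stopped K x n)"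
    unfolding m(2) using \<mu>2 by linarith
qed

section \<open>Optional stopping for the separation on a grid\<close>

definition grid :: "real \<Rightarrow> nat \<Rightarrow> nat \<Rightarrow> real" where
  "grid T n i = real i * T / real n"

lemma grid_nonneg: "0 \<le> T \<Longrightarrow> 0 \<le> grid T n i"
  by (simp add: grid_def)

lemma grid_mono: "0 \<le> T \<Longrightarrow> i \<le> j \<Longrightarrow> grid T n i \<le> grid T n j"
  by (simp add: grid_def divide_right_mono mult_right_mono)

lemma grid_step: "grid T n (Suc i) - grid T n i = T / real n"
  by (simp add: grid_def add_divide_distrib distrib_right)

lemma grid_0 [simp]: "grid T n 0 = 0"
  by (simp add: grid_def)

lemma grid_end: "0 < n \<Longrightarrow> grid T n n = T"
  by (simp add: grid_def)

context planar_brownian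
begin

text \<open>Until the coupling time, \<open>sep u r s\<close> is the signed distance of the two horizontal parts along the
  unit vector \<open>u\<close> that joins their starting points, which are at distance \<open>r\<close>.\<close>

definition sep :: "real \<times> real \<Rightarrow> real \<Rightarrow> real \<Rightarrow> 'w \<Rightarrow> real" where
  "sep u r s \<omega> = r - 2 * incr (lin u) 0 s \<omega>"

lemma sep_0 [simp]: "sep u r 0 \<omega> = r"
  by (simp add: sep_def incr_def lin_def)

lemma sep_diff: "sep u r t \<omega> - sep u r s \<omega> = - 2 * incr (lin u) s t \<omega>"
  using lin_incr_split[of u 0 t \<omega> s] by (simp add: sep_def)

lemma sep_measurable_\<F>: "0 \<le> s \<Longrightarrow> s \<le> t \<Longrightarrow> sep u r s \<in> borel_measurable (\<F> t)"
  unfolding sep_def[abs_def]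
  using measurable_\<F>_mono[OF incr_measurable_\<F>[OF order_refl _ lin_measurable], of s t] by measurable

abbreviation "sep_walk u r T n \<omega> \<equiv> (\<lambda>i. sep u r (grid T n i) \<omega>)"

lemma alive_measurable_\<F>:
  assumes "0 \<le> T" shows "(\<lambda>\<omega>. of_bool (alive K (sep_walk u r T n \<omega>) i) :: real) \<in> borel_measurable (\<F> (grid T n i))"
proof -
  have "(\<lambda>\<omega>. of_bool (alive K (sep_walk u r T n \<omega>) i) :: real) =
    (\<lambda>\<omega>. \<Prod>j\<le>i. indicator {0<..<K} (sep u r (grid T n j) \<omega>))"
    by (auto simp: alive_def fun_eq_iff indicator_def of_bool_def prod_zero_iff intro!: prod.neutral)
  also have "\<dots> \<in> borel_measurable (\<F> (grid T n i))"
  proof (rule borel_measurable_prod)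
    fix j assume "j \<in> {..i}"
    then have "sep u r (grid T n j) \<in> borel_measurable (\<F> (grid T n i))"
      using assms by (intro sep_measurable_\<F> grid_nonneg grid_mono) auto
    then show "(\<lambda>\<omega>. indicator {0<..<K} (sep u r (grid T n j) \<omega>) :: real) \<in> borel_measurable (\<F> (grid T n i))"
      by measurable
  qed
  finally show ?thesis .
qed

text \<open>By the discrete isometry this expected time in the strip is also the second moment of
  the martingale part of the stopped walk, which is how it gets bounded.\<close>

definition alive_time :: "real \<Rightarrow> real \<times> real \<Rightarrow> real \<Rightarrow> real \<Rightarrow> nat \<Rightarrow> real" where
  "alive_time K u r T n = (\<Sum>i<n. (\<integral>\<omega>. of_bool (alive K (sep_walk u r T n \<omega>) i) \<partial>M) * (T / real n))"

text \<open>Optional stopping with \<open>Y = r - 2 * S\<close> and a centred sum \<open>S\<close>.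
  The mean of \<open>Y\<close> bounds the probability of ending above \<open>K\<close>, and the mean
  of \<open>Y * (K - Y)\<close> bounds the time in the strip. Both integrands would be nonnegative
  without overshoot, which accounts for the terms in \<delta> and \<open>q\<close>.\<close>

lemma stopped_walk_estimates:
  assumes u: "norm u = 1" and T: "0 \<le> T" and r: "0 \<le> r" "r < K" and \<delta>: "\<delta> > 0" and n: "0 < n"
  defines "Y \<equiv> \<lambda>\<omega>. stopped K (sep_walk u r T n \<omega>) n" and "q \<equiv> 768 * T\<^sup>2 / real n"
  shows "Y \<in> borel_measurable M"
    and "K * prob {\<omega>\<in>space M. K \<le> Y \<omega>} \<le> r + \<delta> + q / \<delta> ^ 3"
    and "4 * alive_time K u r T n \<le> r * K + K * (\<delta> + q / \<delta> ^ 3) + (\<delta>\<^sup>2 + q / \<delta>\<^sup>2)"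
proof -
  let ?\<theta> = "grid T n"
  note \<theta> = grid_nonneg[OF T] grid_mono[OF T]
  define Z where "Z i \<omega> = (of_bool (alive K (sep_walk u r T n \<omega>) i) :: real)" for i \<omega>
  define S where "S \<omega> = (\<Sum>i<n. Z i \<omega> * incr (lin u) (?\<theta> i) (?\<theta> (Suc i)) \<omega>)" for \<omega>
  have ZF: "Z i \<in> borel_measurable (\<F> (?\<theta> i))" for i
    unfolding Z_def[abs_def] by (rule alive_measurable_\<F>[OF T])
  have Zb: "\<bar>Z i \<omega>\<bar> \<le> 1" for i \<omega> by (simp add: Z_def)
  have Z2: "(Z i \<omega>)\<^sup>2 = Z i \<omega>" for i \<omega> by (simp add: Z_def)
  have YS: "Y \<omega> = r - 2 * S \<omega>" for \<omega>
  proof -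
    have "Y \<omega> = r + (\<Sum>i<n. Z i \<omega> * (- 2 * incr (lin u) (?\<theta> i) (?\<theta> (Suc i)) \<omega>))"
      by (simp only: Y_def stopped_def sep_diff Z_def grid_0 sep_0)
    also have "(\<Sum>i<n. Z i \<omega> * (- 2 * incr (lin u) (?\<theta> i) (?\<theta> (Suc i)) \<omega>)) = - 2 * S \<omega>"
      unfolding S_def sum_distrib_left by (intro sum.cong) simp_all
    finally show ?thesis by simp
  qed
  have st: "0 \<le> ?\<theta> i" "?\<theta> i \<le> ?\<theta> (Suc i)" for i using \<theta> by auto
  have mart: "S \<in> borel_measurable (\<F> (?\<theta> n)) \<and> integrable M (\<lambda>\<omega>. (S \<omega>)\<^sup>2) \<and> (\<integral>\<omega>. S \<omega> \<partial>M) = 0 \<and>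
    (\<integral>\<omega>. (S \<omega>)\<^sup>2 \<partial>M) = (\<Sum>i<n. (\<integral>\<omega>. (Z i \<omega>)\<^sup>2 \<partial>M) * (\<integral>\<omega>. (incr (lin u) (?\<theta> i) (?\<theta> (Suc i)) \<omega>)\<^sup>2 \<partial>M))"
    unfolding S_def[abs_def]
    by (rule martingale_sum[of ?\<theta> Z 1 "lin u" n, OF st ZF Zb lin_measurable
      lin_incr_moments(2)[OF st u] lin_incr_moments(4)[OF st u]])
  have SM: "S \<in> borel_measurable M" using mart measurable_\<F>_M by blast
  have S2: "integrable M (\<lambda>\<omega>. (S \<omega>)\<^sup>2)" and ES: "(\<integral>\<omega>. S \<omega> \<partial>M) = 0" using mart by auto
  have S1: "integrable M S" by (rule square_integrable_imp_integrable[OF SM S2])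
  have ES2: "(\<integral>\<omega>. (S \<omega>)\<^sup>2 \<partial>M) = alive_time K u r T n"
  proof -
    have "(\<integral>\<omega>. (S \<omega>)\<^sup>2 \<partial>M) = (\<Sum>i<n. (\<integral>\<omega>. Z i \<omega> \<partial>M) * (T / real n))"
      using mart by (simp only: Z2 lin_incr_moments(5)[OF st u] grid_step)
    then show ?thesis unfolding alive_time_def Z_def .
  qed
  show YM: "Y \<in> borel_measurable M" unfolding YS using SM by measurable
  define Q where "Q \<omega> = (\<Sum>i<n. (sep u r (?\<theta> (Suc i)) \<omega> - sep u r (?\<theta> i) \<omega>) ^ 4)" for \<omega>
  have Qi: "Q = (\<lambda>\<omega>. \<Sum>i<n. 16 * (incr (lin u) (?\<theta> i) (?\<theta> (Suc i)) \<omega>) ^ 4)"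
    unfolding Q_def sep_diff by (simp add: fun_eq_iff power_mult_distrib)
  have Qint: "integrable M Q"
    unfolding Qi using lin_incr_moments(3)[OF st u]
    by (intro Bochner_Integration.integrable_sum integrable_mult_right)
  have EQ: "(\<integral>\<omega>. Q \<omega> \<partial>M) \<le> q"
  proof -
    have "(\<integral>\<omega>. Q \<omega> \<partial>M) = (\<Sum>i<n. 16 * (\<integral>\<omega>. (incr (lin u) (?\<theta> i) (?\<theta> (Suc i)) \<omega>) ^ 4 \<partial>M))"
      unfolding Qi using lin_incr_moments(3)[OF st u]
      by (subst Bochner_Integration.integral_sum) auto
    also have "\<dots> \<le> (\<Sum>i<n. 16 * (48 * (T / real n)\<^sup>2))"
      using lin_incr_moments(6)[OF st u] by (intro sum_mono mult_left_mono) (auto simp: grid_step)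
    \<comment> \<open>\<open>768 = 16 * 48\<close>, where 16 is the fourth power of the factor 2 in
      \<open>sep\<close>.\<close>
    also have "\<dots> = q" using n by (simp add: q_def power_divide power2_eq_square field_simps)
    finally show ?thesis .
  qed
  have Q0: "0 \<le> Q \<omega>" for \<omega> unfolding Q_def by (intro sum_nonneg) simp
  have os: "- (\<delta> + Q \<omega> / \<delta> ^ 3) \<le> Y \<omega>"
    "- (K * (\<delta> + Q \<omega> / \<delta> ^ 3) + (\<delta>\<^sup>2 + Q \<omega> / \<delta>\<^sup>2)) \<le> Y \<omega> * (K - Y \<omega>)" for \<omega>
    using stopped_overshoot[of "sep_walk u r T n \<omega>" K \<delta> n] r \<delta> unfolding Y_def Q_def by simp_all
  have Yi: "integrable M Y" and EY: "(\<integral>\<omega>. Y \<omega> \<partial>M) = r"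
    unfolding YS using S1 ES by (simp_all add: prob_space)
  have mK: "{\<omega>\<in>space M. K \<le> Y \<omega>} \<in> events" using YM by measurable
  show "K * prob {\<omega>\<in>space M. K \<le> Y \<omega>} \<le> r + \<delta> + q / \<delta> ^ 3"
  proof -
    have "K * prob {\<omega>\<in>space M. K \<le> Y \<omega>} = (\<integral>\<omega>. K * indicator {\<omega>\<in>space M. K \<le> Y \<omega>} \<omega> \<partial>M)"
      using mK by simp
    also have "\<dots> \<le> (\<integral>\<omega>. Y \<omega> + (\<delta> + Q \<omega> / \<delta> ^ 3) \<partial>M)"
    proof (rule integral_mono)
      show "integrable M (\<lambda>\<omega>. K * indicator {\<omega>\<in>space M. K \<le> Y \<omega>} \<omega> :: real)"
        using mK by (intro integrable_mult_right) (simp add: integrable_indicator_iff emeasure_eq_measure)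
      show "integrable M (\<lambda>\<omega>. Y \<omega> + (\<delta> + Q \<omega> / \<delta> ^ 3))" using Yi Qint by simp
      fix \<omega> assume "\<omega> \<in> space M"
      have "0 \<le> Q \<omega> / \<delta> ^ 3" using Q0 \<delta> by simp
      then show "K * indicator {\<omega>\<in>space M. K \<le> Y \<omega>} \<omega> \<le> Y \<omega> + (\<delta> + Q \<omega> / \<delta> ^ 3)"
        using os(1)[of \<omega>] \<delta> by (auto simp: indicator_def)
    qed
    also have "\<dots> = r + \<delta> + (\<integral>\<omega>. Q \<omega> \<partial>M) / \<delta> ^ 3"
      using Yi Qint EY by (simp add: prob_space)
    also have "\<dots> \<le> r + \<delta> + q / \<delta> ^ 3" using EQ \<delta> by (simp add: divide_right_mono)
    finally show ?thesis .
  qed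
  show "4 * alive_time K u r T n \<le> r * K + K * (\<delta> + q / \<delta> ^ 3) + (\<delta>\<^sup>2 + q / \<delta>\<^sup>2)"
  proof -
    \<comment> \<open>Taking means removes \<open>S\<close> and turns \<open>S\<^sup>2\<close> into
      \<open>alive_time\<close>, so a lower bound for \<open>Y * (K - Y)\<close> is an upper bound
      for the time.\<close>
    have YK: "(\<lambda>\<omega>. Y \<omega> * (K - Y \<omega>)) = (\<lambda>\<omega>. (r * K - r\<^sup>2) + (4 * r - 2 * K) * S \<omega> - 4 * (S \<omega>)\<^sup>2)"
      unfolding YS by (rule ext) algebra
    have YKi: "integrable M (\<lambda>\<omega>. Y \<omega> * (K - Y \<omega>))"
      unfolding YK using S1 S2 by simp
    have "(\<integral>\<omega>. Y \<omega> * (K - Y \<omega>) \<partial>M) = r * K - r\<^sup>2 - 4 * alive_time K u r T n"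
      unfolding YK using S1 S2 ES ES2 by (simp add: prob_space)
    moreover have "(\<integral>\<omega>. - (K * (\<delta> + Q \<omega> / \<delta> ^ 3) + (\<delta>\<^sup>2 + Q \<omega> / \<delta>\<^sup>2)) \<partial>M) \<le> (\<integral>\<omega>. Y \<omega> * (K - Y \<omega>) \<partial>M)"
      using Qint YKi os(2) by (intro integral_mono) auto
    moreover have "(\<integral>\<omega>. - (K * (\<delta> + Q \<omega> / \<delta> ^ 3) + (\<delta>\<^sup>2 + Q \<omega> / \<delta>\<^sup>2)) \<partial>M)
      = - (K * (\<delta> + (\<integral>\<omega>. Q \<omega> \<partial>M) / \<delta> ^ 3) + (\<delta>\<^sup>2 + (\<integral>\<omega>. Q \<omega> \<partial>M) / \<delta>\<^sup>2))"
      using Qint by (simp add: prob_space)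
    moreover have "K * (\<delta> + (\<integral>\<omega>. Q \<omega> \<partial>M) / \<delta> ^ 3) \<le> K * (\<delta> + q / \<delta> ^ 3)"
      using EQ \<delta> r by (intro mult_left_mono add_left_mono divide_right_mono) auto
    moreover have "(\<integral>\<omega>. Q \<omega> \<partial>M) / \<delta>\<^sup>2 \<le> q / \<delta>\<^sup>2" using EQ by (intro divide_right_mono) auto
    ultimately show ?thesis using zero_le_power2[of r] by linarith
  qed
qed

end

lemma (in prob_space) AE_tendsto_0_imp_prob_tendsto_0:
  fixes f :: "nat \<Rightarrow> 'a \<Rightarrow> real"
  assumes [measurable]: "\<And>n. f n \<in> borel_measurable M" and lim: "AE \<omega> in M. (\<lambda>n. f n \<omega>) \<longlonglongrightarrow> 0" and e: "e > 0"
  shows "(\<lambda>n. prob {\<omega>\<in>space M. e \<le> \<bar>f n \<omega>\<bar>}) \<longlonglongrightarrow> 0"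
proof -
  let ?I = "\<lambda>n \<omega>. indicator {\<omega>\<in>space M. e \<le> \<bar>f n \<omega>\<bar>} \<omega> :: real"
  have "(\<lambda>n. \<integral>\<omega>. ?I n \<omega> \<partial>M) \<longlonglongrightarrow> (\<integral>\<omega>. 0 \<partial>M)"
  proof (rule integral_dominated_convergence[where w = "\<lambda>_. 1"])
    show "AE \<omega> in M. (\<lambda>n. ?I n \<omega>) \<longlonglongrightarrow> 0"
      using lim
    proof eventually_elim
      case (elim \<omega>)
      have "eventually (\<lambda>n. \<bar>f n \<omega>\<bar> < e) sequentially"
        using tendstoD[OF elim e] by (simp add: dist_real_def)
      then have "eventually (\<lambda>n. ?I n \<omega> = 0) sequentially"
        by eventually_elim (auto simp: indicator_def)
      then show ?case by (rule tendsto_eventually)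
    qed
  qed (auto simp: indicator_def)
  moreover have "(\<integral>\<omega>. ?I n \<omega> \<partial>M) = prob {\<omega>\<in>space M. e \<le> \<bar>f n \<omega>\<bar>}" for n
  proof -
    have "{\<omega>\<in>space M. e \<le> \<bar>f n \<omega>\<bar>} \<in> events" by measurable
    then show ?thesis by simp
  qed
  ultimately show ?thesis by simp
qed

section \<open>The meeting of the horizontal parts and the swept area\<close>

text \<open>Four times the bound on the expected time in the strip; \<open>r * K\<close> is what
  remains when first \<open>q\<close> and then \<delta> tend to 0.\<close>

definition time_bound :: "real \<Rightarrow> real \<Rightarrow> real \<Rightarrow> real \<Rightarrow> real" where
  "time_bound K r \<delta> q = r * K + K * (\<delta> + q / \<delta> ^ 3) + (\<delta>\<^sup>2 + q / \<delta>\<^sup>2)"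

context planar_brownian
begin

text \<open>A rendering of \<open>sep u r > 0\<close> on \<open>[0, s]\<close> that uses countably many times only.\<close>

definition apart :: "real \<times> real \<Rightarrow> real \<Rightarrow> real \<Rightarrow> 'w \<Rightarrow> bool" where
  "apart u r s \<omega> \<longleftrightarrow> (\<exists>k::nat. \<forall>q\<in>\<rat> \<inter> {0..s}. 1 / real (Suc k) \<le> sep u r q \<omega>)"

lemma apart_antimono: "apart u r t \<omega> \<Longrightarrow> s \<le> t \<Longrightarrow> apart u r s \<omega>"
  unfolding apart_def by fastforce

lemma apart_measurable_\<F>: "(\<lambda>\<omega>. of_bool (apart u r s \<omega>) :: real) \<in> borel_measurable (\<F> s)"
proof -
  have "{\<omega> \<in> space (\<F> s). apart u r s \<omega>} \<in> sets (\<F> s)"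
    unfolding apart_def
  proof (intro sets.sets_Collect_countable_Ex sets.sets_Collect_countable_All')
    fix k :: nat and q :: real assume "q \<in> \<rat> \<inter> {0..s}"
    then have "sep u r q \<in> borel_measurable (\<F> s)" by (intro sep_measurable_\<F>) auto
    then show "{\<omega> \<in> space (\<F> s). 1 / real (Suc k) \<le> sep u r q \<omega>} \<in> sets (\<F> s)" by measurable
  qed (auto intro: countable_Int1 countable_rat)
  then have "(indicator {\<omega> \<in> space (\<F> s). apart u r s \<omega>} :: 'w \<Rightarrow> real) \<in> borel_measurable (\<F> s)"
    by (rule borel_measurable_indicator)
  also have "(indicator {\<omega> \<in> space (\<F> s). apart u r s \<omega>} :: 'w \<Rightarrow> real) \<in> borel_measurable (\<F> s) \<longleftrightarrow> ?thesis"
    by (intro measurable_cong) (auto simp: indicator_def)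
  finally show ?thesis .
qed

lemma sep_continuous: "AE \<omega> in M. continuous_on {0..} (\<lambda>s. sep u r s \<omega>)"
proof -
  have "AE \<omega> in M. continuous_on {0..} (\<lambda>t. B1 t \<omega>)" "AE \<omega> in M. continuous_on {0..} (\<lambda>t. B2 t \<omega>)"
    using BM1 BM2 by (simp_all add: standard_BM_def)
  then show ?thesis
    by eventually_elim (auto simp: sep_def incr_def lin_def intro!: continuous_intros)
qed

text \<open>A uniform bound \<open>1 / Suc k\<close> at rational times passes to their closure,
  which strict positivity alone would not. Conversely, a positive continuous function on a compact
  interval has a positive minimum.\<close>

lemma apart_iff:
  assumes cont: "continuous_on {0..} (\<lambda>s. sep u r s \<omega>)" and s: "0 \<le> s"
  shows "apart u r s \<omega> \<longleftrightarrow> (\<forall>q\<in>{0..s}. 0 < sep u r q \<omega>)"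
proof
  assume "apart u r s \<omega>"
  then obtain k :: nat where k: "\<forall>q\<in>\<rat> \<inter> {0..s}. 1 / real (Suc k) \<le> sep u r q \<omega>"
    unfolding apart_def by (elim exE)
  have "closure (\<rat> \<inter> {0..s}) = {0..s}"
  proof
    show "closure (\<rat> \<inter> {0..s}) \<subseteq> {0..s}" by (rule closure_minimal) auto
    show "{0..s} \<subseteq> closure (\<rat> \<inter> {0..s})"
    \<comment> \<open>The single point 0 is rational itself; the density argument needs an interval
      with interior.\<close>
    proof (cases "s = 0")
      case True
      then have "{0..s} \<subseteq> \<rat> \<inter> {0..s}" by auto
      then show ?thesis using closure_subset by (rule subset_trans)
    next
      case False
      have "{0<..<s} \<inter> closure \<rat> \<subseteq> closure ({0<..<s} \<inter> \<rat>)"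
        by (rule open_Int_closure_subset) simp
      then have "{0<..<s} \<subseteq> closure ({0<..<s} \<inter> \<rat>)" by (simp add: Rats_closure_real)
      also have "\<dots> \<subseteq> closure (\<rat> \<inter> {0..s})" by (rule closure_mono) auto
      finally have "closure {0<..<s} \<subseteq> closure (\<rat> \<inter> {0..s})" by (rule closure_minimal) simp
      then show ?thesis using False s by (simp add: closure_greaterThanLessThan)
    qed
  qed
  then have "1 / real (Suc k) \<le> sep u r q \<omega>" if "q \<in> {0..s}" for q
    using continuous_ge_on_closure[of "\<rat> \<inter> {0..s}" "\<lambda>s. sep u r s \<omega>" q "1 / real (Suc k)"] k that
      continuous_on_subset[OF cont, of "{0..s}"] by auto
  moreover have "0 < 1 / real (Suc k)" by simp
  ultimately show "\<forall>q\<in>{0..s}. 0 < sep u r q \<omega>" by (meson less_le_trans)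
next
  assume pos: "\<forall>q\<in>{0..s}. 0 < sep u r q \<omega>"
  have "\<exists>x\<in>{0..s}. \<forall>y\<in>{0..s}. sep u r x \<omega> \<le> sep u r y \<omega>"
    using s by (intro continuous_attains_inf continuous_on_subset[OF cont]) auto
  then obtain x where x: "x \<in> {0..s}" "\<forall>y\<in>{0..s}. sep u r x \<omega> \<le> sep u r y \<omega>" by blast
  then have "0 < sep u r x \<omega>" using pos by blast
  then obtain k :: nat where "1 / real (Suc k) < sep u r x \<omega>" using nat_approx_posE by auto
  then have "\<forall>q\<in>\<rat> \<inter> {0..s}. 1 / real (Suc k) \<le> sep u r q \<omega>"
    using x(2) by (meson IntD2 less_eq_real_def less_le_trans)
  then show "apart u r s \<omega>" unfolding apart_def by blast
qed

abbreviation "cross_step u T n i \<omega> \<equiv> incr (lin (perp u)) (grid T n i) (grid T n (Suc i)) \<omega>"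

text \<open>The process \<open>\<rho>\<close> of the overview: absorbed at 0 from the first zero of
  \<open>sep\<close> on.\<close>

definition sep_stop :: "real \<times> real \<Rightarrow> real \<Rightarrow> real \<Rightarrow> 'w \<Rightarrow> real" where
  "sep_stop u r s \<omega> = of_bool (apart u r s \<omega>) * sep u r s \<omega>"

text \<open>The average over both ends of a cell is what the group law yields for the relative
  height, without any error.\<close>

definition area_sum :: "real \<times> real \<Rightarrow> real \<Rightarrow> real \<Rightarrow> nat \<Rightarrow> 'w \<Rightarrow> real" where
  "area_sum u r T n \<omega> =
    (\<Sum>i<n. (sep_stop u r (grid T n i) \<omega> + sep_stop u r (grid T n (Suc i)) \<omega>) / 2 * cross_step u T n i \<omega>)"

text \<open>The left-endpoint part; the factor \<open>alive\<close> keeps its coefficients in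
  \<open>[0, K]\<close>, so that it is a square-integrable martingale sum.\<close>

definition area_main :: "real \<Rightarrow> real \<times> real \<Rightarrow> real \<Rightarrow> real \<Rightarrow> nat \<Rightarrow> 'w \<Rightarrow> real" where
  "area_main K u r T n \<omega> = (\<Sum>i<n. (of_bool (alive K (sep_walk u r T n \<omega>) i) *
    sep_stop u r (grid T n i) \<omega>) * cross_step u T n i \<omega>)"

definition area_cov :: "real \<times> real \<Rightarrow> real \<Rightarrow> real \<Rightarrow> nat \<Rightarrow> 'w \<Rightarrow> real" where
  "area_cov u r T n \<omega> = (\<Sum>i<n. of_bool (apart u r (grid T n i) \<omega>) *
    incr (lin_perp u) (grid T n i) (grid T n (Suc i)) \<omega>)"

text \<open>Only the step in which the coupling happens contributes.\<close>

definition area_rest :: "real \<times> real \<Rightarrow> real \<Rightarrow> real \<Rightarrow> nat \<Rightarrow> 'w \<Rightarrow> real" where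
  "area_rest u r T n \<omega> = (\<Sum>i<n. (of_bool (apart u r (grid T n i) \<omega>) - of_bool (apart u r (grid T n (Suc i)) \<omega>)) *
    (sep u r (grid T n (Suc i)) \<omega> * cross_step u T n i \<omega>)) / 2"

text \<open>Before the meeting, half of a step of \<open>sep\<close> is minus the increment along
  \<open>u\<close>, which produces the covariation with a minus sign. Below level \<open>K\<close>
  every grid time at which the motions are still apart is \<open>alive\<close>, so inserting that
  factor changes nothing.\<close>

lemma area_sum_decomposition:
  assumes T: "0 \<le> T" and cont: "continuous_on {0..} (\<lambda>s. sep u r s \<omega>)"
    and Y: "stopped K (sep_walk u r T n \<omega>) n < K"
  shows "area_sum u r T n \<omega> = area_main K u r T n \<omega> - area_cov u r T n \<omega> - area_rest u r T n \<omega>"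
proof -
  have eq: "(sep_stop u r (grid T n i) \<omega> + sep_stop u r (grid T n (Suc i)) \<omega>) / 2 * cross_step u T n i \<omega> =
    (of_bool (alive K (sep_walk u r T n \<omega>) i) * sep_stop u r (grid T n i) \<omega>) * cross_step u T n i \<omega>
    - of_bool (apart u r (grid T n i) \<omega>) * incr (lin_perp u) (grid T n i) (grid T n (Suc i)) \<omega>
    - ((of_bool (apart u r (grid T n i) \<omega>) - of_bool (apart u r (grid T n (Suc i)) \<omega>)) *
    (sep u r (grid T n (Suc i)) \<omega> * cross_step u T n i \<omega>)) / 2" if i: "i < n" for i
  proof -
    have alive: "of_bool (alive K (sep_walk u r T n \<omega>) i) * sep_stop u r (grid T n i) \<omega> = sep_stop u r (grid T n i) \<omega>"
    proof (cases "apart u r (grid T n i) \<omega>")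
      case True
      have "alive K (sep_walk u r T n \<omega>) i"
      proof (rule alive_of_stopped_less[OF Y])
        fix j assume "j \<le> i"
        then show "0 < sep u r (grid T n j) \<omega>"
          using apart_iff[OF cont grid_nonneg[OF T, of n i]] True grid_nonneg[OF T, of n j] grid_mono[OF T, of j i n] by auto
      qed (use i in simp)
      then show ?thesis by simp
    qed (simp add: sep_stop_def)
    define X where "X = sep u r (grid T n i) \<omega>"
    define X' where "X' = sep u r (grid T n (Suc i)) \<omega>"
    define d where "d = incr (lin u) (grid T n i) (grid T n (Suc i)) \<omega>"
    define w where "w = cross_step u T n i \<omega>"
    define l :: real where "l = of_bool (apart u r (grid T n i) \<omega>)"
    define l' :: real where "l' = of_bool (apart u r (grid T n (Suc i)) \<omega>)"
    have X': "X' = X - 2 * d" using sep_diff[of u r "grid T n (Suc i)" \<omega> "grid T n i"] by (simp add: X_def X'_def d_def)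
    have lp: "incr (lin_perp u) (grid T n i) (grid T n (Suc i)) \<omega> = d * w"
      by (simp add: incr_def lin_perp_def d_def w_def)
    show ?thesis
      unfolding alive lp
      unfolding sep_stop_def X_def[symmetric] X'_def[symmetric] w_def[symmetric] l_def[symmetric] l'_def[symmetric]
      unfolding X' by (simp add: field_simps)
  qed
  show ?thesis
    unfolding area_sum_def area_main_def area_cov_def area_rest_def sum_divide_distrib sum_subtractf[symmetric]
    by (rule sum.cong[OF refl], rule eq) simp
qed

lemma area_rest_measurable:
  assumes T: "0 \<le> T" shows "area_rest u r T n \<in> borel_measurable M"
proof -
  have "(\<lambda>\<omega>. of_bool (apart u r (grid T n i) \<omega>) :: real) \<in> borel_measurable M" for i
    by (rule measurable_\<F>_M[OF apart_measurable_\<F>])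
  moreover have "sep u r (grid T n i) \<in> borel_measurable M" for i
    by (rule measurable_\<F>_M[OF sep_measurable_\<F>[OF grid_nonneg[OF T] order_refl]])
  moreover have "(\<lambda>\<omega>. cross_step u T n i \<omega>) \<in> borel_measurable M" for i
    using T by (intro incr_measurable grid_nonneg grid_mono lin_measurable) auto
  ultimately show ?thesis
    unfolding area_rest_def[abs_def]
    by (intro borel_measurable_sum borel_measurable_times borel_measurable_diff borel_measurable_divide
      borel_measurable_const)
qed

text \<open>In the cell of the meeting the separation has a zero, so uniform continuity makes both
  its end value and the cross step small.\<close>

lemma area_rest_tendsto_0:
  assumes T: "0 \<le> T"
  shows "AE \<omega> in M. (\<lambda>n. area_rest u r T n \<omega>) \<longlonglongrightarrow> 0"
  \<comment> \<open>\<open>sep (perp u) 0\<close> is -2 times the displacement along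
    \<open>perp u\<close>, so its continuity is that of the cross steps.\<close>
  using sep_continuous[of u r] sep_continuous[of "perp u" 0]
proof eventually_elim
  case (elim \<omega>)
  show ?case
  proof (rule LIMSEQ_I)
    fix e :: real assume e: "e > 0"
    define c where "c = min 1 e"
    have c: "c > 0" "c * c \<le> e" "c \<le> 1"
      using e mult_mono[of c 1 c e] by (auto simp: c_def)
    have uc: "uniformly_continuous_on {0..T} (\<lambda>s. sep u r s \<omega>)" "uniformly_continuous_on {0..T} (\<lambda>s. sep (perp u) 0 s \<omega>)"
      using elim by (auto intro!: compact_uniformly_continuous continuous_on_subset[of "{0..}"])
    obtain d1 where d1: "d1 > 0" "\<forall>x\<in>{0..T}. \<forall>y\<in>{0..T}. dist y x < d1 \<longrightarrow> dist (sep u r y \<omega>) (sep u r x \<omega>) < c"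
      using uc(1) c(1) unfolding uniformly_continuous_on_def by blast
    obtain d2 where d2: "d2 > 0" "\<forall>x\<in>{0..T}. \<forall>y\<in>{0..T}. dist y x < d2 \<longrightarrow> dist (sep (perp u) 0 y \<omega>) (sep (perp u) 0 x \<omega>) < c"
      using uc(2) c(1) unfolding uniformly_continuous_on_def by blast
    obtain N :: nat where N: "T / min d1 d2 < real N" using reals_Archimedean2 by blast
    show "\<exists>no. \<forall>n\<ge>no. norm (area_rest u r T n \<omega> - 0) < e"
    proof (intro exI[of _ "Suc N"] allI impI)
      fix n assume n: "n \<ge> Suc N"
      then have n0: "0 < n" by simp
      have "T / min d1 d2 < real n" using N n by linarith
      moreover have "0 < min d1 d2" "0 < real n" using d1(1) d2(1) n0 by auto
      ultimately have "T / real n < min d1 d2" by (simp only: pos_divide_less_eq mult.commute)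
      then have step: "T / real n < d1" "T / real n < d2" by auto
      let ?l = "\<lambda>i. of_bool (apart u r (grid T n i) \<omega>) :: real"
      have summand: "\<bar>(?l i - ?l (Suc i)) * (sep u r (grid T n (Suc i)) \<omega> * cross_step u T n i \<omega>)\<bar> \<le> (?l i - ?l (Suc i)) * (c * c)"
        if i: "i < n" for i
      proof -
        have g: "grid T n i \<in> {0..T}" "grid T n (Suc i) \<in> {0..T}" "grid T n i \<le> grid T n (Suc i)"
          using grid_nonneg[OF T] grid_mono[OF T, of i "Suc i" n] grid_mono[OF T, of i n n] grid_mono[OF T, of "Suc i" n n]
            grid_end[OF n0, of T] i by auto
        have "\<bar>cross_step u T n i \<omega>\<bar> \<le> c"
        proof -
          have "dist (grid T n (Suc i)) (grid T n i) < d2"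
            using step g(3) grid_step[of T n i] T by (simp add: dist_real_def)
          then have "\<bar>sep (perp u) 0 (grid T n (Suc i)) \<omega> - sep (perp u) 0 (grid T n i) \<omega>\<bar> < c"
            using d2(2) g by (auto simp: dist_real_def)
          then show ?thesis unfolding sep_diff by (simp add: abs_mult)
        qed
        \<comment> \<open>Positive up to the left end and nonpositive somewhere before the right
          end: the intermediate value theorem puts a zero into this cell.\<close>
        moreover have "\<bar>sep u r (grid T n (Suc i)) \<omega>\<bar> \<le> c" if ap: "apart u r (grid T n i) \<omega>" "\<not> apart u r (grid T n (Suc i)) \<omega>"
        proof -
          have pos: "0 < sep u r q \<omega>" if "q \<in> {0..grid T n i}" for q
            using ap(1) apart_iff[OF elim(1), of "grid T n i"] that g by auto
          obtain q where q: "q \<in> {0..grid T n (Suc i)}" "sep u r q \<omega> \<le> 0"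
            using ap(2) apart_iff[OF elim(1), of "grid T n (Suc i)"] g by (auto simp: not_less)
          then have qi: "grid T n i \<le> q" using pos[of q] by (cases "q \<le> grid T n i") auto
          have "\<exists>x\<ge>grid T n i. x \<le> q \<and> sep u r x \<omega> = 0"
          proof (rule IVT2')
            show "continuous_on {grid T n i..q} (\<lambda>s. sep u r s \<omega>)"
              using g by (intro continuous_on_subset[OF elim(1)]) auto
          qed (use q qi pos[of "grid T n i"] g in auto)
          then obtain z where z: "grid T n i \<le> z" "z \<le> q" "sep u r z \<omega> = 0" by blast
          have "z \<in> {0..T}" "dist z (grid T n (Suc i)) < d1"
            using z q g step grid_step[of T n i] by (auto simp: dist_real_def)
          then have "\<bar>sep u r z \<omega> - sep u r (grid T n (Suc i)) \<omega>\<bar> < c"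
            using d1(2) g by (auto simp: dist_real_def)
          then show ?thesis using z(3) by simp
        qed
        ultimately have "\<bar>sep u r (grid T n (Suc i)) \<omega> * cross_step u T n i \<omega>\<bar> \<le> c * c"
          if ap: "apart u r (grid T n i) \<omega>" "\<not> apart u r (grid T n (Suc i)) \<omega>"
          using ap c(1) unfolding abs_mult by (intro mult_mono) auto
        moreover have "apart u r (grid T n i) \<omega>" if "apart u r (grid T n (Suc i)) \<omega>"
          using apart_antimono[OF that g(3)] .
        ultimately show ?thesis by (auto simp: of_bool_def)
      qed
      have "\<bar>area_rest u r T n \<omega>\<bar> = \<bar>\<Sum>i<n. (?l i - ?l (Suc i)) * (sep u r (grid T n (Suc i)) \<omega> * cross_step u T n i \<omega>)\<bar> / 2"
        unfolding area_rest_def by (simp add: abs_divide)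
      also have "\<dots> \<le> (\<Sum>i<n. (?l i - ?l (Suc i)) * (c * c)) / 2"
        using summand by (intro divide_right_mono order.trans[OF sum_abs] sum_mono) auto
      \<comment> \<open>The weights decrease within \<open>[0, 1]\<close>, so their differences
        telescope to at most 1 however fine the grid.\<close>
      also have "(\<Sum>i<n. (?l i - ?l (Suc i)) * (c * c)) = (?l 0 - ?l n) * (c * c)"
        using sum_lessThan_telescope'[of ?l n] by (simp only: sum_distrib_right[symmetric] grid_0)
      also have "\<dots> / 2 \<le> 1 * (c * c) / 2"
        using c by (intro divide_right_mono mult_right_mono) auto
      also have "\<dots> < e" using c e by simp
      finally show "norm (area_rest u r T n \<omega> - 0) < e" by simp
    qed
  qed
qed

lemma alive_bounds:
  "alive K x i \<Longrightarrow> 0 < x i \<and> x i < K"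
  by (simp add: alive_def)

text \<open>Either the stopped walk ends at or above \<open>K\<close>, or one of the three parts of
  the area is at least \<kappa>. Optional stopping bounds the first event, Chebyshev the main part
  (with second moment at most \<open>K\<^sup>2\<close> times the time in the strip) and the
  covariation; the remainder stays as a probability that tends to 0.\<close>

lemma area_sum_tail:
  assumes u: "norm u = 1" and T: "0 \<le> T" and r: "0 \<le> r" "r < K" and \<delta>: "\<delta> > 0" and n: "0 < n" and \<kappa>: "\<kappa> > 0"
  defines "q \<equiv> 768 * T\<^sup>2 / real n"
  shows "\<exists>A\<in>events. (AE \<omega> in M. 3 * \<kappa> \<le> \<bar>area_sum u r T n \<omega>\<bar> \<longrightarrow> \<omega> \<in> A) \<and>
    prob A \<le> (r + \<delta> + q / \<delta> ^ 3) / K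
      + K\<^sup>2 * time_bound K r \<delta> q / (4 * \<kappa>\<^sup>2)
      + 48 * T\<^sup>2 / (real n * \<kappa>\<^sup>2) + prob {\<omega>\<in>space M. \<kappa> \<le> \<bar>area_rest u r T n \<omega>\<bar>}"
proof -
  let ?\<theta> = "grid T n"
  have K: "K > 0" using r by simp
  have st: "0 \<le> ?\<theta> i" "?\<theta> i \<le> ?\<theta> (Suc i)" for i using grid_nonneg[OF T] grid_mono[OF T] by auto
  have pu: "norm (perp u) = 1" using u by simp
  define Y where "Y \<omega> = stopped K (sep_walk u r T n \<omega>) n" for \<omega>
  note Yest = stopped_walk_estimates[OF u T r \<delta> n, folded q_def Y_def[abs_def] time_bound_def]
  define V where "V = area_main K u r T n"
  define D where "D = area_cov u r T n"
  define Z where "Z i \<omega> = of_bool (alive K (sep_walk u r T n \<omega>) i) * sep_stop u r (?\<theta> i) \<omega>" for i \<omega>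
  have apF: "(\<lambda>\<omega>. of_bool (apart u r (?\<theta> i) \<omega>) :: real) \<in> borel_measurable (\<F> (?\<theta> i))" for i
    by (rule apart_measurable_\<F>)
  have ZF: "Z i \<in> borel_measurable (\<F> (?\<theta> i))" for i
    unfolding Z_def[abs_def] sep_stop_def
    by (intro borel_measurable_times alive_measurable_\<F>[OF T] apF sep_measurable_\<F> st order_refl)
  have Zb': "0 \<le> Z i \<omega> \<and> Z i \<omega> \<le> K * of_bool (alive K (sep_walk u r T n \<omega>) i)" for i \<omega>
    using alive_bounds[of K "sep_walk u r T n \<omega>" i] K by (auto simp: Z_def sep_stop_def of_bool_def)
  have Zb: "\<bar>Z i \<omega>\<bar> \<le> K" for i \<omega> using Zb'[of i \<omega>] K by (auto simp: of_bool_def split: if_splits)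
  have martV: "V \<in> borel_measurable (\<F> (?\<theta> n)) \<and> integrable M (\<lambda>\<omega>. (V \<omega>)\<^sup>2) \<and> (\<integral>\<omega>. V \<omega> \<partial>M) = 0 \<and>
    (\<integral>\<omega>. (V \<omega>)\<^sup>2 \<partial>M) = (\<Sum>i<n. (\<integral>\<omega>. (Z i \<omega>)\<^sup>2 \<partial>M) * (\<integral>\<omega>. (incr (lin (perp u)) (?\<theta> i) (?\<theta> (Suc i)) \<omega>)\<^sup>2 \<partial>M))"
    unfolding V_def area_main_def[abs_def] Z_def[symmetric]
    by (rule martingale_sum[of ?\<theta> Z K "lin (perp u)" n, OF st ZF Zb lin_measurable
      lin_incr_moments(2)[OF st pu] lin_incr_moments(4)[OF st pu]])
  have VM: "V \<in> borel_measurable M" using martV measurable_\<F>_M by blast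
  have EV: "(\<integral>\<omega>. (V \<omega>)\<^sup>2 \<partial>M) \<le> K\<^sup>2 * alive_time K u r T n"
  proof -
    have "(\<integral>\<omega>. (V \<omega>)\<^sup>2 \<partial>M) = (\<Sum>i<n. (\<integral>\<omega>. (Z i \<omega>)\<^sup>2 \<partial>M) * (T / real n))"
      using martV by (simp only: lin_incr_moments(5)[OF st pu] grid_step)
    also have "\<dots> \<le> (\<Sum>i<n. (K\<^sup>2 * (\<integral>\<omega>. of_bool (alive K (sep_walk u r T n \<omega>) i) \<partial>M)) * (T / real n))"
    proof (intro sum_mono mult_right_mono)
      fix i
      have ZM: "Z i \<in> borel_measurable M" by (rule measurable_\<F>_M[OF ZF])
      have aM: "(\<lambda>\<omega>. of_bool (alive K (sep_walk u r T n \<omega>) i) :: real) \<in> borel_measurable M"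
        by (rule measurable_\<F>_M[OF alive_measurable_\<F>[OF T]])
      have ai: "integrable M (\<lambda>\<omega>. K\<^sup>2 * of_bool (alive K (sep_walk u r T n \<omega>) i) :: real)"
        by (intro integrable_mult_right integrable_const_bound[where B = 1] aM) auto
      have le: "(Z i \<omega>)\<^sup>2 \<le> K\<^sup>2 * of_bool (alive K (sep_walk u r T n \<omega>) i)" for \<omega>
      proof -
        have "(Z i \<omega>)\<^sup>2 \<le> (K * of_bool (alive K (sep_walk u r T n \<omega>) i))\<^sup>2"
          using Zb'[of i \<omega>] by (intro power_mono) auto
        then show ?thesis by (cases "alive K (sep_walk u r T n \<omega>) i") simp_all
      qed
      have "(\<integral>\<omega>. (Z i \<omega>)\<^sup>2 \<partial>M) \<le> (\<integral>\<omega>. K\<^sup>2 * of_bool (alive K (sep_walk u r T n \<omega>) i) \<partial>M)"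
      proof (rule integral_mono[OF _ ai le])
        show "integrable M (\<lambda>\<omega>. (Z i \<omega>)\<^sup>2)"
        proof (rule Bochner_Integration.integrable_bound[OF ai])
          show "AE \<omega> in M. norm ((Z i \<omega>)\<^sup>2) \<le> norm (K\<^sup>2 * of_bool (alive K (sep_walk u r T n \<omega>) i))"
            using le by (auto simp: abs_of_nonneg)
        qed (use ZM in measurable)
      qed
      then show "(\<integral>\<omega>. (Z i \<omega>)\<^sup>2 \<partial>M) \<le> K\<^sup>2 * (\<integral>\<omega>. of_bool (alive K (sep_walk u r T n \<omega>) i) \<partial>M)" by simp
    qed (use T in auto)
    also have "\<dots> = K\<^sup>2 * alive_time K u r T n"
      by (simp add: alive_time_def sum_distrib_left mult.assoc)
    finally show ?thesis .
  qed
  have martD: "D \<in> borel_measurable (\<F> (?\<theta> n)) \<and> integrable M (\<lambda>\<omega>. (D \<omega>)\<^sup>2) \<and> (\<integral>\<omega>. D \<omega> \<partial>M) = 0 \<and>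
    (\<integral>\<omega>. (D \<omega>)\<^sup>2 \<partial>M) = (\<Sum>i<n. (\<integral>\<omega>. (of_bool (apart u r (?\<theta> i) \<omega>))\<^sup>2 \<partial>M) * (\<integral>\<omega>. (incr (lin_perp u) (?\<theta> i) (?\<theta> (Suc i)) \<omega>)\<^sup>2 \<partial>M))"
    unfolding D_def area_cov_def[abs_def]
  proof (rule martingale_sum[of ?\<theta> "\<lambda>i \<omega>. of_bool (apart u r (?\<theta> i) \<omega>)" 1 "lin_perp u" n, OF st apF _ lin_perp_measurable
      lin_perp_incr_moments(2)[OF st u] lin_perp_incr_moments(3)[OF st u]])
    show "\<bar>of_bool (apart u r (?\<theta> i) \<omega>)\<bar> \<le> (1::real)" for i \<omega> by simp
  qed
  have DM: "D \<in> borel_measurable M" using martD measurable_\<F>_M by blast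
  have ED: "(\<integral>\<omega>. (D \<omega>)\<^sup>2 \<partial>M) \<le> 48 * T\<^sup>2 / real n"
  proof -
    have "(\<integral>\<omega>. (D \<omega>)\<^sup>2 \<partial>M) \<le> (\<Sum>i<n. 1 * (48 * (T / real n)\<^sup>2))"
      unfolding martD[THEN conjunct2, THEN conjunct2, THEN conjunct2]
    proof (intro sum_mono mult_mono)
      fix i
      have apM: "(\<lambda>\<omega>. of_bool (apart u r (?\<theta> i) \<omega>) :: real) \<in> borel_measurable M" by (rule measurable_\<F>_M[OF apF])
      have "(\<integral>\<omega>. (of_bool (apart u r (?\<theta> i) \<omega>))\<^sup>2 \<partial>M) \<le> (\<integral>\<omega>. 1 \<partial>M :: real)"
        using apM by (intro integral_mono integrable_const_bound[where B = 1]) auto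
      then show "(\<integral>\<omega>. (of_bool (apart u r (?\<theta> i) \<omega>))\<^sup>2 \<partial>M) \<le> (1::real)" by (simp add: prob_space)
      show "(\<integral>\<omega>. (incr (lin_perp u) (?\<theta> i) (?\<theta> (Suc i)) \<omega>)\<^sup>2 \<partial>M) \<le> 48 * (T / real n)\<^sup>2"
        using lin_perp_incr_moments(4)[OF st u] by (simp add: grid_step)
    qed auto
    also have "\<dots> = 48 * T\<^sup>2 / real n" using n by (simp add: power_divide power2_eq_square field_simps)
    finally show ?thesis .
  qed
  define A1 where "A1 = {\<omega>\<in>space M. K \<le> Y \<omega>}"
  define A2 where "A2 = {\<omega>\<in>space M. \<kappa> \<le> \<bar>V \<omega>\<bar>}"
  define A3 where "A3 = {\<omega>\<in>space M. \<kappa> \<le> \<bar>D \<omega>\<bar>}"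
  define A4 where "A4 = {\<omega>\<in>space M. \<kappa> \<le> \<bar>area_rest u r T n \<omega>\<bar>}"
  have A: "A1 \<in> events" "A2 \<in> events" "A3 \<in> events" "A4 \<in> events"
    unfolding A1_def A2_def A3_def A4_def using Yest(1) VM DM area_rest_measurable[OF T, of u r n] by measurable
  have P1: "prob A1 \<le> (r + \<delta> + q / \<delta> ^ 3) / K"
    using Yest(2) K unfolding A1_def Y_def by (simp add: pos_le_divide_eq mult.commute)
  have P2: "prob A2 \<le> K\<^sup>2 * time_bound K r \<delta> q / (4 * \<kappa>\<^sup>2)"
  proof -
    have "prob A2 \<le> (\<integral>\<omega>. (V \<omega>)\<^sup>2 \<partial>M) / \<kappa>\<^sup>2"
      unfolding A2_def using martV by (intro second_moment_method[OF VM _ \<kappa>]) auto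
    also have "\<dots> \<le> K\<^sup>2 * alive_time K u r T n / \<kappa>\<^sup>2" using EV by (intro divide_right_mono) auto
    also have "\<dots> = K\<^sup>2 * (4 * alive_time K u r T n) / (4 * \<kappa>\<^sup>2)" by simp
    also have "\<dots> \<le> K\<^sup>2 * time_bound K r \<delta> q / (4 * \<kappa>\<^sup>2)"
      using Yest(3) by (intro divide_right_mono mult_left_mono) auto
    finally show ?thesis .
  qed
  have P3: "prob A3 \<le> 48 * T\<^sup>2 / (real n * \<kappa>\<^sup>2)"
  proof -
    have "prob A3 \<le> (\<integral>\<omega>. (D \<omega>)\<^sup>2 \<partial>M) / \<kappa>\<^sup>2"
      unfolding A3_def using martD by (intro second_moment_method[OF DM _ \<kappa>]) auto
    also have "\<dots> \<le> 48 * T\<^sup>2 / real n / \<kappa>\<^sup>2" using ED by (intro divide_right_mono) auto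
    finally show ?thesis by simp
  qed
  have "AE \<omega> in M. 3 * \<kappa> \<le> \<bar>area_sum u r T n \<omega>\<bar> \<longrightarrow> \<omega> \<in> A1 \<union> A2 \<union> A3 \<union> A4"
    using sep_continuous[of u r] AE_space
  proof eventually_elim
    case (elim \<omega>)
    show ?case
    proof (cases "K \<le> Y \<omega>")
      case True
      then show ?thesis using elim(2) by (simp add: A1_def)
    next
      case False
      then have "area_sum u r T n \<omega> = V \<omega> - D \<omega> - area_rest u r T n \<omega>"
        using area_sum_decomposition[OF T elim(1), of K n] by (simp add: V_def D_def Y_def)
      then show ?thesis using elim(2) by (auto simp: A2_def A3_def A4_def)
    qed
  qed
  moreover have "prob (A1 \<union> A2 \<union> A3 \<union> A4) \<le> prob A1 + prob A2 + prob A3 + prob A4"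
    using A by (intro order.trans[OF measure_Un_le] add_right_mono) auto
  ultimately show ?thesis
    using A P1 P2 P3 unfolding A4_def by (intro bexI[of _ "A1 \<union> A2 \<union> A3 \<union> A4"] conjI) (auto simp: A4_def)
qed

text \<open>If the motions are apart up to \<open>T\<close>, all grid values are positive; a stopped
  walk below \<open>K\<close> would then be alive at the last grid point, contradicting a final
  separation of at least \<open>K\<close>.\<close>

lemma sep_stop_tail:
  assumes u: "norm u = 1" and T: "0 \<le> T" and r: "0 \<le> r" "r < K" and \<delta>: "\<delta> > 0" and n: "0 < n"
  shows "prob {\<omega>\<in>space M. K \<le> sep_stop u r T \<omega>} \<le> (r + \<delta> + (768 * T\<^sup>2 / real n) / \<delta> ^ 3) / K"
proof -
  have K: "K > 0" using r by simp
  note Yest = stopped_walk_estimates[OF u T r \<delta> n]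
  have "prob {\<omega>\<in>space M. K \<le> sep_stop u r T \<omega>} \<le> prob {\<omega>\<in>space M. K \<le> stopped K (sep_walk u r T n \<omega>) n}"
  proof (rule finite_measure_mono_AE)
    show "AE \<omega> in M. \<omega> \<in> {\<omega>\<in>space M. K \<le> sep_stop u r T \<omega>} \<longrightarrow> \<omega> \<in> {\<omega>\<in>space M. K \<le> stopped K (sep_walk u r T n \<omega>) n}"
      using sep_continuous[of u r]
    proof (eventually_elim, safe)
      fix \<omega> assume cont: "continuous_on {0..} (\<lambda>s. sep u r s \<omega>)" and le: "K \<le> sep_stop u r T \<omega>"
      then have ap: "apart u r T \<omega>" "K \<le> sep u r T \<omega>" using K by (auto simp: sep_stop_def of_bool_def split: if_splits)
      show "K \<le> stopped K (sep_walk u r T n \<omega>) n"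
      proof (rule ccontr)
        assume "\<not> K \<le> stopped K (sep_walk u r T n \<omega>) n"
        then have "alive K (sep_walk u r T n \<omega>) n"
        proof (intro alive_of_stopped_less)
          fix j assume "j \<le> n"
          then show "0 < sep u r (grid T n j) \<omega>"
            using ap(1) apart_iff[OF cont T] grid_nonneg[OF T, of n j] grid_mono[OF T, of j n n] grid_end[OF n, of T] by auto
        qed auto
        then show False using alive_bounds[of K "sep_walk u r T n \<omega>" n] ap(2) grid_end[OF n, of T] by simp
      qed
    qed
    show "{\<omega>\<in>space M. K \<le> stopped K (sep_walk u r T n \<omega>) n} \<in> events"
      using Yest(1) by measurable
  qed
  also have "\<dots> \<le> (r + \<delta> + (768 * T\<^sup>2 / real n) / \<delta> ^ 3) / K"
    using Yest(2) K by (simp add: pos_le_divide_eq mult.commute)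
  finally show ?thesis .
qed

end

section \<open>The relative height of the coupled motions\<close>

lemma rel_z_eq:
  "rel_z w w' = snd (snd w') - snd (snd w) - (fst w * fst (snd w') - fst (snd w) * fst w') / 2"
  by (cases w; cases w') simp

lemma heis_coords_measurable:
  fixes f :: "'a \<Rightarrow> heis"
  assumes "f \<in> borel_measurable M"
  shows "(\<lambda>\<omega>. fst (f \<omega>)) \<in> borel_measurable M" "(\<lambda>\<omega>. fst (snd (f \<omega>))) \<in> borel_measurable M"
    "(\<lambda>\<omega>. snd (snd (f \<omega>))) \<in> borel_measurable M"
  by (rule measurable_compose[OF assms], intro borel_measurable_continuous_onI continuous_intros)+

section \<open>Geometry of the reflection and of the height\<close>

text \<open>\<open>R\<close> and \<open>R'\<close> stand for the antisymmetric Riemann sums of the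
  two motions so far. As the horizontal difference is a multiple of \<open>u\<close> at both ends of
  the cell, the group law turns one more summand in each into the averaged multiple times the cross
  step.\<close>

lemma rel_z_step:
  fixes a a' :: heis
  assumes "fst a' + p' = fst a + p + \<rho> * fst u" "fst (snd a') + q' = fst (snd a) + q + \<rho> * snd u"
    and "fst a' + p1' = fst a + p1 + \<rho>1 * fst u" "fst (snd a') + q1' = fst (snd a) + q1 + \<rho>1 * snd u"
  shows "rel_z (heis_mult a (p1, q1, (R + (p * (q1 - q) - q * (p1 - p))) / 2))
      (heis_mult a' (p1', q1', (R' + (p' * (q1' - q') - q' * (p1' - p'))) / 2)) =
    rel_z (heis_mult a (p, q, R / 2)) (heis_mult a' (p', q', R' / 2))
      + (\<rho> + \<rho>1) / 2 * (- snd u * (p1 - p) + fst u * (q1 - q))"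
proof -
  obtain x y z where a: "a = (x, y, z)" by (cases a)
  obtain x' y' z' where a': "a' = (x', y', z')" by (cases a')
  have p': "p' = x + p + \<rho> * fst u - x'" "q' = y + q + \<rho> * snd u - y'"
    "p1' = x + p1 + \<rho>1 * fst u - x'" "q1' = y + q1 + \<rho>1 * snd u - y'"
    using assms by (simp_all add: a a')
  show ?thesis unfolding a a' p' by (simp add: field_simps)
qed

text \<open>The bisector lies at distance \<open>r / 2\<close> from \<open>b\<close> in the
  direction \<open>u\<close>, and a reflection moves a point by twice its distance to the mirror.
  This is the origin of the formula for \<open>sep\<close>.\<close>

lemma mirror_diff:
  assumes r: "r > 0" and u: "norm u = 1" and b: "b' - b = r *\<^sub>R u"
  shows "mirror b b' v - v = (r - 2 * ((v - b) \<bullet> u)) *\<^sub>R u"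
proof -
  have uu: "u \<bullet> u = 1" using u by (simp add: dot_square_norm)
  have m: "v - midpoint b b' = (v - b) - (r / 2) *\<^sub>R u"
  proof -
    have b': "b' = b + r *\<^sub>R u" using b by (simp add: algebra_simps)
    have "midpoint b b' = b + (r / 2) *\<^sub>R u"
      unfolding b' midpoint_def by (simp add: algebra_simps flip: scaleR_2)
    then show ?thesis by (simp add: algebra_simps)
  qed
  define c where "c = (v - b) \<bullet> u"
  have "(v - midpoint b b') \<bullet> (b' - b) = r * (c - r / 2)"
    unfolding m b c_def inner_diff_left[of "v - b"] inner_scaleR_left inner_scaleR_right uu by (simp add: algebra_simps)
  moreover have "(b' - b) \<bullet> (b' - b) = r * r"
    unfolding b inner_scaleR_left inner_scaleR_right uu by simp
  ultimately have "2 * ((v - midpoint b b') \<bullet> (b' - b)) / ((b' - b) \<bullet> (b' - b)) * r = 2 * c - r"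
    using r by (simp add: field_simps)
  then have "2 * ((v - midpoint b b') \<bullet> (b' - b)) / ((b' - b) \<bullet> (b' - b)) * r = 2 * ((v - b) \<bullet> u) - r"
    by (simp only: c_def)
  then have "(2 * ((v - midpoint b b') \<bullet> (b' - b)) / ((b' - b) \<bullet> (b' - b))) *\<^sub>R (b' - b) = (2 * ((v - b) \<bullet> u) - r) *\<^sub>R u"
    unfolding b by (simp only: scaleR_scaleR)
  then show ?thesis unfolding mirror_def by (simp add: algebra_simps)
qed

lemma lin_inner: "lin c d = c \<bullet> d"
  by (cases c; cases d) (simp add: lin_def)

lemma rel_z_heis_mult:
  "rel_z (heis_mult a (p, q, c)) (heis_mult a' (p', q', c')) =
    rel_z (heis_mult a (p, q, d)) (heis_mult a' (p', q', d')) + ((c' - c) - (d' - d))"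
  by (cases a; cases a') simp

lemma heis_mult_0: "heis_mult a (0, 0, 0) = a"
  by (cases a) simp

lemma (in prob_space) chebyshev_nn:
  assumes f [measurable]: "f \<in> borel_measurable M" and le: "(\<integral>\<^sup>+\<omega>. ennreal ((f \<omega>)\<^sup>2) \<partial>M) \<le> ennreal C" and C: "0 \<le> C" and k: "0 < \<kappa>"
  shows "prob {\<omega>\<in>space M. \<kappa> \<le> \<bar>f \<omega>\<bar>} \<le> C / \<kappa>\<^sup>2"
proof -
  have i: "integrable M (\<lambda>\<omega>. (f \<omega>)\<^sup>2)"
    using le by (intro integrableI_bounded) (auto intro: le_less_trans)
  have "(\<integral>\<omega>. (f \<omega>)\<^sup>2 \<partial>M) \<le> C"
    using le C nn_integral_eq_integral[OF i] by simp
  then have "(\<integral>\<omega>. (f \<omega>)\<^sup>2 \<partial>M) / \<kappa>\<^sup>2 \<le> C / \<kappa>\<^sup>2" by (intro divide_right_mono) auto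
  then show ?thesis using second_moment_method[OF f i k] by linarith
qed

text \<open>A meeting before \<open>s\<close> would force a zero of \<open>\<sigma>\<close>, because
  at \<open>mt\<close> both coupling rules apply. Conversely, a nonpositive value of
  \<open>\<sigma>\<close> yields an earlier zero, at which the mirror rule, if still in force, makes
  the paths meet; afterwards they agree.\<close>

lemma reflection_separation:
  fixes hP hP' :: "real \<Rightarrow> real \<times> real" and \<sigma> :: "real \<Rightarrow> real"
  assumes r: "0 < r" and u: "norm u = 1" and b: "b' - b = r *\<^sub>R u"
    and \<sigma>: "\<And>s. 0 \<le> s \<Longrightarrow> \<sigma> s = r - 2 * ((hP s - b) \<bullet> u)" and cont: "continuous_on {0..} \<sigma>" and \<sigma>0: "\<sigma> 0 = r"
    and before: "\<And>s. 0 \<le> s \<Longrightarrow> ereal s \<le> mt \<Longrightarrow> hP' s = mirror b b' (hP s)"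
    and after: "\<And>s. 0 \<le> s \<Longrightarrow> mt \<le> ereal s \<Longrightarrow> hP' s = hP s"
    and mt: "mt = Inf {ereal s | s. 0 \<le> s \<and> hP s = hP' s}" and s: "0 \<le> s"
  shows "hP' s - hP s = (if \<forall>q\<in>{0..s}. 0 < \<sigma> q then \<sigma> s else 0) *\<^sub>R u"
proof -
  have u0: "u \<noteq> 0" using u by auto
  have mir: "hP' q - hP q = \<sigma> q *\<^sub>R u" if "0 \<le> q" "ereal q \<le> mt" for q
    unfolding before[OF that] \<sigma>[OF that(1)] by (rule mirror_diff[OF r u b])
  show ?thesis
  proof (cases "\<forall>q\<in>{0..s}. 0 < \<sigma> q")
    case True
    have "ereal s \<le> mt"
    proof (rule ccontr)
      assume "\<not> ereal s \<le> mt"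
      then have lt: "mt < ereal s" by simp
      have "0 \<le> mt" unfolding mt by (rule Inf_greatest) auto
      with lt obtain m where m: "mt = ereal m" "0 \<le> m" "m < s" by (cases mt) auto
      \<comment> \<open>At time \<open>mt\<close> itself the reflected path is both the mirror image
        and equal, so no attainment of the infimum has to be shown.\<close>
      have "\<sigma> m *\<^sub>R u = 0" using mir[OF m(2)] after[OF m(2)] m(1) by simp
      then show False using u0 bspec[OF True, of m] m by simp
    qed
    then show ?thesis using mir[OF s] True by simp
  next
    case False
    then obtain q where q: "q \<in> {0..s}" "\<sigma> q \<le> 0" by (auto simp: not_less)
    have "\<exists>x\<ge>0. x \<le> q \<and> \<sigma> x = 0"
      by (rule IVT2') (use q \<sigma>0 r in \<open>auto intro: continuous_on_subset[OF cont]\<close>)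
    then obtain z where z: "0 \<le> z" "z \<le> q" "\<sigma> z = 0" by blast
    have "mt \<le> ereal z"
    proof (cases "ereal z \<le> mt")
      case True
      then have "hP z = hP' z" using mir[OF z(1)] z(3) by simp
      then show ?thesis unfolding mt using z(1) by (intro Inf_lower) auto
    qed simp
    also have "ereal z \<le> ereal s" using z q by simp
    finally have "hP' s = hP s" by (rule after[OF s])
    then show ?thesis using False by auto
  qed
qed

text \<open>The horizontal difference is \<open>sep_stop\<close> times \<open>u\<close>, and the
  change of height is \<open>area_sum\<close> up to Riemann errors. The first two involve only
  \<open>B1\<close> and \<open>B2\<close>; the Brownian motion driving \<open>P'\<close> remains in
  the errors alone.\<close>

lemma reflection_coupling_tails:
  assumes coupling: "reflection_coupling M a a' P P'" and t: "0 \<le> t"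
  defines "r \<equiv> norm (hor a' - hor a)"
  shows "prob_space M"
    and "\<And>\<kappa>. 0 < \<kappa> \<Longrightarrow> measure M {\<omega>\<in>space M. \<kappa> \<le> norm (hor (P' t \<omega>) - hor (P t \<omega>))} \<le> r / \<kappa>"
    and "\<And>\<kappa>. 0 < \<kappa> \<Longrightarrow> measure M {\<omega>\<in>space M. \<kappa> \<le> sqrt \<bar>rel_z (P t \<omega>) (P' t \<omega>) - rel_z a a'\<bar>} \<le> 5 / 2 * r / \<kappa>"
proof -
  have hb: "heis_BM M a P" "heis_BM M a' P'" using coupling by (auto simp: reflection_coupling_def)
  obtain B1 B2 L1 L2 where pl: "planar_BM M B1 B2"
    and ito: "\<forall>t\<ge>0. ito_integral M (natural_filtration M B1 B2) B2 B1 t (L1 t) \<and>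
             ito_integral M (natural_filtration M B1 B2) B1 B2 t (L2 t)"
    and Peq: "AE \<omega> in M. \<forall>t\<ge>0. P t \<omega> = heis_mult a (B1 t \<omega>, B2 t \<omega>, (L1 t \<omega> - L2 t \<omega>) / 2)"
    using hb(1) unfolding heis_BM_def by (elim conjE exE)
  obtain B1' B2' L1' L2' where pl': "planar_BM M B1' B2'"
    and ito': "\<forall>t\<ge>0. ito_integral M (natural_filtration M B1' B2') B2' B1' t (L1' t) \<and>
             ito_integral M (natural_filtration M B1' B2') B1' B2' t (L2' t)"
    and Peq': "AE \<omega> in M. \<forall>t\<ge>0. P' t \<omega> = heis_mult a' (B1' t \<omega>, B2' t \<omega>, (L1' t \<omega> - L2' t \<omega>) / 2)"
    using hb(2) unfolding heis_BM_def by (elim conjE exE)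
  have ps: "prob_space M" using pl by (simp add: planar_BM_def standard_BM_def)
  then show "prob_space M" .
  interpret X: planar_brownian M B1 B2 using ps pl by (intro planar_brownian.intro planar_brownian_axioms.intro)
  interpret X': planar_brownian M B1' B2' using ps pl' by (intro planar_brownian.intro planar_brownian_axioms.intro)
  have PM [measurable]: "P t \<in> borel_measurable M" "P' t \<in> borel_measurable M"
    using hb t by (simp_all add: heis_BM_def)
  note comp = heis_coords_measurable[OF PM(1)] heis_coords_measurable[OF PM(2)]
  have zM: "(\<lambda>\<omega>. rel_z (P t \<omega>) (P' t \<omega>)) \<in> borel_measurable M"
    unfolding rel_z_eq using comp by measurable
  \<comment> \<open>For \<open>r = 0\<close> there is no direction to choose; an arbitrary unit
    vector keeps the later formulas valid.\<close>
  define u :: "real \<times> real" where "u = (if r = 0 then (1, 0) else (1 / r) *\<^sub>R (hor a' - hor a))"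
  have u: "norm u = 1" by (auto simp: u_def r_def norm_Pair)
  have b: "hor a' - hor a = r *\<^sub>R u" by (auto simp: u_def r_def zero_prod_def)
  have r0: "0 \<le> r" by (simp add: r_def)
  have init: "AE \<omega> in M. B1 0 \<omega> = 0" "AE \<omega> in M. B2 0 \<omega> = 0" "AE \<omega> in M. B1' 0 \<omega> = 0" "AE \<omega> in M. B2' 0 \<omega> = 0"
    using X.BM1 X.BM2 X'.BM1 X'.BM2 by (simp_all add: standard_BM_def)
  have cpl: "AE \<omega> in M. \<forall>t\<ge>0.
      (ereal t \<le> meeting_time P P' \<omega> \<longrightarrow> hor (P' t \<omega>) = mirror (hor a) (hor a') (hor (P t \<omega>))) \<and>
      (meeting_time P P' \<omega> \<le> ereal t \<longrightarrow> hor (P' t \<omega>) = hor (P t \<omega>))"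
    using coupling by (simp add: reflection_coupling_def)
  have sep: "AE \<omega> in M. \<forall>s\<ge>0. hor (P' s \<omega>) - hor (P s \<omega>) = X.sep_stop u r s \<omega> *\<^sub>R u"
    using cpl Peq Peq' init X.sep_continuous[of u r]
  proof eventually_elim
    case (elim \<omega>)
    have hP: "hor (P s \<omega>) = hor a + (B1 s \<omega>, B2 s \<omega>)" if "0 \<le> s" for s
      using elim(2) that by (cases a) simp
    have hP': "hor (P' s \<omega>) = hor a' + (B1' s \<omega>, B2' s \<omega>)" if "0 \<le> s" for s
      using elim(3) that by (cases a') simp
    show ?case
    proof (intro allI impI)
      fix s :: real assume s: "0 \<le> s"
      have ap: "X.apart u r s \<omega> \<longleftrightarrow> (\<forall>q\<in>{0..s}. 0 < X.sep u r q \<omega>)"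
        by (rule X.apart_iff[OF elim(8) s])
      show "hor (P' s \<omega>) - hor (P s \<omega>) = X.sep_stop u r s \<omega> *\<^sub>R u"
      proof (cases "r = 0")
        \<comment> \<open>Equal horizontal starting points meet at time 0, and \<open>sep\<close>
          starts at 0, so the motions are never \<open>apart\<close>.\<close>
        case True
        have "hor a' = hor a" using b True by simp
        then have "hor (P 0 \<omega>) = hor (P' 0 \<omega>)"
          using hP[of 0] hP'[of 0] elim(4-7) by simp
        then have "meeting_time P P' \<omega> \<le> ereal 0"
          unfolding meeting_time_def by (intro Inf_lower) auto
        also have "\<dots> \<le> ereal s" using s by simp
        finally have "hor (P' s \<omega>) = hor (P s \<omega>)" using elim(1) s by blast
        moreover have "\<not> X.apart u r s \<omega>" unfolding ap using s True by (intro notI) (auto dest: bspec[of _ _ 0])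
        ultimately show ?thesis by (simp add: X.sep_stop_def)
      next
        case False
        have "hor (P' s \<omega>) - hor (P s \<omega>) = (if \<forall>q\<in>{0..s}. 0 < X.sep u r q \<omega> then X.sep u r s \<omega> else 0) *\<^sub>R u"
        proof (rule reflection_separation[where b = "hor a" and b' = "hor a'" and r = r and mt = "meeting_time P P' \<omega>"])
          show "X.sep u r s \<omega> = r - 2 * ((hor (P s \<omega>) - hor a) \<bullet> u)" if "0 \<le> s" for s
            using hP[OF that] elim(4,5) by (simp add: X.sep_def X.incr_def lin_inner inner_commute)
        qed (use False r0 u b elim s in \<open>auto simp: meeting_time_def\<close>)
        then show ?thesis using ap by (simp add: X.sep_stop_def)
      qed
    qed
  qed
  have sep_norm: "AE \<omega> in M. norm (hor (P' t \<omega>) - hor (P t \<omega>)) = X.sep_stop u r t \<omega>"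
    using sep X.sep_continuous[of u r]
  proof eventually_elim
    case (elim \<omega>)
    have "0 \<le> X.sep_stop u r t \<omega>"
      using X.apart_iff[OF elim(2) t] t by (auto simp: X.sep_stop_def of_bool_def less_imp_le)
    then show ?case using elim(1) t u by simp
  qed
  have grid_lim: "(\<lambda>n. 768 * t\<^sup>2 / real n) \<longlonglongrightarrow> 0" by (rule lim_const_over_n)
  show "measure M {\<omega>\<in>space M. \<kappa> \<le> norm (hor (P' t \<omega>) - hor (P t \<omega>))} \<le> r / \<kappa>" if k: "0 < \<kappa>" for \<kappa>
  proof (cases "r < \<kappa>")
    case False
    then have "1 \<le> r / \<kappa>" using k by simp
    then show ?thesis using X.prob_le_1 order.trans by blast
  next
    case True
    have S: "X.sep_stop u r t \<in> borel_measurable M"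
      unfolding X.sep_stop_def[abs_def]
      by (intro borel_measurable_times X.measurable_\<F>_M[OF X.apart_measurable_\<F>]
          X.measurable_\<F>_M[OF X.sep_measurable_\<F>[OF t order_refl]])
    have "measure M {\<omega>\<in>space M. \<kappa> \<le> norm (hor (P' t \<omega>) - hor (P t \<omega>))} \<le> measure M {\<omega>\<in>space M. \<kappa> \<le> X.sep_stop u r t \<omega>}"
      by (rule X.finite_measure_mono_AE) (use sep_norm S in \<open>auto elim: eventually_mono\<close>)
    also have "\<dots> \<le> r / \<kappa>"
    \<comment> \<open>The order of limits matters: \<open>n\<close> tends to infinity at fixed
      \<delta>, which removes the term with \<open>\<delta> ^ 3\<close> in the denominator, and then
      \<delta> tends to 0.\<close>
    proof (rule tendsto_lowerbound[of "\<lambda>\<delta>. (r + \<delta>) / \<kappa>" _ "at_right 0"])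
      show "((\<lambda>\<delta>. (r + \<delta>) / \<kappa>) \<longlongrightarrow> r / \<kappa>) (at_right 0)"
        using k by (auto intro!: tendsto_eq_intros)
      show "\<forall>\<^sub>F \<delta> in at_right 0. measure M {\<omega>\<in>space M. \<kappa> \<le> X.sep_stop u r t \<omega>} \<le> (r + \<delta>) / \<kappa>"
        using eventually_at_right_less
      proof eventually_elim
        case (elim \<delta>)
        have "(\<lambda>n. (r + \<delta> + (768 * t\<^sup>2 / real n) / \<delta> ^ 3) / \<kappa>) \<longlonglongrightarrow> (r + \<delta> + 0 / \<delta> ^ 3) / \<kappa>"
          using elim k by (intro tendsto_intros grid_lim) auto
        then have "measure M {\<omega>\<in>space M. \<kappa> \<le> X.sep_stop u r t \<omega>} \<le> (r + \<delta> + 0 / \<delta> ^ 3) / \<kappa>"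
          by (rule LIMSEQ_le_const) (use X.sep_stop_tail[OF u t r0 True elim] in \<open>auto intro!: exI[of _ 1]\<close>)
        then show ?case by simp
      qed
    qed simp
    finally show ?thesis .
  qed
  define R where "R W V n m \<omega> = (\<Sum>i<m. W (grid t n i) \<omega> * (V (grid t n (Suc i)) \<omega> - V (grid t n i) \<omega>))"
    for W V :: "real \<Rightarrow> 'a \<Rightarrow> real" and n m \<omega>
  have riem: "(\<integral>\<^sup>+\<omega>. ennreal ((L1 t \<omega> - R B1 B2 n n \<omega>)\<^sup>2) \<partial>M) \<le> ennreal (4 * t\<^sup>2 / real n)"
      "(\<integral>\<^sup>+\<omega>. ennreal ((L2 t \<omega> - R B2 B1 n n \<omega>)\<^sup>2) \<partial>M) \<le> ennreal (4 * t\<^sup>2 / real n)"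
      "(\<integral>\<^sup>+\<omega>. ennreal ((L1' t \<omega> - R B1' B2' n n \<omega>)\<^sup>2) \<partial>M) \<le> ennreal (4 * t\<^sup>2 / real n)"
      "(\<integral>\<^sup>+\<omega>. ennreal ((L2' t \<omega> - R B2' B1' n n \<omega>)\<^sup>2) \<partial>M) \<le> ennreal (4 * t\<^sup>2 / real n)"
    if n: "0 < n" for n
    using X.ito_integral_riemann[OF _ _ t n, of B1 B2 "L1 t"] X.ito_integral_riemann[OF _ _ t n, of B2 B1 "L2 t"]
      X'.ito_integral_riemann[OF _ _ t n, of B1' B2' "L1' t"] X'.ito_integral_riemann[OF _ _ t n, of B2' B1' "L2' t"]
      ito ito' t unfolding R_def grid_def by auto
  \<comment> \<open>The error in the relative height when all four stochastic integrals are replaced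
    by Riemann sums.\<close>
  define E where "E n \<omega> = (((L1' t \<omega> - R B1' B2' n n \<omega>) - (L2' t \<omega> - R B2' B1' n n \<omega>))
    - ((L1 t \<omega> - R B1 B2 n n \<omega>) - (L2 t \<omega> - R B2 B1 n n \<omega>))) / 2" for n \<omega>
  have RM: "R W V n m \<in> borel_measurable M" if "\<And>s. 0 \<le> s \<Longrightarrow> W s \<in> borel_measurable M" "\<And>s. 0 \<le> s \<Longrightarrow> V s \<in> borel_measurable M"
    for W V :: "real \<Rightarrow> 'a \<Rightarrow> real" and n m
    unfolding R_def[abs_def]
    by (intro borel_measurable_sum borel_measurable_times borel_measurable_diff that grid_nonneg t)
  have LM: "L1 t \<in> borel_measurable M" "L2 t \<in> borel_measurable M" "L1' t \<in> borel_measurable M" "L2' t \<in> borel_measurable M"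
    using ito ito' t by (auto simp: ito_integral_def)
  have DM [measurable]: "(\<lambda>\<omega>. L1 t \<omega> - R B1 B2 n n \<omega>) \<in> borel_measurable M" "(\<lambda>\<omega>. L2 t \<omega> - R B2 B1 n n \<omega>) \<in> borel_measurable M"
    "(\<lambda>\<omega>. L1' t \<omega> - R B1' B2' n n \<omega>) \<in> borel_measurable M" "(\<lambda>\<omega>. L2' t \<omega> - R B2' B1' n n \<omega>) \<in> borel_measurable M" for n
    by (intro borel_measurable_diff LM RM X.B1_measurable X.B2_measurable X'.B1_measurable X'.B2_measurable; assumption)+
  have EM: "E n \<in> borel_measurable M" for n unfolding E_def[abs_def] by measurable
  have E2: "(\<integral>\<^sup>+\<omega>. ennreal ((E n \<omega>)\<^sup>2) \<partial>M) \<le> ennreal (16 * t\<^sup>2 / real n)" if n: "0 < n" for n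
  proof -
    have sqm: "(\<lambda>\<omega>. ennreal ((f \<omega>)\<^sup>2)) \<in> borel_measurable M" if [measurable]: "f \<in> borel_measurable M" for f
      by measurable
    note m = sqm[OF DM(1)[of n]] sqm[OF DM(2)[of n]] sqm[OF DM(3)[of n]] sqm[OF DM(4)[of n]]
    \<comment> \<open>Cauchy--Schwarz for four terms, witnessed by a sum of squares; the four errors
      \<open>4 * t\<^sup>2 / n\<close> then add up to \<open>16 * t\<^sup>2 / n\<close>.\<close>
    have sq: "((c - d - (a - b)) / 2)\<^sup>2 \<le> a\<^sup>2 + b\<^sup>2 + c\<^sup>2 + d\<^sup>2" for a b c d :: real
    proof -
      have "a\<^sup>2 + b\<^sup>2 + c\<^sup>2 + d\<^sup>2 - ((c - d - (a - b)) / 2)\<^sup>2 =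
        ((a + b)\<^sup>2 + (a + c)\<^sup>2 + (a - d)\<^sup>2 + (b - c)\<^sup>2 + (b + d)\<^sup>2 + (c + d)\<^sup>2) / 4"
        by (simp add: power2_eq_square field_simps)
      also have "\<dots> \<ge> 0" by simp
      finally show ?thesis by simp
    qed
    have "(\<integral>\<^sup>+\<omega>. ennreal ((E n \<omega>)\<^sup>2) \<partial>M) \<le> (\<integral>\<^sup>+\<omega>. ennreal ((L1 t \<omega> - R B1 B2 n n \<omega>)\<^sup>2) + ennreal ((L2 t \<omega> - R B2 B1 n n \<omega>)\<^sup>2)
      + ennreal ((L1' t \<omega> - R B1' B2' n n \<omega>)\<^sup>2) + ennreal ((L2' t \<omega> - R B2' B1' n n \<omega>)\<^sup>2) \<partial>M)"
    proof (rule nn_integral_mono)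
      fix \<omega>
      show "ennreal ((E n \<omega>)\<^sup>2) \<le> ennreal ((L1 t \<omega> - R B1 B2 n n \<omega>)\<^sup>2) + ennreal ((L2 t \<omega> - R B2 B1 n n \<omega>)\<^sup>2)
        + ennreal ((L1' t \<omega> - R B1' B2' n n \<omega>)\<^sup>2) + ennreal ((L2' t \<omega> - R B2' B1' n n \<omega>)\<^sup>2)"
        unfolding E_def by (subst ennreal_plus[symmetric], simp, simp)+ (intro ennreal_leI sq)
    qed
    also have "\<dots> = (\<integral>\<^sup>+\<omega>. ennreal ((L1 t \<omega> - R B1 B2 n n \<omega>)\<^sup>2) \<partial>M) + (\<integral>\<^sup>+\<omega>. ennreal ((L2 t \<omega> - R B2 B1 n n \<omega>)\<^sup>2) \<partial>M)
      + (\<integral>\<^sup>+\<omega>. ennreal ((L1' t \<omega> - R B1' B2' n n \<omega>)\<^sup>2) \<partial>M) + (\<integral>\<^sup>+\<omega>. ennreal ((L2' t \<omega> - R B2' B1' n n \<omega>)\<^sup>2) \<partial>M)"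
      by (simp only: nn_integral_add[OF borel_measurable_add[OF borel_measurable_add[OF m(1,2)] m(3)] m(4)]
          nn_integral_add[OF borel_measurable_add[OF m(1,2)] m(3)] nn_integral_add[OF m(1,2)])
    also have "\<dots> \<le> ennreal (4 * t\<^sup>2 / real n) + ennreal (4 * t\<^sup>2 / real n) + ennreal (4 * t\<^sup>2 / real n) + ennreal (4 * t\<^sup>2 / real n)"
      by (intro add_mono riem n)
    also have "\<dots> = ennreal (16 * t\<^sup>2 / real n)"
      by (subst ennreal_plus[symmetric], simp, simp)+ simp
    finally show ?thesis .
  qed
  have area: "AE \<omega> in M. rel_z (P t \<omega>) (P' t \<omega>) - rel_z a a' = X.area_sum u r t n \<omega> + E n \<omega>" if n: "0 < n" for n
    using sep Peq Peq' init
  proof eventually_elim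
    case (elim \<omega>)
    \<comment> \<open>The relative height after \<open>m\<close> cells with Riemann sums in place of
      integrals; it starts at \<open>rel_z a a'\<close> and changes exactly by the summands of
      \<open>area_sum\<close>.\<close>
    define G where "G m = rel_z (heis_mult a (B1 (grid t n m) \<omega>, B2 (grid t n m) \<omega>, (R B1 B2 n m \<omega> - R B2 B1 n m \<omega>) / 2))
      (heis_mult a' (B1' (grid t n m) \<omega>, B2' (grid t n m) \<omega>, (R B1' B2' n m \<omega> - R B2' B1' n m \<omega>) / 2))" for m
    have hor': "fst a' + B1' s \<omega> = fst a + B1 s \<omega> + X.sep_stop u r s \<omega> * fst u \<and>
      fst (snd a') + B2' s \<omega> = fst (snd a) + B2 s \<omega> + X.sep_stop u r s \<omega> * snd u" if s: "0 \<le> s" for s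
    proof -
      have "hor (P' s \<omega>) - hor (P s \<omega>) = X.sep_stop u r s \<omega> *\<^sub>R u" using elim(1) s by blast
      then show ?thesis using elim(2,3) s by (cases a; cases a'; cases u) (auto simp: algebra_simps)
    qed
    have "G m = rel_z a a' + (\<Sum>i<m. (X.sep_stop u r (grid t n i) \<omega> + X.sep_stop u r (grid t n (Suc i)) \<omega>) / 2 * X.cross_step u t n i \<omega>)" for m
    proof (induction m)
      case 0
      then show ?case using elim(4-7) by (simp add: G_def R_def heis_mult_0)
    next
      case (Suc m)
      have R_Suc: "R W V n (Suc m) \<omega> - R V W n (Suc m) \<omega> = (R W V n m \<omega> - R V W n m \<omega>)
        + (W (grid t n m) \<omega> * (V (grid t n (Suc m)) \<omega> - V (grid t n m) \<omega>) - V (grid t n m) \<omega> * (W (grid t n (Suc m)) \<omega> - W (grid t n m) \<omega>))"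
        for W V by (simp add: R_def)
      have "G (Suc m) = G m + (X.sep_stop u r (grid t n m) \<omega> + X.sep_stop u r (grid t n (Suc m)) \<omega>) / 2 *
        (- snd u * (B1 (grid t n (Suc m)) \<omega> - B1 (grid t n m) \<omega>) + fst u * (B2 (grid t n (Suc m)) \<omega> - B2 (grid t n m) \<omega>))"
        unfolding G_def R_Suc
        using hor'[OF grid_nonneg[OF t, of n m]] hor'[OF grid_nonneg[OF t, of n "Suc m"]]
        by (intro rel_z_step) simp_all
      then show ?case using Suc by (simp add: X.incr_def lin_def perp_def)
    qed
    from this[of n] have G: "G n = rel_z a a' + X.area_sum u r t n \<omega>"
      by (simp add: X.area_sum_def)
    have "rel_z (P t \<omega>) (P' t \<omega>) = G n + E n \<omega>"
      using elim(2,3) t unfolding G_def grid_end[OF n]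
      by (simp add: rel_z_heis_mult[of a _ _ "(L1 t \<omega> - L2 t \<omega>) / 2" a' _ _ "(L1' t \<omega> - L2' t \<omega>) / 2"
            "(R B1 B2 n n \<omega> - R B2 B1 n n \<omega>) / 2" "(R B1' B2' n n \<omega> - R B2' B1' n n \<omega>) / 2"])
        (simp add: E_def field_simps)
    then show ?case using G by simp
  qed
  show "measure M {\<omega>\<in>space M. \<kappa> \<le> sqrt \<bar>rel_z (P t \<omega>) (P' t \<omega>) - rel_z a a'\<bar>} \<le> 5 / 2 * r / \<kappa>" if \<kappa>: "0 < \<kappa>" for \<kappa>
  \<comment> \<open>Otherwise the claimed bound is at least \<open>5 / 4\<close>, and nothing is to
    be shown.\<close>
  proof (cases "r < \<kappa> / 2")
    case False
    then have "1 \<le> 5 / 2 * r / \<kappa>" using \<kappa> by (simp add: field_simps)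
    then show ?thesis using X.prob_le_1 order.trans by blast
  next
    case True
    \<comment> \<open>The square of \<kappa> is \<open>4 * k\<close>: three shares for the parts of
      the area, one for the Riemann error. In the limit \<open>r / K + r / (4 * K)\<close> remains,
      which is \<open>5 / 2 * r / \<kappa>\<close>.\<close>
    define K where "K = \<kappa> / 2"
    define k where "k = K\<^sup>2"
    have K: "0 < K" "r < K" and k: "0 < k" using True \<kappa> by (auto simp: K_def k_def)
    define S where "S = {\<omega>\<in>space M. \<kappa> \<le> sqrt \<bar>rel_z (P t \<omega>) (P' t \<omega>) - rel_z a a'\<bar>}"
    define bnd where "bnd \<delta> n = (r + \<delta> + (768 * t\<^sup>2 / real n) / \<delta> ^ 3) / K
      + K\<^sup>2 * time_bound K r \<delta> (768 * t\<^sup>2 / real n) / (4 * k\<^sup>2)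
      + 48 * t\<^sup>2 / (real n * k\<^sup>2) + measure M {\<omega>\<in>space M. k \<le> \<bar>X.area_rest u r t n \<omega>\<bar>} + 16 * t\<^sup>2 / real n / k\<^sup>2" for \<delta> n
    have le: "measure M S \<le> bnd \<delta> n" if \<delta>: "0 < \<delta>" and n: "0 < n" for \<delta> n
    proof -
      obtain A where A: "A \<in> sets M" "AE \<omega> in M. 3 * k \<le> \<bar>X.area_sum u r t n \<omega>\<bar> \<longrightarrow> \<omega> \<in> A"
        "measure M A \<le> (r + \<delta> + (768 * t\<^sup>2 / real n) / \<delta> ^ 3) / K
          + K\<^sup>2 * time_bound K r \<delta> (768 * t\<^sup>2 / real n) / (4 * k\<^sup>2)
          + 48 * t\<^sup>2 / (real n * k\<^sup>2) + measure M {\<omega>\<in>space M. k \<le> \<bar>X.area_rest u r t n \<omega>\<bar>}"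
        using X.area_sum_tail[OF u t r0 K(2) \<delta> n k] by (elim bexE conjE)
      define A' where "A' = {\<omega>\<in>space M. k \<le> \<bar>E n \<omega>\<bar>}"
      have A'M: "A' \<in> sets M" unfolding A'_def using EM by measurable
      have A'P: "measure M A' \<le> 16 * t\<^sup>2 / real n / k\<^sup>2"
        unfolding A'_def by (rule X.chebyshev_nn[OF EM E2[OF n] _ k]) simp
      have "measure M S \<le> measure M (A \<union> A')"
      proof (rule X.finite_measure_mono_AE)
        show "AE \<omega> in M. \<omega> \<in> S \<longrightarrow> \<omega> \<in> A \<union> A'"
          using A(2) area[OF n]
        proof (eventually_elim, intro impI)
          fix \<omega> assume *: "3 * k \<le> \<bar>X.area_sum u r t n \<omega>\<bar> \<longrightarrow> \<omega> \<in> A"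
            and eq: "rel_z (P t \<omega>) (P' t \<omega>) - rel_z a a' = X.area_sum u r t n \<omega> + E n \<omega>" and S: "\<omega> \<in> S"
          have "\<bar>\<kappa>\<bar> \<le> sqrt \<bar>X.area_sum u r t n \<omega> + E n \<omega>\<bar>"
            using S \<kappa> unfolding S_def by (simp add: eq)
          then have "\<kappa>\<^sup>2 \<le> \<bar>X.area_sum u r t n \<omega> + E n \<omega>\<bar>" by (rule sqrt_ge_absD)
          moreover have "\<kappa>\<^sup>2 = 4 * k" by (simp add: k_def K_def power2_eq_square)
          ultimately have "3 * k \<le> \<bar>X.area_sum u r t n \<omega>\<bar> \<or> k \<le> \<bar>E n \<omega>\<bar>" by linarith
          then show "\<omega> \<in> A \<union> A'" using * S by (auto simp: A'_def S_def)
        qed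
      qed (use A(1) A'M in auto)
      also have "\<dots> \<le> measure M A + measure M A'" by (rule measure_Un_le[OF A(1) A'M])
      finally show ?thesis using A(3) A'P unfolding bnd_def by linarith
    qed
    have lim1: "(\<lambda>n. bnd \<delta> n) \<longlonglongrightarrow> (r + \<delta>) / K + K\<^sup>2 * (r * K + K * \<delta> + \<delta>\<^sup>2) / (4 * k\<^sup>2)" if \<delta>: "0 < \<delta>" for \<delta>
    proof -
      have "(\<lambda>n. (48 * t\<^sup>2 / k\<^sup>2) / real n) \<longlonglongrightarrow> 0" by (rule lim_const_over_n)
      then have l1: "(\<lambda>n. 48 * t\<^sup>2 / (real n * k\<^sup>2)) \<longlonglongrightarrow> 0" by (simp add: mult.commute)
      have "(\<lambda>n. (16 * t\<^sup>2 / k\<^sup>2) / real n) \<longlonglongrightarrow> 0" by (rule lim_const_over_n)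
      then have l2: "(\<lambda>n. 16 * t\<^sup>2 / real n / k\<^sup>2) \<longlonglongrightarrow> 0" by (simp add: mult.commute)
      have l3: "(\<lambda>n. measure M {\<omega>\<in>space M. k \<le> \<bar>X.area_rest u r t n \<omega>\<bar>}) \<longlonglongrightarrow> 0"
        by (rule X.AE_tendsto_0_imp_prob_tendsto_0[OF X.area_rest_measurable[OF t] X.area_rest_tendsto_0[OF t] k])
      have "(\<lambda>n. bnd \<delta> n) \<longlonglongrightarrow> (r + \<delta> + 0 / \<delta> ^ 3) / K
        + K\<^sup>2 * (r * K + K * (\<delta> + 0 / \<delta> ^ 3) + (\<delta>\<^sup>2 + 0 / \<delta>\<^sup>2)) / (4 * k\<^sup>2) + 0 + 0 + 0"
        unfolding bnd_def time_bound_def using \<delta> K k by (intro tendsto_intros grid_lim l1 l2 l3) auto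
      then show ?thesis by (simp add: add.assoc)
    qed
    \<comment> \<open>The grid limit has been taken at fixed \<delta>; now \<delta> tends to
      0.\<close>
    have "measure M S \<le> (r + 0) / K + K\<^sup>2 * (r * K + K * 0 + 0\<^sup>2) / (4 * k\<^sup>2)"
    proof (rule tendsto_lowerbound[of "\<lambda>\<delta>. (r + \<delta>) / K + K\<^sup>2 * (r * K + K * \<delta> + \<delta>\<^sup>2) / (4 * k\<^sup>2)" _ "at_right 0"])
      show "((\<lambda>\<delta>. (r + \<delta>) / K + K\<^sup>2 * (r * K + K * \<delta> + \<delta>\<^sup>2) / (4 * k\<^sup>2)) \<longlongrightarrow>
        (r + 0) / K + K\<^sup>2 * (r * K + K * 0 + 0\<^sup>2) / (4 * k\<^sup>2)) (at_right 0)"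
        using K k by (intro tendsto_intros) auto
      show "\<forall>\<^sub>F \<delta> in at_right 0. measure M S \<le> (r + \<delta>) / K + K\<^sup>2 * (r * K + K * \<delta> + \<delta>\<^sup>2) / (4 * k\<^sup>2)"
        using eventually_at_right_less
      proof eventually_elim
        case (elim \<delta>)
        show ?case by (rule LIMSEQ_le_const[OF lim1[OF elim]]) (use le[OF elim] in \<open>auto intro!: exI[of _ 1]\<close>)
      qed
    qed simp
    also have "\<dots> = 5 / 2 * r / \<kappa>"
      using \<kappa> by (simp add: k_def K_def field_simps power2_eq_square)
    finally show ?thesis unfolding S_def .
  qed
qed

section \<open>From weak-type tails to moments\<close>

text \<open>Layers between \<open>2 ^ k * A\<close> and \<open>2 ^ Suc k * A\<close> have
  probability at most \<open>1 / 2 ^ k\<close> and contribute at most the \<open>p\<close>-th power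
  of their upper end, which gives a geometric series.\<close>

lemma (in prob_space) weak_type_moment:
  fixes V :: "'a \<Rightarrow> real"
  assumes p: "0 < p" "p < 1" and V [measurable]: "V \<in> borel_measurable M" and V0: "\<And>\<omega>. 0 \<le> V \<omega>"
    and A: "0 \<le> A" and tail: "\<And>s. 0 < s \<Longrightarrow> prob {\<omega>\<in>space M. s \<le> V \<omega>} \<le> A / s"
  shows "(\<integral>\<^sup>+\<omega>. ennreal (V \<omega> powr p) \<partial>M) \<le> ennreal ((1 + 2 powr p / (1 - 2 powr (p - 1))) * A powr p)"
proof (cases "A = 0")
  case True
  \<comment> \<open>For \<open>A = 0\<close> all layers degenerate, but the tail bound then says
    that \<open>V\<close> vanishes almost surely.\<close>
  have "AE \<omega> in M. \<forall>k::nat. V \<omega> < 1 / real (Suc k)"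
  proof (subst AE_all_countable, rule allI)
    fix k :: nat
    have "prob {\<omega>\<in>space M. 1 / real (Suc k) \<le> V \<omega>} = 0"
      using tail[of "1 / real (Suc k)"] True by (simp add: measure_le_0_iff)
    moreover have "{\<omega>\<in>space M. 1 / real (Suc k) \<le> V \<omega>} \<in> events" by measurable
    ultimately have "AE \<omega> in M. \<omega> \<notin> {\<omega>\<in>space M. 1 / real (Suc k) \<le> V \<omega>}"
      using prob_eq_0 by blast
    then show "AE \<omega> in M. V \<omega> < 1 / real (Suc k)"
      using AE_space by eventually_elim (simp add: not_le)
  qed
  then have "AE \<omega> in M. V \<omega> powr p = 0"
  proof eventually_elim
    case (elim \<omega>)
    have "V \<omega> = 0"
    proof (rule ccontr)
      assume "V \<omega> \<noteq> 0"
      then obtain k :: nat where "1 / real (Suc k) < V \<omega>" using V0[of \<omega>] nat_approx_posE[of "V \<omega>"] by auto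
      then show False using spec[OF elim, of k] by (rule less_asym)
    qed
    then show ?case by simp
  qed
  then have "(\<integral>\<^sup>+\<omega>. ennreal (V \<omega> powr p) \<partial>M) = (\<integral>\<^sup>+\<omega>. 0 \<partial>M)"
    by (intro nn_integral_cong_AE) auto
  then show ?thesis by simp
next
  case False
  then have A: "0 < A" using A by simp
  define c where "c k = (2 ^ Suc k * A) powr p" for k :: nat
  define E where "E k = {\<omega>\<in>space M. 2 ^ k * A \<le> V \<omega>}" for k :: nat
  have E: "E k \<in> events" for k unfolding E_def by measurable
  \<comment> \<open>The ratio of the series; it is below 1 precisely because
    \<open>p < 1\<close>.\<close>
  define x where "x = (2::real) powr (p - 1)"
  have x: "0 < x" "x < 1" using p powr_less_mono[of "p - 1" 0 "2::real"] by (simp_all add: x_def)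
  have ck: "c k * (1 / 2 ^ k) = 2 powr p * A powr p * x ^ k" for k
  proof -
    have "c k = (2 powr p) ^ Suc k * A powr p"
    proof -
      have "((2::real) ^ Suc k) powr p = (2 powr real (Suc k)) powr p" by (subst powr_realpow) simp_all
      also have "\<dots> = (2 powr p) ^ Suc k" by (simp only: powr_powr powr_power mult.commute)
      finally show ?thesis unfolding c_def by (simp only: powr_mult)
    qed
    moreover have "x ^ k = (2 powr p) ^ k / 2 ^ k"
      unfolding x_def by (simp add: powr_diff power_divide)
    ultimately show ?thesis by simp
  qed
  have pointwise: "ennreal (V \<omega> powr p) \<le> ennreal (A powr p) + (\<Sum>k. ennreal (c k) * indicator (E k) \<omega>)"
    if \<omega>: "\<omega> \<in> space M" for \<omega>
  proof (cases "V \<omega> < A")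
    case True
    then have "V \<omega> powr p \<le> A powr p" using V0[of \<omega>] p by (intro powr_mono2) auto
    then have "ennreal (V \<omega> powr p) \<le> ennreal (A powr p) + 0" by (simp add: ennreal_leI)
    also have "\<dots> \<le> ennreal (A powr p) + (\<Sum>k. ennreal (c k) * indicator (E k) \<omega>)"
      by (intro add_left_mono) simp
    finally show ?thesis .
  next
    case False
    obtain N :: nat where "V \<omega> / A < 2 ^ N" using real_arch_pow[of 2 "V \<omega> / A"] by auto
    then have N: "V \<omega> < 2 ^ N * A" using A by (simp add: field_simps)
    \<comment> \<open>The least dyadic level above the value; it is positive since the value is at
      least \<open>A\<close>, and its predecessor \<open>k\<close> is the layer that contains the
      value.\<close>
    define m where "m = (LEAST k. V \<omega> < 2 ^ k * A)"
    have m: "V \<omega> < 2 ^ m * A" unfolding m_def by (rule LeastI[of _ N]) fact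
    then obtain k where k: "m = Suc k" using False by (cases m) auto
    have "\<not> V \<omega> < 2 ^ k * A" using not_less_Least[of k "\<lambda>k. V \<omega> < 2 ^ k * A"] k m_def by simp
    then have in_E: "\<omega> \<in> E k" using \<omega> by (simp add: E_def not_less)
    have "V \<omega> powr p \<le> c k"
      unfolding c_def using m V0[of \<omega>] p k by (intro powr_mono2) auto
    define f where "f j = ennreal (c j) * indicator (E j) \<omega>" for j
    have "ennreal (V \<omega> powr p) \<le> f k"
      using in_E \<open>V \<omega> powr p \<le> c k\<close> by (simp add: f_def ennreal_leI)
    also have "f k \<le> (\<Sum>k. f k)"
      using sum_le_suminf[of f "{k}"] by simp
    also have "\<dots> \<le> ennreal (A powr p) + (\<Sum>k. f k)" by simp
    finally show ?thesis unfolding f_def .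
  qed
  have "(\<integral>\<^sup>+\<omega>. ennreal (V \<omega> powr p) \<partial>M) \<le> (\<integral>\<^sup>+\<omega>. ennreal (A powr p) + (\<Sum>k. ennreal (c k) * indicator (E k) \<omega>) \<partial>M)"
    by (intro nn_integral_mono pointwise)
  also have "\<dots> = ennreal (A powr p) + (\<Sum>k. ennreal (c k) * emeasure M (E k))"
    using E by (simp add: nn_integral_add nn_integral_suminf nn_integral_cmult_indicator emeasure_space_1)
  also have "\<dots> \<le> ennreal (A powr p) + (\<Sum>k. ennreal (2 powr p * A powr p * x ^ k))"
  proof (intro add_left_mono suminf_le)
    fix k
    have "prob (E k) \<le> 1 / 2 ^ k" using tail[of "2 ^ k * A"] A by (simp add: E_def)
    then have "c k * prob (E k) \<le> c k * (1 / 2 ^ k)" by (intro mult_left_mono) (simp_all add: c_def)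
    then show "ennreal (c k) * emeasure M (E k) \<le> ennreal (2 powr p * A powr p * x ^ k)"
      unfolding ck by (simp add: emeasure_eq_measure ennreal_mult[symmetric] c_def ennreal_leI)
  qed auto
  also have "(\<Sum>k. ennreal (2 powr p * A powr p * x ^ k)) = ennreal (2 powr p * A powr p * (1 / (1 - x)))"
  proof (rule suminf_ennreal_eq)
    show "0 \<le> 2 powr p * A powr p * x ^ k" for k using x by simp
    show "(\<lambda>k. 2 powr p * A powr p * x ^ k) sums (2 powr p * A powr p * (1 / (1 - x)))"
      using x by (intro sums_mult geometric_sums) simp
  qed
  also have "ennreal (A powr p) + ennreal (2 powr p * A powr p * (1 / (1 - x))) = ennreal (A powr p + 2 powr p * A powr p * (1 / (1 - x)))"
    using x by (intro ennreal_plus[symmetric]) auto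
  also have "A powr p + 2 powr p * A powr p * (1 / (1 - x)) = (1 + 2 powr p / (1 - 2 powr (p - 1))) * A powr p"
    by (simp add: x_def field_simps)
  finally show ?thesis .
qed

lemma powr_add3_le:
  fixes x y z p :: real
  assumes "0 \<le> x" "0 \<le> y" "0 \<le> z" "0 < p"
  shows "(x + y + z) powr p \<le> 3 powr p * (x powr p + y powr p + z powr p)"
proof -
  define m where "m = max x (max y z)"
  have "(x + y + z) powr p \<le> (3 * m) powr p"
    using assms by (intro powr_mono2) (auto simp: m_def)
  also have "\<dots> = 3 powr p * m powr p" by (rule powr_mult)
  also have "\<dots> \<le> 3 powr p * (x powr p + y powr p + z powr p)"
    by (intro mult_left_mono) (auto simp: m_def max_def)
  finally show ?thesis .
qed

text \<open>The gauge at time \<open>t\<close> is at most the horizontal distance plus the roots of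
  the initial height and of its change. Two of these have weak-type tails of order
  \<open>r / s\<close>, the third is constant, and all resulting bounds are powers of the initial
  gauge. The constant depends on \<open>p\<close> only.\<close>

lemma reflection_coupling_moment:
  fixes p :: real
  assumes p: "0 < p" "p < 1"
  shows "\<exists>C\<ge>0. \<forall>(M :: 'w measure) a a' P P' t. reflection_coupling M a a' P P' \<longrightarrow> 0 \<le> t \<longrightarrow>
    (\<integral>\<^sup>+ \<omega>. ennreal (dist_H (P t \<omega>) (P' t \<omega>) powr p) \<partial>M) \<le> ennreal (C * dist_H a a' powr p)"
proof -
  define C0 where "C0 = 1 + 2 powr p / (1 - 2 powr (p - 1))"
  have C0: "C0 \<ge> 0" using p powr_less_mono[of "p - 1" 0 "2::real"] by (simp add: C0_def)
  define C1 where "C1 = C0 + 1 + C0 * (5 / 2) powr p"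
  have C1: "C1 \<ge> 0" using C0 by (simp add: C1_def)
  \<comment> \<open>\<open>2100 = 700 * 3\<close> combines the upper comparison with the splitting
    into three terms, whose contributions are collected in \<open>C1\<close>; the last factor
    returns from the gauge to the distance.\<close>
  define C where "C = 2100 powr p * C1 * 3 powr p"
  show ?thesis
  proof (intro exI[of _ C] conjI allI impI)
    show "0 \<le> C" using C1 by (simp add: C_def)
    fix M :: "'w measure" and a a' P P' and t :: real
    assume rc: "reflection_coupling M a a' P P'" and t: "0 \<le> t"
    note tails = reflection_coupling_tails[OF rc t]
    interpret prob_space M by (rule tails(1))
    define r where "r = norm (hor a' - hor a)"
    define D where "D \<omega> = norm (hor (P' t \<omega>) - hor (P t \<omega>))" for \<omega>
    define V where "V \<omega> = sqrt \<bar>rel_z (P t \<omega>) (P' t \<omega>) - rel_z a a'\<bar>" for \<omega>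
    define z where "z = sqrt \<bar>rel_z a a'\<bar>"
    have PM: "P t \<in> borel_measurable M" "P' t \<in> borel_measurable M"
      using rc t by (simp_all add: reflection_coupling_def heis_BM_def)
    note comp = heis_coords_measurable[OF PM(1)] heis_coords_measurable[OF PM(2)]
    have VM: "V \<in> borel_measurable M"
      unfolding V_def[abs_def] rel_z_eq using comp by measurable
    have DM: "D \<in> borel_measurable M"
      unfolding D_def[abs_def] hor_eq diff_Pair norm_Pair using comp by measurable
    have powM: "(\<lambda>\<omega>. ennreal (f \<omega> powr p)) \<in> borel_measurable M" if [measurable]: "f \<in> borel_measurable M" for f :: "'w \<Rightarrow> real"
      by measurable
    have r0: "0 \<le> r" by (simp add: r_def)
    have ED: "(\<integral>\<^sup>+\<omega>. ennreal (D \<omega> powr p) \<partial>M) \<le> ennreal (C0 * r powr p)"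
      unfolding C0_def by (rule weak_type_moment[OF p DM _ r0]) (use tails(2) in \<open>simp_all add: D_def r_def\<close>)
    have EV: "(\<integral>\<^sup>+\<omega>. ennreal (V \<omega> powr p) \<partial>M) \<le> ennreal (C0 * (5 / 2 * r) powr p)"
      unfolding C0_def by (rule weak_type_moment[OF p VM]) (use tails(3) r0 in \<open>simp_all add: V_def r_def\<close>)
    have bound: "dist_H (P t \<omega>) (P' t \<omega>) powr p \<le> 2100 powr p * (D \<omega> powr p + z powr p + V \<omega> powr p)" for \<omega>
    proof -
      have "sqrt \<bar>rel_z (P t \<omega>) (P' t \<omega>)\<bar> \<le> sqrt (\<bar>rel_z a a'\<bar> + \<bar>rel_z (P t \<omega>) (P' t \<omega>) - rel_z a a'\<bar>)"
        by simp
      also have "\<dots> \<le> z + V \<omega>" unfolding z_def V_def by (rule sqrt_add_le_add_sqrt) auto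
      finally have "hgauge (P t \<omega>) (P' t \<omega>) \<le> D \<omega> + z + V \<omega>" by (simp add: hgauge_def D_def)
      then have "dist_H (P t \<omega>) (P' t \<omega>) \<le> 700 * (D \<omega> + z + V \<omega>)"
        by (intro order.trans[OF dist_H_le] mult_left_mono) simp_all
      then have "dist_H (P t \<omega>) (P' t \<omega>) powr p \<le> (700 * (D \<omega> + z + V \<omega>)) powr p"
        using p dist_H_nonneg by (intro powr_mono2) auto
      also have "\<dots> = 700 powr p * (D \<omega> + z + V \<omega>) powr p"
        by (rule powr_mult)
      also have "\<dots> \<le> 700 powr p * (3 powr p * (D \<omega> powr p + z powr p + V \<omega> powr p))"
        using p by (intro mult_left_mono powr_add3_le) (simp_all add: D_def z_def V_def)
      also have "\<dots> = 2100 powr p * (D \<omega> powr p + z powr p + V \<omega> powr p)"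
        using powr_mult[of 700 3 p] by simp
      finally show ?thesis .
    qed
    have "(\<integral>\<^sup>+ \<omega>. ennreal (dist_H (P t \<omega>) (P' t \<omega>) powr p) \<partial>M)
      \<le> (\<integral>\<^sup>+\<omega>. ennreal (2100 powr p) * (ennreal (D \<omega> powr p) + ennreal (z powr p) + ennreal (V \<omega> powr p)) \<partial>M)"
    proof (rule nn_integral_mono)
      fix \<omega>
      have "ennreal (dist_H (P t \<omega>) (P' t \<omega>) powr p) \<le> ennreal (2100 powr p * (D \<omega> powr p + z powr p + V \<omega> powr p))"
        by (rule ennreal_leI[OF bound])
      also have "\<dots> = ennreal (2100 powr p) * (ennreal (D \<omega> powr p) + ennreal (z powr p) + ennreal (V \<omega> powr p))"
        by (simp add: ennreal_mult ennreal_plus)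
      finally show "ennreal (dist_H (P t \<omega>) (P' t \<omega>) powr p)
        \<le> ennreal (2100 powr p) * (ennreal (D \<omega> powr p) + ennreal (z powr p) + ennreal (V \<omega> powr p))" .
    qed
    also have "\<dots> = ennreal (2100 powr p) * ((\<integral>\<^sup>+\<omega>. ennreal (D \<omega> powr p) \<partial>M) + ennreal (z powr p) + (\<integral>\<^sup>+\<omega>. ennreal (V \<omega> powr p) \<partial>M))"
      using powM[OF DM] powM[OF VM] by (simp add: nn_integral_cmult nn_integral_add emeasure_space_1)
    also have "\<dots> \<le> ennreal (2100 powr p) * (ennreal (C0 * r powr p) + ennreal (z powr p) + ennreal (C0 * (5 / 2 * r) powr p))"
      by (intro mult_left_mono add_mono ED EV) auto
    also have "\<dots> = ennreal (2100 powr p * (C0 * r powr p + z powr p + C0 * (5 / 2 * r) powr p))"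
      using C0 by (simp add: ennreal_mult ennreal_plus)
    also have "\<dots> \<le> ennreal (C * dist_H a a' powr p)"
    proof (rule ennreal_leI)
      have rg: "r \<le> hgauge a a'" and zg: "z \<le> hgauge a a'" by (simp_all add: hgauge_def r_def z_def)
      have "r powr p \<le> hgauge a a' powr p" "z powr p \<le> hgauge a a' powr p"
        using rg zg r0 p by (auto intro!: powr_mono2 simp: z_def)
      moreover have "(5 / 2 * r) powr p = (5 / 2) powr p * r powr p" by (rule powr_mult)
      ultimately have "C0 * r powr p + z powr p + C0 * (5 / 2 * r) powr p
        \<le> C0 * hgauge a a' powr p + hgauge a a' powr p + C0 * ((5 / 2) powr p * hgauge a a' powr p)"
        using C0 by (simp only:) (intro add_mono mult_left_mono; simp)
      also have "\<dots> = C1 * hgauge a a' powr p" by (simp add: C1_def algebra_simps)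
      also have "\<dots> \<le> C1 * (3 powr p * dist_H a a' powr p)"
      proof (rule mult_left_mono[OF _ C1])
        have "hgauge a a' powr p \<le> (3 * dist_H a a') powr p"
          using hgauge_le hgauge_nonneg p by (intro powr_mono2) auto
        also have "\<dots> = 3 powr p * dist_H a a' powr p" by (rule powr_mult)
        finally show "hgauge a a' powr p \<le> 3 powr p * dist_H a a' powr p" .
      qed
      finally have "2100 powr p * (C0 * r powr p + z powr p + C0 * (5 / 2 * r) powr p)
        \<le> 2100 powr p * (C1 * (3 powr p * dist_H a a' powr p))" by (intro mult_left_mono) auto
      then show "2100 powr p * (C0 * r powr p + z powr p + C0 * (5 / 2 * r) powr p) \<le> C * dist_H a a' powr p"
        by (simp add: C_def mult_ac)
    qed
    finally show "(\<integral>\<^sup>+ \<omega>. ennreal (dist_H (P t \<omega>) (P' t \<omega>) powr p) \<partial>M) \<le> ennreal (C * dist_H a a' powr p)" .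
  qed
qed

text \<open>A vanishing gauge forces equal horizontal parts, and then equal heights. Positivity
  makes the quotient in the second claim meaningful.\<close>

lemma dist_H_pos:
  assumes "a \<noteq> a'" shows "0 < dist_H a a'"
proof -
  have "0 < hgauge a a'"
  proof (rule ccontr)
    assume "\<not> 0 < hgauge a a'"
    then have "hgauge a a' = 0" using hgauge_nonneg[of a a'] by linarith
    then have "hor a' = hor a" "rel_z a a' = 0"
      by (simp_all add: hgauge_def add_nonneg_eq_0_iff)
    then have "a = a'" by (cases a; cases a') auto
    then show False using assms by simp
  qed
  then show ?thesis using hgauge_le[of a a'] by linarith
qed

text \<open>Both claims come from one bound whose constant is uniform in the time, the starting
  points and the probability space: the first because the initial distance is finite, the second
  after division by it.\<close>

theorem theorem1p8:
  fixes p :: real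
  assumes "0 < p" and "p < 1"
  shows
    "(\<forall>(M :: 'w measure) a a' P P'. reflection_coupling M a a' P P' \<longrightarrow>
        (SUP t\<in>{0..}. \<integral>\<^sup>+ \<omega>. ennreal (dist_H (P t \<omega>) (P' t \<omega>) powr p) \<partial>M) < \<infinity>) \<and>
     (\<forall>(M :: heis \<Rightarrow> heis \<Rightarrow> 'w measure) P P'.
        (\<forall>a a'. a \<noteq> a' \<longrightarrow> reflection_coupling (M a a') a a' (P a a') (P' a a')) \<longrightarrow>
        (SUP (a, a') \<in> {(a, a'). a \<noteq> a'}. SUP t\<in>{0..}.
            (\<integral>\<^sup>+ \<omega>. ennreal (dist_H (P a a' t \<omega>) (P' a a' t \<omega>) powr p) \<partial>(M a a'))
              / ennreal (dist_H a a' powr p)) < \<infinity>)"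
proof -
  obtain C where C: "C \<ge> 0" and bound: "\<forall>(M :: 'w measure) a a' P P' t. reflection_coupling M a a' P P' \<longrightarrow> 0 \<le> t \<longrightarrow>
    (\<integral>\<^sup>+ \<omega>. ennreal (dist_H (P t \<omega>) (P' t \<omega>) powr p) \<partial>M) \<le> ennreal (C * dist_H a a' powr p)"
    using reflection_coupling_moment[OF assms, where 'w = 'w] by (elim exE conjE)
  show ?thesis
  proof (intro conjI allI impI)
    fix M :: "'w measure" and a a' P P' assume rc: "reflection_coupling M a a' P P'"
    have "(SUP t\<in>{0..}. \<integral>\<^sup>+ \<omega>. ennreal (dist_H (P t \<omega>) (P' t \<omega>) powr p) \<partial>M) \<le> ennreal (C * dist_H a a' powr p)"
      using bound[rule_format, OF rc] by (intro SUP_least) auto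
    then show "(SUP t\<in>{0..}. \<integral>\<^sup>+ \<omega>. ennreal (dist_H (P t \<omega>) (P' t \<omega>) powr p) \<partial>M) < \<infinity>"
      by (rule le_less_trans) simp
  next
    fix M :: "heis \<Rightarrow> heis \<Rightarrow> 'w measure" and P P'
    assume rc: "\<forall>a a'. a \<noteq> a' \<longrightarrow> reflection_coupling (M a a') a a' (P a a') (P' a a')"
    have key: "(SUP t\<in>{0..}. (\<integral>\<^sup>+ \<omega>. ennreal (dist_H (P a a' t \<omega>) (P' a a' t \<omega>) powr p) \<partial>(M a a'))
      / ennreal (dist_H a a' powr p)) \<le> ennreal C" if ne: "a \<noteq> a'" for a a'
    proof (rule SUP_least)
      fix t :: real assume t: "t \<in> {0..}"
      have pos: "0 < dist_H a a' powr p" using dist_H_pos[OF ne] by simp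
      have "(\<integral>\<^sup>+ \<omega>. ennreal (dist_H (P a a' t \<omega>) (P' a a' t \<omega>) powr p) \<partial>(M a a')) / ennreal (dist_H a a' powr p)
        \<le> ennreal (C * dist_H a a' powr p) / ennreal (dist_H a a' powr p)"
        using t by (intro divide_right_mono_ennreal bound[rule_format] rc[rule_format, OF ne]) simp
      also have "\<dots> = ennreal C"
        using pos C by (subst divide_ennreal) auto
      finally show "(\<integral>\<^sup>+ \<omega>. ennreal (dist_H (P a a' t \<omega>) (P' a a' t \<omega>) powr p) \<partial>(M a a')) / ennreal (dist_H a a' powr p) \<le> ennreal C" .
    qed
    have "(SUP (a, a') \<in> {(a, a'). a \<noteq> a'}. SUP t\<in>{0..}.
            (\<integral>\<^sup>+ \<omega>. ennreal (dist_H (P a a' t \<omega>) (P' a a' t \<omega>) powr p) \<partial>(M a a'))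
              / ennreal (dist_H a a' powr p)) \<le> ennreal C"
    proof (rule SUP_least)
      fix x :: "heis \<times> heis" assume "x \<in> {(a, a'). a \<noteq> a'}"
      then have "fst x \<noteq> snd x" by (simp only: mem_Collect_eq case_prod_unfold not_False_eq_True)
      from key[OF this] show "(case x of (a, a') \<Rightarrow> SUP t\<in>{0..}.
            (\<integral>\<^sup>+ \<omega>. ennreal (dist_H (P a a' t \<omega>) (P' a a' t \<omega>) powr p) \<partial>(M a a'))
              / ennreal (dist_H a a' powr p)) \<le> ennreal C"
        unfolding case_prod_unfold .
    qed
    then show "(SUP (a, a') \<in> {(a, a'). a \<noteq> a'}. SUP t\<in>{0..}.
            (\<integral>\<^sup>+ \<omega>. ennreal (dist_H (P a a' t \<omega>) (P' a a' t \<omega>) powr p) \<partial>(M a a'))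
              / ennreal (dist_H a a' powr p)) < \<infinity>"
      by (rule le_less_trans) simp
  qed
qed

end
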